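(* Assume $t^{1/2}$, $t_0^{1/2}$ and $t_k^{1/2}$ are invertible, $t^{1/2}$ is not a root of unity, and $$t_0^{1/2}t_k^{1/2},\ -t_0^{-1/2}t_k^{1/2}\notin\{1,-1,t^{\pm1/2},-t^{\pm1/2},t^{\pm1},-t^{\pm1}\}\quad\text{and}\quad t_0^{1/2}t_k^{1/2}\ne(-t_0^{-1/2}t_k^{1/2})^{\pm1}.$$ (a) Let $(\mathbf{c},J)$ be a skew local region and let $z\in\mathbb{C}^\times$. Define $$H_k^{(z,\mathbf{c},J)}=\mathrm{span}_{\mathbb{C}}\{v_w: w\in\mathcal{F}^{(\mathbf{c},J)}\},$$ so that the symbols $v_w$ are a labeled basis of the vector space $H_k^{(z,\mathbf{c},J)}$. Let $\gamma_i=-t^{c_i}$ for $i=1,\dots,k$ and $\gamma_0=z\gamma_{w^{-1}(1)}^{-1}\cdots\gamma_{w^{-1}(k)}^{-1}$. Then the following formulas make $H_k^{(z,\mathbf{c},J)}$ into an irreducible $H_k^{\mathrm{ext}}$-module: $$PW_1\cdots W_kv_w=zv_w,\qquad Pv_w=\gamma_0v_w,\qquad W_iv_w=\gamma_{w^{-1}(i)}v_w,$$ $$T_iv_w=[T_i]_{ww}v_w+\sqrt{-([T_i]_{ww}-t^{1/2})([T_i]_{ww}+t^{-1/2})}\;v_{s_iw}\quad(i=1,\dots,k-1),$$ $$T_0v_w=[T_0]_{ww}v_w+\sqrt{-([T_0]_{ww}-t_0^{1/2})([T_0]_{ww}+t_0^{-1/2})}\;v_{s_0w},$$ where $v_{s_iw}=0$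 if $s_iw\notin\mathcal{F}^{(\mathbf{c},J)}$, and $$[T_i]_{ww}=\frac{t^{1/2}-t^{-1/2}}{1-\gamma_{w^{-1}(i)}\gamma_{w^{-1}(i+1)}^{-1}},\qquad [T_0]_{ww}=\frac{(t_0^{1/2}-t_0^{-1/2})+(t_k^{1/2}-t_k^{-1/2})\gamma_{w^{-1}(1)}^{-1}}{1-\gamma_{w^{-1}(1)}^{-2}}.$$ (b) The map $$\mathbb{C}^\times\times\{\text{skew local regions }(\mathbf{c},J)\}\longleftrightarrow\{\text{irreducible calibrated }H_k^{\mathrm{ext}}\text{-modules}\},\qquad (z,\mathbf{c},J)\longmapsto H_k^{(z,\mathbf{c},J)}$$ is a bijection.
   Context: The extended two boundary (affine type C) Hecke algebra $H_k^{\mathrm{ext}}$ is the $\mathbb{C}$-algebra with generators $T_0,\dots,T_{k-1}$ and invertible generators $W_0,\dots,W_k$ and relations (those involving nonexistent generators are omitted): $W_0$ is central; $T_0T_1T_0T_1=T_1T_0T_1T_0$; $T_iT_{i+1}T_i=T_{i+1}T_iT_{i+1}$ for $1\le i\le k-2$; $T_iT_j=T_jT_i$ for $|i-j|\ge2$; $W_iW_j=W_jW_i$; $T_0W_j=W_jT_0$ for $j\ne1$; $T_iW_j=W_jT_i$ for $1\le i\le k-1$, $j\ne i,i+1$; $(T_0-t_0^{1/2})(T_0+t_0^{-1/2})=0$; $(T_i-t^{1/2})(T_i+t^{-1/2})=0$ for $1\le i\le k-1$; for $1\le i\le k-1$, $T_iW_i=W_{i+1}T_i+(t^{1/2}-t^{-1/2})\frac{W_i-W_{i+1}}{1-W_iW_{i+1}^{-1}}$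 and $T_iW_{i+1}=W_iT_i+(t^{1/2}-t^{-1/2})\frac{W_{i+1}-W_i}{1-W_iW_{i+1}^{-1}}$; and $T_0W_1=W_1^{-1}T_0+\big((t_0^{1/2}-t_0^{-1/2})+(t_k^{1/2}-t_k^{-1/2})W_1^{-1}\big)\frac{W_1-W_1^{-1}}{1-W_1^{-2}}$. The element $P$ is determined by $W_0=PW_1\cdots W_k$. An $H_k^{\mathrm{ext}}$-module is calibrated if $W_0,W_1,\dots,W_k$ are simultaneously diagonalizable on it, i.e. it has a basis of simultaneous eigenvectors for $W_0,\dots,W_k$. $\mathcal{W}_0$ is the group of signed permutations: bijections $w$ of $\{-k,\dots,-1,1,\dots,k\}$ with $w(-i)=-w(i)$. It is generated by $s_0$ (swapping $1,-1$) and $s_i$ (swapping $i,i+1$ and $-i,-(i+1)$), $1\le i\le k-1$. For $\mathbf{c}=(c_1,\dots,c_k)\in\mathbb{C}^k$ put $c_{-i}=-c_i$ (so $\gamma_{-i}=-t^{c_{-i}}=\gamma_i^{-1}$); $\mathcal{W}_0$ acts by $w\mathbf{c}=(c_{w^{-1}(1)},\dots,c_{w^{-1}(k)})$, and $(w\mathbf{c})_i=c_{w^{-1}(i)}$. Here $t^s$ denotes a complex power of $t$, and $r_1,r_2$ are defined by $-t^{r_1}=-t_k^{1/2}t_0^{-1/2}$ and $-t^{r_2}=t_k^{1/2}t_0^{1/2}$. Let $\varepsilon_1,\dots,\varepsilon_k$ be the standard basis of $(\mathbb{R}^k)^*$. Define $$R(w)=\{\varepsilon_i: i>0,\ w(i)<0\}\sqcup\{\varepsilon_j-\varepsilon_i: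 0<i<j,\ w(i)>w(j)\}\sqcup\{\varepsilon_j+\varepsilon_i: 0<i<j,\ -w(i)>w(j)\},$$ $$Z(\mathbf{c})=\{\varepsilon_i: c_i=0\}\sqcup\{\varepsilon_j-\varepsilon_i:0<i<j,\ c_j-c_i=0\}\sqcup\{\varepsilon_j+\varepsilon_i:0<i<j,\ c_j+c_i=0\},$$ $$P(\mathbf{c})=\{\varepsilon_i: c_i\in\{\pm r_1,\pm r_2\}\}\sqcup\{\varepsilon_j-\varepsilon_i:0<i<j,\ c_j-c_i=\pm1\}\sqcup\{\varepsilon_j+\varepsilon_i:0<i<j,\ c_j+c_i=\pm1\}.$$ A local region is a pair $(\mathbf{c},J)$ with $\mathbf{c}\in\mathbb{C}^k$ and $J\subseteq P(\mathbf{c})$; $\mathcal{F}^{(\mathbf{c},J)}=\{w\in\mathcal{W}_0:R(w)\cap Z(\mathbf{c})=\emptyset,\ R(w)\cap P(\mathbf{c})=J\}$. A skew local region is a local region $(\mathbf{c},J)$ such that if $w\in\mathcal{F}^{(\mathbf{c},J)}$ then $w\mathbf{c}=((w\mathbf{c})_1,\dots,(w\mathbf{c})_k)$ satisfies $$(w\mathbf{c})_1\ne0,\quad (w\mathbf{c})_2\ne0,\quad (w\mathbf{c})_1\ne-(w\mathbf{c})_2,$$ $$(w\mathbf{c})_i\ne(w\mathbf{c})_{i+1}\ \text{for } i=1,\dots,k-1,\quad\text{and}\quad (w\mathbf{c})_i\ne(w\mathbf{c})_{i+2}\ \text{for } i=1,\dots,k-2.$$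
   Formalization: Equations between exponents are read modulo the period of t^s, with c_i=0 read as γ_i=±1; irreducibility and the labels in (b) require F^(c,J) nonempty; in (b) c runs over one representative per orbit of W_0 and period shifts, and modules are taken up to isomorphism. *)

theory Defs
  imports Complex_Main "HOL-Library.Function_Algebras" "HOL-Combinatorics.Permutations"
begin

(* Parameters: q, q0, qk are the fixed square roots t^(1/2), t_0^(1/2), t_k^(1/2), and tau is a
   logarithm of t compatible with q, i.e. exp (tau/2) = q. *)

section \<open>Modules of the extended two boundary Hecke algebra\<close>

text \<open>A module is a subspace \<open>hcar\<close> of a complex vector space (with scalar multiplication
  \<open>hscl\<close>) and operators \<open>hT i\<close> and \<open>hW j\<close> by which the generators act.  Only
  \<open>hT i\<close> for \<open>i < k\<close> and \<open>hW j\<close> for \<open>j \<le> k\<close>, and only their values on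
  \<open>hcar\<close>, are meaningful.\<close>

record 'v hmod =
  hcar :: "'v set"
  hscl :: "complex \<Rightarrow> 'v \<Rightarrow> 'v"
  hT :: "nat \<Rightarrow> 'v \<Rightarrow> 'v"
  hW :: "nat \<Rightarrow> 'v \<Rightarrow> 'v"

definition hWinv :: "'v hmod \<Rightarrow> nat \<Rightarrow> 'v \<Rightarrow> 'v" where
  "hWinv M j = inv_into (hcar M) (hW M j)"

definition linear_endo :: "('v::ab_group_add) hmod \<Rightarrow> ('v \<Rightarrow> 'v) \<Rightarrow> bool" where
  "linear_endo M f \<longleftrightarrow>
     (\<forall>x\<in>hcar M. f x \<in> hcar M) \<and>
     (\<forall>x\<in>hcar M. \<forall>y\<in>hcar M. f (x + y) = f x + f y) \<and>
     (\<forall>a. \<forall>x\<in>hcar M. f (hscl M a x) = hscl M a (f x))"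

text \<open>\<open>(T - p)(T + 1/p) = 0\<close>\<close>
definition quadratic_rel :: "('v::ab_group_add) hmod \<Rightarrow> ('v \<Rightarrow> 'v) \<Rightarrow> complex \<Rightarrow> bool" where
  "quadratic_rel M T p \<longleftrightarrow>
     (\<forall>v\<in>hcar M. let u = T v + hscl M (inverse p) v in T u - hscl M p u = 0)"

text \<open>The fractions in the last three relations denote Laurent polynomials in the commuting
  invertible elements \<open>W_j\<close>:
  \<open>(W_i - W_{i+1}) / (1 - W_i W_{i+1}^{-1}) = - W_{i+1}\<close>,
  \<open>(W_{i+1} - W_i) / (1 - W_i W_{i+1}^{-1}) = W_{i+1}\<close> and
  \<open>(W_1 - W_1^{-1}) / (1 - W_1^{-2}) = W_1\<close>.\<close>

definition hecke_module ::
  "nat \<Rightarrow> complex \<Rightarrow> complex \<Rightarrow> complex \<Rightarrow> ('v::ab_group_add) hmod \<Rightarrow> bool" where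
  "hecke_module k q q0 qk M \<longleftrightarrow>
     vector_space (hscl M) \<and> module.subspace (hscl M) (hcar M) \<and>
     (\<forall>i<k. linear_endo M (hT M i)) \<and>
     (\<forall>j\<le>k. linear_endo M (hW M j) \<and> bij_betw (hW M j) (hcar M) (hcar M)) \<and>
     (\<forall>v\<in>hcar M.
        (\<forall>i<k. hW M 0 (hT M i v) = hT M i (hW M 0 v)) \<and>
        (k \<ge> 2 \<longrightarrow>
           hT M 0 (hT M 1 (hT M 0 (hT M 1 v))) = hT M 1 (hT M 0 (hT M 1 (hT M 0 v)))) \<and>
        (\<forall>i. 1 \<le> i \<and> i + 1 < k \<longrightarrow>
           hT M i (hT M (i+1) (hT M i v)) = hT M (i+1) (hT M i (hT M (i+1) v))) \<and>
        (\<forall>i<k. \<forall>j<k. i + 2 \<le> j \<longrightarrow> hT M i (hT M j v) = hT M j (hT M i v)) \<and>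
        (\<forall>i\<le>k. \<forall>j\<le>k. hW M i (hW M j v) = hW M j (hW M i v)) \<and>
        (\<forall>j\<le>k. j \<noteq> 1 \<longrightarrow> hT M 0 (hW M j v) = hW M j (hT M 0 v)) \<and>
        (\<forall>i j. 1 \<le> i \<and> i < k \<and> j \<le> k \<and> j \<noteq> i \<and> j \<noteq> i + 1 \<longrightarrow>
           hT M i (hW M j v) = hW M j (hT M i v)) \<and>
        (\<forall>i. 1 \<le> i \<and> i < k \<longrightarrow>
           hT M i (hW M i v) =
             hW M (i+1) (hT M i v) + hscl M (q - inverse q) (- hW M (i+1) v) \<and>
           hT M i (hW M (i+1) v) =
             hW M i (hT M i v) + hscl M (q - inverse q) (hW M (i+1) v)) \<and>
        hT M 0 (hW M 1 v) =
          hWinv M 1 (hT M 0 v)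
          + hscl M (q0 - inverse q0) (hW M 1 v)
          + hscl M (qk - inverse qk) (hWinv M 1 (hW M 1 v))) \<and>
     quadratic_rel M (hT M 0) q0 \<and>
     (\<forall>i. 1 \<le> i \<and> i < k \<longrightarrow> quadratic_rel M (hT M i) q)"

text \<open>The action of the product \<open>W_1 \<dots> W_k\<close>, and of \<open>P = W_0 (W_1 \<dots> W_k)^{-1}\<close>.\<close>
definition hWprod :: "nat \<Rightarrow> 'v hmod \<Rightarrow> 'v \<Rightarrow> 'v" where
  "hWprod k M v = foldr (hW M) [1..<Suc k] v"

definition hP :: "nat \<Rightarrow> 'v hmod \<Rightarrow> 'v \<Rightarrow> 'v" where
  "hP k M v = hW M 0 (fold (hWinv M) [1..<Suc k] v)"

definition submodule :: "nat \<Rightarrow> ('v::ab_group_add) hmod \<Rightarrow> 'v set \<Rightarrow> bool" where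
  "submodule k M U \<longleftrightarrow>
     U \<subseteq> hcar M \<and> module.subspace (hscl M) U \<and>
     (\<forall>i<k. hT M i ` U \<subseteq> U) \<and> (\<forall>j\<le>k. hW M j ` U \<subseteq> U \<and> hWinv M j ` U \<subseteq> U)"

definition irreducible_module ::
  "nat \<Rightarrow> complex \<Rightarrow> complex \<Rightarrow> complex \<Rightarrow> ('v::ab_group_add) hmod \<Rightarrow> bool" where
  "irreducible_module k q q0 qk M \<longleftrightarrow>
     hecke_module k q q0 qk M \<and> hcar M \<noteq> {0} \<and>
     (\<forall>U. submodule k M U \<longrightarrow> U = {0} \<or> U = hcar M)"

definition calibrated :: "nat \<Rightarrow> ('v::ab_group_add) hmod \<Rightarrow> bool" where
  "calibrated k M \<longleftrightarrow>
     (\<exists>B. B \<subseteq> hcar M \<and> \<not> module.dependent (hscl M) B \<and> module.span (hscl M) B = hcar M \<and>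
          (\<forall>b\<in>B. \<forall>j\<le>k. \<exists>a. hW M j b = hscl M a b))"

definition hmod_iso ::
  "nat \<Rightarrow> ('v::ab_group_add) hmod \<Rightarrow> ('u::ab_group_add) hmod \<Rightarrow> bool" where
  "hmod_iso k M N \<longleftrightarrow>
     (\<exists>f. bij_betw f (hcar M) (hcar N) \<and>
          (\<forall>x\<in>hcar M. \<forall>y\<in>hcar M. f (x + y) = f x + f y) \<and>
          (\<forall>a. \<forall>x\<in>hcar M. f (hscl M a x) = hscl N a (f x)) \<and>
          (\<forall>i<k. \<forall>x\<in>hcar M. f (hT M i x) = hT N i (f x)) \<and>
          (\<forall>j\<le>k. \<forall>x\<in>hcar M. f (hW M j x) = hW N j (f x)))"

definition iso_class ::
  "nat \<Rightarrow> complex \<Rightarrow> complex \<Rightarrow> complex \<Rightarrow> ('v::ab_group_add) hmod \<Rightarrow> 'v hmod set" where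
  "iso_class k q q0 qk M = {N. hecke_module k q q0 qk N \<and> hmod_iso k M N}"

section \<open>Signed permutations and local regions\<close>

text \<open>Signed permutations are extended by the identity outside \<open>{-k..k}\<close>.\<close>
definition signed_perms :: "nat \<Rightarrow> (int \<Rightarrow> int) set" where
  "signed_perms k = {w. w permutes ({- int k..int k} - {0}) \<and> (\<forall>i. w (- i) = - w i)}"

definition simple_refl :: "nat \<Rightarrow> int \<Rightarrow> int" where
  "simple_refl i =
     (if i = 0 then transpose 1 (- 1)
      else transpose (int i) (int i + 1) \<circ> transpose (- int i) (- (int i + 1)))"

text \<open>A vector \<open>(c_1, \<dots>, c_k)\<close> is stored together with \<open>c_{-i} = - c_i\<close>, as an odd function on
  the integers that is zero outside \<open>{-k..k}\<close>.\<close>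
definition cvecs :: "nat \<Rightarrow> (int \<Rightarrow> complex) set" where
  "cvecs k = {c. (\<forall>i. c (- i) = - c i) \<and> (\<forall>i. \<bar>i\<bar> > int k \<longrightarrow> c i = 0)}"

definition act :: "(int \<Rightarrow> int) \<Rightarrow> (int \<Rightarrow> complex) \<Rightarrow> int \<Rightarrow> complex" where
  "act w c i = c (inv w i)"

definition tpow :: "complex \<Rightarrow> complex \<Rightarrow> complex" where
  "tpow tau s = exp (tau * s)"

definition gam :: "complex \<Rightarrow> (int \<Rightarrow> complex) \<Rightarrow> int \<Rightarrow> complex" where
  "gam tau c i = - tpow tau (c i)"

text \<open>The exponents \<open>c_i\<close> matter only through \<open>t^{c_i}\<close>, that is, modulo \<open>2 \<pi> i / tau\<close>.
  Accordingly, every equation between exponents in the definitions of \<open>Z(c)\<close>, \<open>P(c)\<close> and of skew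
  local regions is read modulo this period.  An equation \<open>c_i = 0\<close> is read as
  \<open>c_i = c_{-i}\<close>, i.e. as \<open>\<gamma>_i = \<gamma>_{-i}\<close>, that is \<open>\<gamma>_i \<in> {1, -1}\<close>; this is the case \<open>j = -i\<close> of
  the equation \<open>c_j - c_i = 0\<close>.  (With literal equality of exponents, the denominators of the
  seminormal formulas vanish for example when \<open>t^{c_1} = -1\<close>.)
  The lemmas after the definition of \<open>Zset\<close> show that for real \<open>tau\<close> and \<open>c\<close> this is
  literal equality.\<close>
definition same_pow :: "complex \<Rightarrow> complex \<Rightarrow> complex \<Rightarrow> bool" where
  "same_pow tau a b \<longleftrightarrow> tpow tau a = tpow tau b"

definition eps :: "int \<Rightarrow> (int \<Rightarrow> real)" where
  "eps i = (\<lambda>j. if j = i then 1 else 0)"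

definition Rset :: "nat \<Rightarrow> (int \<Rightarrow> int) \<Rightarrow> (int \<Rightarrow> real) set" where
  "Rset k w =
     {eps i | i. 1 \<le> i \<and> i \<le> int k \<and> w i < 0} \<union>
     {eps j - eps i | i j. 0 < i \<and> i < j \<and> j \<le> int k \<and> w i > w j} \<union>
     {eps j + eps i | i j. 0 < i \<and> i < j \<and> j \<le> int k \<and> - w i > w j}"

definition Zset :: "nat \<Rightarrow> complex \<Rightarrow> (int \<Rightarrow> complex) \<Rightarrow> (int \<Rightarrow> real) set" where
  "Zset k tau c =
     {eps i | i. 1 \<le> i \<and> i \<le> int k \<and> same_pow tau (c i) (c (- i))} \<union>
     {eps j - eps i | i j. 0 < i \<and> i < j \<and> j \<le> int k \<and> same_pow tau (c j - c i) 0} \<union>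
     {eps j + eps i | i j. 0 < i \<and> i < j \<and> j \<le> int k \<and> same_pow tau (c j + c i) 0}"

lemma same_pow_real:
  assumes "tau \<in> \<real>" "tau \<noteq> 0" "a \<in> \<real>" "b \<in> \<real>"
  shows "same_pow tau a b \<longleftrightarrow> a = b"
proof -
  obtain x y z where *: "tau = of_real x" "a = of_real y" "b = of_real z"
    using assms by (auto elim!: Reals_cases)
  have "same_pow tau a b \<longleftrightarrow> complex_of_real (exp (x * y)) = complex_of_real (exp (x * z))"
    unfolding same_pow_def tpow_def * exp_of_real[symmetric] by simp
  with assms(2) show ?thesis unfolding * of_real_eq_iff by simp
qed

lemma Zset_real:
  assumes "tau \<in> \<real>" "tau \<noteq> 0" "c \<in> cvecs k" "\<And>i. c i \<in> \<real>"
  shows "Zset k tau c =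
     {eps i | i. 1 \<le> i \<and> i \<le> int k \<and> c i = 0} \<union>
     {eps j - eps i | i j. 0 < i \<and> i < j \<and> j \<le> int k \<and> c j - c i = 0} \<union>
     {eps j + eps i | i j. 0 < i \<and> i < j \<and> j \<le> int k \<and> c j + c i = 0}"
proof -
  have *: "same_pow tau (c i) (c (- i)) \<longleftrightarrow> c i = 0" for i
    using assms same_pow_real[of tau "c i" "c (- i)"] by (auto simp: cvecs_def)
  have "c j - c i \<in> \<real>" "c j + c i \<in> \<real>" for i j using assms(4) by auto
  then show ?thesis
    unfolding Zset_def * using assms(1,2) by (simp add: same_pow_real)
qed

definition Pset ::
  "nat \<Rightarrow> complex \<Rightarrow> complex \<Rightarrow> complex \<Rightarrow> (int \<Rightarrow> complex) \<Rightarrow> (int \<Rightarrow> real) set" where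
  "Pset k tau r1 r2 c =
     {eps i | i. 1 \<le> i \<and> i \<le> int k \<and> (\<exists>r\<in>{r1, - r1, r2, - r2}. same_pow tau (c i) r)} \<union>
     {eps j - eps i | i j. 0 < i \<and> i < j \<and> j \<le> int k \<and>
        (\<exists>e\<in>{1, - 1}. same_pow tau (c j - c i) e)} \<union>
     {eps j + eps i | i j. 0 < i \<and> i < j \<and> j \<le> int k \<and>
        (\<exists>e\<in>{1, - 1}. same_pow tau (c j + c i) e)}"

definition local_region ::
  "nat \<Rightarrow> complex \<Rightarrow> complex \<Rightarrow> complex \<Rightarrow> (int \<Rightarrow> complex) \<Rightarrow> (int \<Rightarrow> real) set \<Rightarrow> bool" where
  "local_region k tau r1 r2 c J \<longleftrightarrow> c \<in> cvecs k \<and> J \<subseteq> Pset k tau r1 r2 c"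

definition Fset ::
  "nat \<Rightarrow> complex \<Rightarrow> complex \<Rightarrow> complex \<Rightarrow> (int \<Rightarrow> complex) \<Rightarrow> (int \<Rightarrow> real) set
     \<Rightarrow> (int \<Rightarrow> int) set" where
  "Fset k tau r1 r2 c J =
     {w \<in> signed_perms k. Rset k w \<inter> Zset k tau c = {} \<and> Rset k w \<inter> Pset k tau r1 r2 c = J}"

definition skew_local_region ::
  "nat \<Rightarrow> complex \<Rightarrow> complex \<Rightarrow> complex \<Rightarrow> (int \<Rightarrow> complex) \<Rightarrow> (int \<Rightarrow> real) set \<Rightarrow> bool" where
  "skew_local_region k tau r1 r2 c J \<longleftrightarrow>
     local_region k tau r1 r2 c J \<and>
     (\<forall>w\<in>Fset k tau r1 r2 c J. let d = act w c in
        \<not> same_pow tau (d 1) (d (- 1)) \<and>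
        (k \<ge> 2 \<longrightarrow> \<not> same_pow tau (d 2) (d (- 2)) \<and> \<not> same_pow tau (d 1) (- d 2)) \<and>
        (\<forall>i\<in>{1..int k - 1}. \<not> same_pow tau (d i) (d (i + 1))) \<and>
        (\<forall>i\<in>{1..int k - 2}. \<not> same_pow tau (d i) (d (i + 2))))"

text \<open>\<open>C\<close> contains exactly one vector from each orbit of the group generated by \<open>W_0\<close>
  (\<open>signed_perms k\<close>) and the translations by periods of \<open>s \<mapsto> t^s\<close>, i.e. exactly one vector for
  each \<open>W_0\<close>-orbit of tuples \<open>(\<gamma>_1, \<dots>, \<gamma>_k)\<close>.\<close>
definition same_orbit :: "nat \<Rightarrow> complex \<Rightarrow> (int \<Rightarrow> complex) \<Rightarrow> (int \<Rightarrow> complex) \<Rightarrow> bool" where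
  "same_orbit k tau c c' \<longleftrightarrow> (\<exists>u\<in>signed_perms k. \<forall>i. same_pow tau (act u c i) (c' i))"

definition orbit_representatives :: "nat \<Rightarrow> complex \<Rightarrow> (int \<Rightarrow> complex) set \<Rightarrow> bool" where
  "orbit_representatives k tau C \<longleftrightarrow>
     C \<subseteq> cvecs k \<and> (\<forall>c\<in>cvecs k. \<exists>!c'. c' \<in> C \<and> same_orbit k tau c c')"

section \<open>The modules attached to local regions\<close>

text \<open>The formal span of symbols \<open>v_w\<close> is realised inside the functions on signed permutations.\<close>
definition fscale :: "complex \<Rightarrow> ('w \<Rightarrow> complex) \<Rightarrow> 'w \<Rightarrow> complex" where
  "fscale a f = (\<lambda>x. a * f x)"

text \<open>\<open>v_w\<close>, with the convention \<open>v_w = 0\<close> if \<open>w \<notin> F\<close>\<close>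
definition vsym :: "'w set \<Rightarrow> 'w \<Rightarrow> 'w \<Rightarrow> complex" where
  "vsym F w = (if w \<in> F then (\<lambda>u. if u = w then 1 else 0) else 0)"

text \<open>The linear map on \<open>span {v_w | w \<in> F}\<close> that maps \<open>v_w\<close> to \<open>g w\<close>.\<close>
definition lin_ext :: "'w set \<Rightarrow> ('w \<Rightarrow> 'w \<Rightarrow> complex) \<Rightarrow> ('w \<Rightarrow> complex) \<Rightarrow> 'w \<Rightarrow> complex" where
  "lin_ext F g f = (\<Sum>w\<in>F. fscale (f w) (g w))"

definition Tdiag ::
  "complex \<Rightarrow> complex \<Rightarrow> complex \<Rightarrow> complex \<Rightarrow> (int \<Rightarrow> complex) \<Rightarrow> nat \<Rightarrow> (int \<Rightarrow> int) \<Rightarrow> complex" where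
  "Tdiag q q0 qk tau c i w =
     (if i = 0 then
        ((q0 - inverse q0) + (qk - inverse qk) * inverse (gam tau c (inv w 1)))
        / (1 - inverse (gam tau c (inv w 1)) ^ 2)
      else
        (q - inverse q)
        / (1 - gam tau c (inv w (int i)) * inverse (gam tau c (inv w (int i + 1)))))"

definition Hmod ::
  "nat \<Rightarrow> complex \<Rightarrow> complex \<Rightarrow> complex \<Rightarrow> complex \<Rightarrow> complex \<Rightarrow> complex \<Rightarrow>
   complex \<Rightarrow> (int \<Rightarrow> complex) \<Rightarrow> (int \<Rightarrow> real) set \<Rightarrow> ((int \<Rightarrow> int) \<Rightarrow> complex) hmod" where
  "Hmod k q q0 qk tau r1 r2 z c J =
     (let F = Fset k tau r1 r2 c J; v = vsym F in
      \<lparr> hcar = module.span fscale (v ` F),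
        hscl = fscale,
        hT = (\<lambda>i. let p = (if i = 0 then q0 else q) in
                lin_ext F (\<lambda>w. let d = Tdiag q q0 qk tau c i w in
                  fscale d (v w)
                  + fscale (csqrt (- (d - p) * (d + inverse p))) (v (simple_refl i \<circ> w)))),
        hW = (\<lambda>j. lin_ext F (\<lambda>w. fscale (if j = 0 then z else gam tau c (inv w (int j))) (v w)))
      \<rparr>)"

text \<open>A skew local region with \<open>\<F> = \<emptyset>\<close> gives the zero module and labels no irreducible module.\<close>
definition skew_labels ::
  "nat \<Rightarrow> complex \<Rightarrow> complex \<Rightarrow> complex \<Rightarrow> (int \<Rightarrow> complex) set
     \<Rightarrow> (complex \<times> (int \<Rightarrow> complex) \<times> (int \<Rightarrow> real) set) set" where
  "skew_labels k tau r1 r2 C =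
     {(z, c, J). z \<noteq> 0 \<and> c \<in> C \<and> skew_local_region k tau r1 r2 c J \<and> Fset k tau r1 r2 c J \<noteq> {}}"

end

theory Submission
  imports Defs
begin

text \<open>
  The proof works with weights.  A tuple \<open>(\<gamma>\<^sub>1, \<dots>, \<gamma>\<^sub>k)\<close> is extended by \<open>\<gamma>\<^sub>-\<^sub>i = \<gamma>\<^sub>i\<^sup>-\<^sup>1\<close>, and signed
  permutations act on it by composition.  On a vector of weight \<open>d\<close>, the operator
  \<open>\<tau>\<^sub>i = T\<^sub>i - [T\<^sub>i]\<close> maps to weight \<open>d \<circ> s\<^sub>i\<close>, provided that \<open>d\<close> is not on the wall of \<open>s\<^sub>i\<close>
  (\<open>tau_wv\<close>).  Its square is the scalar \<open>rad\<close> (\<open>tau_tau\<close>), which vanishes exactly when the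
  hyperplane between the two weights belongs to \<open>P(c)\<close> (\<open>rad_eq_0_iff\<close>).  If \<open>d\<close> is regular for
  the rank two groups of non-commuting simple reflections, then the braid relations for the
  \<open>T\<^sub>i\<close> on this vector are equivalent to those for the \<open>\<tau>\<^sub>i\<close> (\<open>braid_tau_A\<close>, \<open>braid_tau_B\<close>); this
  is a rational identity between the coefficients \<open>[T\<^sub>i]\<close>.

  Part (a).  The skew condition says that the weights of all \<open>v\<^sub>w\<close> are regular (\<open>skew_iff\<close>), and in
  the seminormal basis \<open>\<tau>\<^sub>i\<close> sends \<open>v\<^sub>w\<close> to the square root of \<open>rad\<close> times \<open>v\<^bsub>s\<^sub>i w\<^esub>\<close>.  The
  square roots vanish exactly where \<open>s\<^sub>i w\<close> leaves \<open>\<F>\<close> (\<open>sq_eq_0_iff\<close>), so the boundary of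
  \<open>\<F>\<close> needs no separate treatment in the verification of the relations, and the braid relations hold because
  both sides cross the same walls.  For irreducibility, the weights of the \<open>v\<^sub>w\<close> are pairwise different
  (\<open>weights_differ\<close>), so a nonzero submodule contains some \<open>v\<^sub>w\<close>; and since \<open>\<F>\<close> is the set of
  chambers on given sides of some hyperplanes, any two of its members are connected by a gallery
  that crosses none of these, along which the off-diagonal coefficients do not vanish
  (\<open>submodule_contains_all\<close>).

  Part (b).  Let \<open>v\<close> be a vector of weight \<open>d\<close> in an irreducible calibrated module.  All weights of
  the module are regular (\<open>weight_regular\<close>): on the wall of a simple reflection the cross relation
  produces a Jordan block, and the remaining cases contradict a braid relation or the assumptions
  on the parameters.  Hence the \<open>\<tau>\<^sub>i\<close> satisfy the braid relations, and by Matsumoto's argument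
  (\<open>diamond\<close>) a reduced word of \<open>\<tau>\<^sub>i\<close> applied to \<open>v\<close> gives a vector \<open>vec y\<close> that depends on the signed
  permutation \<open>y\<close> only.  These vectors span a submodule, hence everything.  A nonzero \<open>vec y\<close> cannot
  have crossed a hyperplane of \<open>Z\<close>, as the weight would have been on a wall, nor one of \<open>P\<close>, as the
  vectors beyond this hyperplane would span a proper submodule; conversely \<open>vec y \<noteq> 0\<close> if neither
  happens (\<open>vec_nz_iff\<close>).  So the weight determines the basis \<open>{vec y | vec y \<noteq> 0}\<close> and the
  action on it, and irreducible calibrated modules with a common weight are isomorphic
  (\<open>irreducible_iso_if_common_weight\<close>).  Finally, each weight belongs to exactly one label
  \<open>(z, c, J)\<close>: the orbit gives \<open>c\<close>, the weight is \<open>\<gamma> \<circ> w\<^sup>-\<^sup>1\<close> for exactly one \<open>w\<close> with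
  \<open>R(w) \<inter> Z(c) = \<emptyset>\<close> (\<open>fibre_sorted_exists\<close>, \<open>fibre_sorted_unique\<close>), and \<open>J = R(w) \<inter> P(c)\<close>.
\<close>

section \<open>Signed permutations\<close>

definition idx :: "nat \<Rightarrow> int set" where
  "idx k = {- int k..int k} - {0}"

text \<open>Reading \<open>s\<^sub>0\<close> as the exchange of the neighbours \<open>-1\<close> and \<open>1\<close> allows a uniform
  treatment of all simple reflections: \<open>s\<^sub>i\<close> exchanges \<open>lo i < hi i\<close> and their negatives.\<close>
definition lo :: "nat \<Rightarrow> int" where
  "lo i = (if i = 0 then - 1 else int i)"

definition hi :: "nat \<Rightarrow> int" where
  "hi i = int i + 1"

text \<open>The reflections of the hyperoctahedral group; \<open>b = - a\<close> gives the sign changes.\<close>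
definition signed_swap :: "int \<Rightarrow> int \<Rightarrow> int \<Rightarrow> int" where
  "signed_swap a b x = (if x = a then b else if x = b then a else
                 if x = - a then - b else if x = - b then - a else x)"

lemma finite_idx [simp]: "finite (idx k)"
  by (simp add: idx_def)

lemma uminus_idx [simp]: "- a \<in> idx k \<longleftrightarrow> a \<in> idx k"
  by (auto simp: idx_def)

lemma idx_nonzero: "a \<in> idx k \<Longrightarrow> a \<noteq> 0"
  by (simp add: idx_def)

lemma simple_refl_eq_swap: "simple_refl i = signed_swap (lo i) (hi i)"
  by (rule ext) (auto simp: simple_refl_def signed_swap_def lo_def hi_def transpose_def)

lemma lo_less_hi: "lo i < hi i"
  by (simp add: lo_def hi_def)

lemma lo_hi_idx: "i < k \<Longrightarrow> lo i \<in> idx k \<and> hi i \<in> idx k"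
  by (auto simp: lo_def hi_def idx_def)

lemma signed_permsI:
  assumes "\<And>x. x \<in> idx k \<Longrightarrow> w x \<in> idx k" "\<And>x. x \<notin> idx k \<Longrightarrow> w x = x"
    "\<And>x. w (w' x) = x" "\<And>x. w' (w x) = x" "\<And>x. w (- x) = - w x"
  shows "w \<in> signed_perms k"
proof -
  have "bij w" by (rule o_bij[where g = w']) (auto simp: fun_eq_iff assms(3,4))
  moreover from this have "\<exists>!x. w x = y" for y by (metis bij_iff)
  ultimately have "w permutes idx k" using assms(2) unfolding permutes_def by blast
  then show ?thesis using assms(5) by (simp add: signed_perms_def idx_def)
qed

lemma sp_permutes: "w \<in> signed_perms k \<Longrightarrow> w permutes idx k"
  by (simp add: signed_perms_def idx_def)

lemma sp_neg: "w \<in> signed_perms k \<Longrightarrow> w (- i) = - w i"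
  by (simp add: signed_perms_def)

lemma sp_in [simp]: "w \<in> signed_perms k \<Longrightarrow> w i \<in> idx k \<longleftrightarrow> i \<in> idx k"
  using permutes_in_image[OF sp_permutes] by blast

lemma sp_out: "w \<in> signed_perms k \<Longrightarrow> i \<notin> idx k \<Longrightarrow> w i = i"
  by (meson permutes_not_in sp_permutes)

lemma sp_eq_iff [simp]: "w \<in> signed_perms k \<Longrightarrow> w i = w j \<longleftrightarrow> i = j"
  by (meson inj_eq permutes_inj sp_permutes)

lemma sp_inv_f [simp]: "w \<in> signed_perms k \<Longrightarrow> inv w (w i) = i"
  by (meson permutes_inverses(2) sp_permutes)

lemma sp_f_inv [simp]: "w \<in> signed_perms k \<Longrightarrow> w (inv w i) = i"
  by (meson permutes_inverses(1) sp_permutes)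

lemma sp_bij: "w \<in> signed_perms k \<Longrightarrow> bij w"
  by (meson permutes_bij sp_permutes)

lemma sp_id [simp]: "id \<in> signed_perms k"
  by (simp add: signed_perms_def permutes_id)

lemma sp_comp: "v \<in> signed_perms k \<Longrightarrow> w \<in> signed_perms k \<Longrightarrow> v \<circ> w \<in> signed_perms k"
  by (simp add: signed_perms_def permutes_compose)

lemma sp_inv:
  assumes w: "w \<in> signed_perms k"
  shows "inv w \<in> signed_perms k"
proof -
  have "inv w (- i) = - inv w i" for i
    using sp_eq_iff[OF w, of "inv w (- i)" "- inv w i"] w by (simp add: sp_neg)
  then show ?thesis
    using w by (simp add: signed_perms_def permutes_inv)
qed

lemma finite_sp: "finite (signed_perms k)"
  by (rule finite_subset[OF _ finite_permutations[of "idx k"]]) (auto intro: sp_permutes)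

lemma inv_sp_comp:
  "v \<in> signed_perms k \<Longrightarrow> w \<in> signed_perms k \<Longrightarrow> inv (v \<circ> w) = inv w \<circ> inv v"
  by (simp add: o_inv_distrib sp_bij)

lemma inv_inv_sp [simp]: "w \<in> signed_perms k \<Longrightarrow> inv (inv w) = w"
  by (simp add: inv_inv_eq sp_bij)

lemma signed_swap_involution: "a \<noteq> 0 \<Longrightarrow> b \<noteq> 0 \<Longrightarrow> signed_swap a b (signed_swap a b x) = x"
  by (auto simp: signed_swap_def)

lemma signed_swap_neg: "a \<noteq> 0 \<Longrightarrow> b \<noteq> 0 \<Longrightarrow> signed_swap a b (- x) = - signed_swap a b x"
  by (auto simp: signed_swap_def)

lemma sp_signed_swap: "a \<in> idx k \<Longrightarrow> b \<in> idx k \<Longrightarrow> signed_swap a b \<in> signed_perms k"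
  by (rule signed_permsI[where w' = "signed_swap a b"])
     (auto simp: signed_swap_neg signed_swap_involution idx_nonzero, auto simp: signed_swap_def idx_nonzero split: if_splits)

lemma sp_sr: "i < k \<Longrightarrow> simple_refl i \<in> signed_perms k"
  using lo_hi_idx[of i k] by (simp add: simple_refl_eq_swap sp_signed_swap)

lemma sr_sr [simp]: "simple_refl i (simple_refl i x) = x"
  unfolding simple_refl_eq_swap by (rule signed_swap_involution) (auto simp: lo_def hi_def)

lemma sr_sr_comp [simp]: "y \<circ> simple_refl i \<circ> simple_refl i = y"
  by (simp add: fun_eq_iff)

lemma inv_sr [simp]: "inv (simple_refl i) = simple_refl i"
  by (rule inv_unique_comp) (auto simp: fun_eq_iff)

lemma sr_lo [simp]: "simple_refl i (lo i) = hi i"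
  by (simp add: simple_refl_eq_swap signed_swap_def)

lemma sr_hi [simp]: "simple_refl i (hi i) = lo i"
  by (simp add: simple_refl_eq_swap signed_swap_def)

text \<open>In \<open>{-k, \<dots>, -1, 1, \<dots>, k}\<close> the members of a simple pair are neighbours, so a simple
  reflection changes the order of no other pair.\<close>
lemma sr_less:
  assumes "x \<noteq> 0" "y \<noteq> 0" "x < y" "\<not> simple_refl i x < simple_refl i y"
  shows "x = lo i \<and> y = hi i \<or> x = - hi i \<and> y = - lo i"
proof (cases "i = 0")
  case True
  have s: "simple_refl i z = z \<or> z = - 1 \<and> simple_refl i z = 1 \<or> z = 1 \<and> simple_refl i z = - 1" for z
    using True by (auto simp: simple_refl_eq_swap signed_swap_def lo_def hi_def)
  have "x = - 1 \<and> y = 1"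
    using s[of x] s[of y] assms by linarith
  then show ?thesis using True by (simp add: lo_def hi_def)
next
  case False
  have s: "simple_refl i z = z \<or> (z = lo i \<or> z = - hi i) \<and> simple_refl i z = z + 1 \<or>
      (z = hi i \<or> z = - lo i) \<and> simple_refl i z = z - 1" for z
    using False by (auto simp: simple_refl_eq_swap signed_swap_def lo_def hi_def)
  have "y = x + 1 \<and> (x = lo i \<or> x = - hi i)"
    using s[of x] s[of y] assms sr_sr[of i x] sr_sr[of i y] by (smt (verit, best))
  then show ?thesis using False by (auto simp: lo_def hi_def)
qed

text \<open>Read \<open>y\<close> as an arrangement of labels, \<open>y x\<close> at position \<open>x\<close>.  Since \<open>y \<circ> s\<^sub>i\<close> exchanges
  neighbouring positions, only the two labels found there, and their negatives, change their
  order.\<close>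
lemma order_change:
  assumes y: "y \<in> signed_perms k" and i: "i < k" and ab: "a \<in> idx k" "b \<in> idx k"
    and 1: "inv y a < inv y b" and 2: "\<not> inv (y \<circ> simple_refl i) a < inv (y \<circ> simple_refl i) b"
  shows "a = y (lo i) \<and> b = y (hi i) \<or> a = - y (hi i) \<and> b = - y (lo i)"
proof -
  have e: "inv (y \<circ> simple_refl i) x = simple_refl i (inv y x)" for x
    using inv_sp_comp[OF y sp_sr[OF i]] by simp
  have "inv y a \<noteq> 0" "inv y b \<noteq> 0"
    using ab sp_in[OF sp_inv[OF y]] idx_nonzero by blast+
  from sr_less[OF this 1] 2 have
    "inv y a = lo i \<and> inv y b = hi i \<or> inv y a = - hi i \<and> inv y b = - lo i"
    unfolding e by blast
  then show ?thesis using sp_f_inv[OF y] sp_neg[OF y] by metis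
qed

text \<open>The square distance to the identity serves as the length of a signed permutation.\<close>
definition disp :: "nat \<Rightarrow> (int \<Rightarrow> int) \<Rightarrow> nat" where
  "disp k y = nat (\<Sum>a\<in>idx k. (y a - a)\<^sup>2)"

text \<open>A rearrangement inequality: exchanging two values that are in the wrong order increases
  \<open>\<Sum> x \<cdot> y(x)\<close>, and \<open>disp\<close> differs from a constant by minus twice this sum.\<close>
lemma disp_swap_less:
  assumes y: "y \<in> signed_perms k" and ab: "a \<in> idx k" "b \<in> idx k" "a < b" "y a > y b"
  shows "disp k (y \<circ> signed_swap a b) < disp k y"
proof -
  let ?t = "signed_swap a b"
  have t: "?t \<in> signed_perms k" using ab by (simp add: sp_signed_swap)
  have bij: "bij_betw ?t (idx k) (idx k)"
    by (meson permutes_imp_bij sp_permutes t)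
  have nz: "a \<noteq> 0" "b \<noteq> 0" using ab idx_nonzero by auto
  have "(\<Sum>x\<in>idx k. ((y \<circ> ?t) x - x)\<^sup>2) = (\<Sum>x\<in>idx k. ((y \<circ> ?t) (?t x) - ?t x)\<^sup>2)"
    by (rule sum.reindex_bij_betw[OF bij, symmetric])
  also have "\<dots> = (\<Sum>x\<in>idx k. (y x - x)\<^sup>2 + ((?t x)\<^sup>2 - x\<^sup>2) - 2 * (y x * (?t x - x)))"
    by (rule sum.cong) (auto simp: signed_swap_involution nz power2_eq_square algebra_simps)
  also have "\<dots> = (\<Sum>x\<in>idx k. (y x - x)\<^sup>2) + ((\<Sum>x\<in>idx k. (?t x)\<^sup>2) - (\<Sum>x\<in>idx k. x\<^sup>2))
      - 2 * (\<Sum>x\<in>idx k. y x * (?t x - x))"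
    by (simp add: sum.distrib sum_subtractf sum_distrib_left)
  also have "(\<Sum>x\<in>idx k. (?t x)\<^sup>2) = (\<Sum>x\<in>idx k. x\<^sup>2)"
    by (rule sum.reindex_bij_betw[OF bij])
  finally have 1: "(\<Sum>x\<in>idx k. ((y \<circ> ?t) x - x)\<^sup>2)
      = (\<Sum>x\<in>idx k. (y x - x)\<^sup>2) - 2 * (\<Sum>x\<in>idx k. y x * (?t x - x))" by simp
  have "(\<Sum>x\<in>idx k. y x * (?t x - x)) = (\<Sum>x\<in>{a, b, - a, - b}. y x * (?t x - x))"
    using ab by (intro sum.mono_neutral_right) (auto simp: signed_swap_def)
  also have "\<dots> > 0"
  proof (cases "b = - a")
    case True
    have "(\<Sum>x\<in>{a, b, - a, - b}. y x * (?t x - x)) = (\<Sum>x\<in>{a, - a}. y x * (?t x - x))"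
      using True by (intro arg_cong2[where f = sum]) auto
    also have "\<dots> = y a * (b - a) + y b * (a - b)"
      using True nz by (simp add: signed_swap_def)
    also have "\<dots> = (b - a) * (y a - y b)"
      by (simp add: algebra_simps)
    finally show ?thesis using ab by simp
  next
    case False
    have "distinct [a, b, - a, - b]" using False nz ab by auto
    then have "(\<Sum>x\<in>{a, b, - a, - b}. y x * (?t x - x))
        = y a * (?t a - a) + y b * (?t b - b) + y (- a) * (?t (- a) + a) + y (- b) * (?t (- b) + b)"
      by simp
    also have "\<dots> = y a * (b - a) + y b * (a - b) + (- y a) * (a - b) + (- y b) * (b - a)"
      using False nz ab sp_neg[OF y, of a] sp_neg[OF y, of b] by (simp add: signed_swap_def)
    also have "\<dots> = 2 * ((b - a) * (y a - y b))"
      by (simp add: algebra_simps)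
    finally show ?thesis using ab by simp
  qed
  finally have "(\<Sum>x\<in>idx k. ((y \<circ> ?t) x - x)\<^sup>2) < (\<Sum>x\<in>idx k. (y x - x)\<^sup>2)"
    using 1 by linarith
  moreover have "0 \<le> (\<Sum>x\<in>idx k. ((y \<circ> ?t) x - x)\<^sup>2)"
    by (simp add: sum_nonneg)
  ultimately show ?thesis
    unfolding disp_def by linarith
qed

lemma disp_descent:
  assumes "y \<in> signed_perms k" "i < k" "y (lo i) > y (hi i)"
  shows "disp k (y \<circ> simple_refl i) < disp k y"
  using disp_swap_less[OF assms(1), of "lo i" "hi i"] lo_hi_idx[OF assms(2)] lo_less_hi assms(3)
  by (simp add: simple_refl_eq_swap)

text \<open>An increasing map from \<open>{1, \<dots>, k}\<close> to itself is bounded by the identity from below, counting from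
  the left end, and from above, counting from the right end.\<close>
lemma sp_no_descent:
  assumes y: "y \<in> signed_perms k" and asc: "\<And>i. i < k \<Longrightarrow> y (lo i) < y (hi i)"
  shows "y = id"
proof -
  have step: "y (int i) < y (int i + 1)" if "1 \<le> i" "i < k" for i
    using asc[of i] that by (simp add: lo_def hi_def)
  have low: "y (int i) \<ge> int i" if "1 \<le> i" "i \<le> k" for i
    using that
  proof (induction i rule: dec_induct)
    case base
    then show ?case using asc[of 0] sp_neg[OF y, of 1] by (simp add: lo_def hi_def)
  next
    case (step i)
    then show ?case using \<open>\<And>i. 1 \<le> i \<Longrightarrow> i < k \<Longrightarrow> y (int i) < y (int i + 1)\<close>[of i]
      by (simp add: add.commute)
  qed
  have up: "y (int i) \<le> int i" if "1 \<le> i" "i \<le> k" for i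
    using that(2,1)
  proof (induction i rule: inc_induct)
    case base
    have "int k \<in> idx k" using base by (simp add: idx_def)
    then have "y (int k) \<in> idx k" using y by simp
    then show ?case by (simp add: idx_def)
  next
    case (step i)
    then show ?case using \<open>\<And>i. 1 \<le> i \<Longrightarrow> i < k \<Longrightarrow> y (int i) < y (int i + 1)\<close>[of i]
      by (simp add: add.commute)
  qed
  have pos: "y x = x" if "0 < x" "x \<le> int k" for x
    using low[of "nat x"] up[of "nat x"] that by fastforce
  have "y x = x" for x
  proof (cases "x \<in> idx k")
    case True
    then consider "0 < x" "x \<le> int k" | "0 < - x" "- x \<le> int k" by (force simp: idx_def)
    then show ?thesis
      by cases (use pos pos[of "- x"] sp_neg[OF y, of x] in auto)
  qed (simp add: sp_out[OF y])
  then show ?thesis by auto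
qed

text \<open>Induction along the weak order, from \<open>y\<close> down to the identity through descents.\<close>
lemma sp_induct [consumes 1, case_names id descent]:
  assumes "y \<in> signed_perms k" "P id"
    and "\<And>y i. y \<in> signed_perms k \<Longrightarrow> i < k \<Longrightarrow> y (lo i) > y (hi i) \<Longrightarrow>
            P (y \<circ> simple_refl i) \<Longrightarrow> P y"
  shows "P y"
  using assms(1)
proof (induction "disp k y" arbitrary: y rule: less_induct)
  case less
  show ?case
  proof (cases "y = id")
    case False
    then obtain i where i: "i < k" "\<not> y (lo i) < y (hi i)" using sp_no_descent[OF less.prems] by blast
    then have "y (lo i) > y (hi i)"
      using sp_eq_iff[OF less.prems, of "lo i" "hi i"] lo_less_hi[of i] by force
    with i less show ?thesis using assms(3) disp_descent sp_comp sp_sr by metis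
  qed (use assms(2) in simp)
qed

section \<open>Arrangements that are increasing on fibres\<close>

text \<open>For \<open>d = \<gamma>\<close> this is the condition \<open>R(w) \<inter> Z(c) = \<emptyset>\<close>: it selects one element from each coset of
  the stabilizer of \<open>\<gamma>\<close>.\<close>
definition fibre_sorted :: "nat \<Rightarrow> (int \<Rightarrow> complex) \<Rightarrow> (int \<Rightarrow> int) \<Rightarrow> bool" where
  "fibre_sorted k d w \<longleftrightarrow> (\<forall>a\<in>idx k. \<forall>b\<in>idx k. a < b \<and> d a = d b \<longrightarrow> w a < w b)"

text \<open>On each fibre, \<open>w\<close> and \<open>w'\<close> are increasing bijections onto the same set of positions.\<close>
lemma fibre_sorted_unique:
  assumes w: "w \<in> signed_perms k" "w' \<in> signed_perms k"
    and s: "fibre_sorted k d w" "fibre_sorted k d w'"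
    and e: "\<And>i. i \<in> idx k \<Longrightarrow> d (inv w i) = d (inv w' i)"
  shows "w = w'"
proof -
  have nle: False if H: "w \<in> signed_perms k" "w' \<in> signed_perms k"
      "fibre_sorted k d w" "fibre_sorted k d w'"
      "\<And>i. i \<in> idx k \<Longrightarrow> d (inv w i) = d (inv w' i)"
      and a: "a \<in> idx k" "w a < w' a" and min: "\<And>b. b \<in> idx k \<Longrightarrow> b < a \<Longrightarrow> w b = w' b"
    for w w' a
  proof -
    define b where "b = inv w' (w a)"
    have wa: "w a \<in> idx k" and b: "b \<in> idx k" "w' b = w a"
      using H a sp_inv[OF H(2)] by (auto simp: b_def)
    have db: "d b = d a" using H(5)[OF wa] H(1) by (simp add: b_def)
    have "b \<noteq> a" using a b by auto
    moreover have "\<not> a < b" using H(4) a b db unfolding fibre_sorted_def by force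
    ultimately have "b < a" by simp
    with min[OF b(1)] b have "w b = w a" by simp
    with \<open>b \<noteq> a\<close> H(1) show False by simp
  qed
  have idx: "w a = w' a" if "a \<in> idx k" for a
    using that
  proof (induction "nat (a + int k)" arbitrary: a rule: less_induct)
    case less
    have min: "w b = w' b" if "b \<in> idx k" "b < a" for b
    proof (rule less(1)[OF _ that(1)])
      show "nat (b + int k) < nat (a + int k)" using that less(2) by (auto simp: idx_def)
    qed
    show ?case
      using nle[OF w s e less(2) _ min] nle[OF w(2,1) s(2,1) e[symmetric] less(2) _ min[symmetric]]
      by (meson linorder_neqE_linordered_idom)
  qed
  show ?thesis
    using idx sp_out[OF w(1)] sp_out[OF w(2)] by (metis ext)
qed

text \<open>Exchanging the images of two elements of a fibre that are in the wrong order reduces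
  \<open>disp\<close>.\<close>
lemma fibre_sorted_exists:
  assumes "w \<in> signed_perms k" and d: "\<And>x. d (- x) = inverse (d x)"
  shows "\<exists>w'\<in>signed_perms k. fibre_sorted k d w' \<and> d \<circ> inv w' = d \<circ> inv w"
  using assms(1)
proof (induction "disp k w" arbitrary: w rule: less_induct)
  case less
  show ?case
  proof (cases "fibre_sorted k d w")
    case False
    then obtain a b where ab: "a \<in> idx k" "b \<in> idx k" "a < b" "d a = d b" "\<not> w a < w b"
      unfolding fibre_sorted_def by blast
    moreover have "w a \<noteq> w b" using ab sp_eq_iff[OF less.prems] by auto
    ultimately have gt: "w a > w b" by simp
    let ?w = "w \<circ> signed_swap a b"
    have t: "signed_swap a b \<in> signed_perms k" using ab by (simp add: sp_signed_swap)
    have inv_t: "inv (signed_swap a b) = signed_swap a b"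
      using ab by (intro inv_unique_comp) (auto simp: fun_eq_iff signed_swap_involution idx_nonzero)
    have dt: "d (signed_swap a b x) = d x" for x
      using ab(4) d[of a] d[of b] by (auto simp: signed_swap_def)
    have "d \<circ> inv ?w = d \<circ> inv w"
      using inv_sp_comp[OF less.prems t] by (simp add: fun_eq_iff inv_t dt)
    then show ?thesis
      using less(1)[OF disp_swap_less[OF less.prems ab(1-3) gt] sp_comp[OF less.prems t]] by simp
  qed (use less.prems in blast)
qed

section \<open>Roots as pairs of indices\<close>

text \<open>The extension \<open>\<epsilon>\<^sub>-\<^sub>a = - \<epsilon>\<^sub>a\<close>.\<close>
definition sgn_eps :: "int \<Rightarrow> int \<Rightarrow> real" where
  "sgn_eps a = (if 0 < a then eps a else - eps (- a))"

text \<open>The pairs \<open>(a, b)\<close> and \<open>(- b, - a)\<close> give the same root \<open>\<epsilon>\<^sub>b - \<epsilon>\<^sub>a\<close>; the pair \<open>(- b, b)\<close> gives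
  \<open>\<epsilon>\<^sub>b\<close> instead of \<open>2\<epsilon>\<^sub>b\<close>.  In these terms the three families of roots in the definitions of
  \<open>R\<close>, \<open>Z\<close> and \<open>P\<close> become a single one.\<close>
definition pair_root :: "int \<Rightarrow> int \<Rightarrow> int \<Rightarrow> real" where
  "pair_root a b = (if b = - a then eps b else sgn_eps b - sgn_eps a)"

definition pair_roots :: "nat \<Rightarrow> (int \<Rightarrow> int \<Rightarrow> bool) \<Rightarrow> (int \<Rightarrow> real) set" where
  "pair_roots k Q = {pair_root a b | a b. a \<in> idx k \<and> b \<in> idx k \<and> a < b \<and> Q a b}"

text \<open>The odd extension of a root to \<open>\<int>\<close> recovers its pair of indices up to the flip.\<close>
lemma pair_root_pos:
  assumes "a \<noteq> 0" "b \<noteq> 0" "a < b"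
  shows "{x. pair_root a b x - pair_root a b (- x) > 0} = {b, - a}"
proof -
  consider "b = - a" | "b \<noteq> - a" "0 < a" | "b \<noteq> - a" "a < 0" "0 < b" | "b \<noteq> - a" "b < 0"
    using assms by linarith
  then show ?thesis
    by cases (use assms in \<open>auto simp: pair_root_def sgn_eps_def eps_def split: if_splits\<close>)
qed

lemma pair_root_eq:
  assumes "a \<in> idx k" "b \<in> idx k" "a < b" "a' \<in> idx k" "b' \<in> idx k" "a' < b'" "pair_root a b = pair_root a' b'"
  shows "a' = a \<and> b' = b \<or> a' = - b \<and> b' = - a"
proof -
  have "{b, - a} = {b', - a'}"
    using pair_root_pos[of a b] pair_root_pos[of a' b'] assms idx_nonzero by metis
  then show ?thesis by (auto simp: doubleton_eq_iff)
qed

lemma pair_root_flip: "a \<in> idx k \<Longrightarrow> b \<in> idx k \<Longrightarrow> pair_root (- b) (- a) = pair_root a b"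
  by (auto simp: pair_root_def sgn_eps_def eps_def fun_eq_iff idx_def)

lemma pair_roots_mem:
  assumes "\<And>a b. Q a b \<Longrightarrow> Q (- b) (- a)" "a \<in> idx k" "b \<in> idx k" "a < b"
  shows "pair_root a b \<in> pair_roots k Q \<longleftrightarrow> Q a b"
proof
  assume "pair_root a b \<in> pair_roots k Q"
  then obtain a' b' where "a' \<in> idx k" "b' \<in> idx k" "a' < b'" "Q a' b'" "pair_root a b = pair_root a' b'"
    unfolding pair_roots_def by blast
  with pair_root_eq[OF assms(2-4), of a' b'] assms(1)[of a' b'] show "Q a b" by auto
qed (use assms in \<open>auto simp: pair_roots_def\<close>)

text \<open>Each of the three families of roots consists of the pairs of one shape, up to the flip.\<close>
lemma pair_roots_eqI:
  assumes "\<And>a b. Q a b \<Longrightarrow> Q (- b) (- a)"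
  shows "{eps i | i. 1 \<le> i \<and> i \<le> int k \<and> Q (- i) i} \<union>
     {eps j - eps i | i j. 0 < i \<and> i < j \<and> j \<le> int k \<and> Q i j} \<union>
     {eps j + eps i | i j. 0 < i \<and> i < j \<and> j \<le> int k \<and> Q (- i) j} = pair_roots k Q"
    (is "?A \<union> ?B \<union> ?C = _")
proof (intro equalityI subsetI)
  fix f assume "f \<in> ?A \<union> ?B \<union> ?C"
  then consider i where "1 \<le> i" "i \<le> int k" "Q (- i) i" "f = eps i"
    | i j where "0 < i" "i < j" "j \<le> int k" "Q i j" "f = eps j - eps i"
    | i j where "0 < i" "i < j" "j \<le> int k" "Q (- i) j" "f = eps j + eps i" by blast
  then show "f \<in> pair_roots k Q"
  proof cases
    case 1
    then have "f = pair_root (- i) i" by (simp add: pair_root_def)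
    with 1 show ?thesis unfolding pair_roots_def by (force simp: idx_def)
  next
    case 2
    then have "f = pair_root i j" by (simp add: pair_root_def sgn_eps_def)
    with 2 show ?thesis unfolding pair_roots_def by (force simp: idx_def)
  next
    case 3
    then have "f = pair_root (- i) j" by (simp add: pair_root_def sgn_eps_def)
    with 3 show ?thesis unfolding pair_roots_def by (force simp: idx_def)
  qed
next
  fix f assume "f \<in> pair_roots k Q"
  then obtain a b where ab: "a \<in> idx k" "b \<in> idx k" "a < b" "Q a b" "f = pair_root a b"
    unfolding pair_roots_def by blast
  \<comment> \<open>Each root has a representative whose second index is the larger one in absolute value.\<close>
  have *: "f \<in> ?A \<union> ?B \<union> ?C"
    if "a \<in> idx k" "b \<in> idx k" "a < b" "Q a b" "f = pair_root a b" "\<bar>a\<bar> \<le> b" for a b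
  proof -
    have "b = - a \<or> 0 < a \<or> a < 0 \<and> - a < b" using that idx_nonzero[of a k] by linarith
    then consider "b = - a" | "0 < a" | "a < 0" "- a < b" by blast
    then show ?thesis
    proof cases
      case 1
      with that have "f = eps b" "1 \<le> b" "b \<le> int k" "Q (- b) b" by (auto simp: pair_root_def idx_def)
      then show ?thesis by blast
    next
      case 2
      with that have "f = eps b - eps a" "a < b" "b \<le> int k" "Q a b"
        by (auto simp: pair_root_def sgn_eps_def idx_def)
      with 2 show ?thesis by blast
    next
      case 3
      with that have "f = eps b + eps (- a)" "0 < - a" "- a < b" "b \<le> int k" "Q (- (- a)) b"
        by (auto simp: pair_root_def sgn_eps_def idx_def)
      then show ?thesis by blast
    qed
  qed
  show "f \<in> ?A \<union> ?B \<union> ?C"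
  proof (cases "\<bar>a\<bar> \<le> b")
    case True
    then show ?thesis using *[of a b] ab by blast
  next
    case False
    then have "\<bar>- b\<bar> \<le> - a" "- b < - a" using ab by auto
    then show ?thesis using *[of "- b" "- a"] ab assms pair_root_flip[of a k b] by auto
  qed
qed

lemma Rset_roots:
  assumes "w \<in> signed_perms k"
  shows "Rset k w = pair_roots k (\<lambda>a b. w a > w b)"
  by (subst pair_roots_eqI[symmetric]) (use assms in \<open>auto simp: Rset_def sp_neg\<close>)

section \<open>Weights\<close>

text \<open>A tuple \<open>(\<gamma>\<^sub>1, \<dots>, \<gamma>\<^sub>k)\<close> is extended by \<open>\<gamma>\<^sub>-\<^sub>i = \<gamma>\<^sub>i\<^sup>-\<^sup>1\<close>, so that signed permutations act by
  composition.\<close>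
definition wtfun :: "(int \<Rightarrow> complex) \<Rightarrow> bool" where
  "wtfun d \<longleftrightarrow> (\<forall>i. d (- i) = inverse (d i) \<and> d i \<noteq> 0)"

text \<open>The four values \<open>- t\<^sup>r\<close> with \<open>r \<in> {\<plusminus>r\<^sub>1, \<plusminus>r\<^sub>2}\<close>.\<close>
definition special :: "complex \<Rightarrow> complex \<Rightarrow> complex \<Rightarrow> bool" where
  "special q0 qk g \<longleftrightarrow>
     g \<in> {q0 * qk, inverse (q0 * qk), - (qk * inverse q0), - (q0 * inverse qk)}"

text \<open>For \<open>d = \<gamma>\<close> and \<open>a < b\<close>: the root of the pair \<open>(a, b)\<close> lies in \<open>P(c)\<close>.\<close>
definition adj :: "complex \<Rightarrow> complex \<Rightarrow> complex \<Rightarrow> (int \<Rightarrow> complex) \<Rightarrow> int \<Rightarrow> int \<Rightarrow> bool" where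
  "adj q q0 qk d a b \<longleftrightarrow>
     (if b = - a then special q0 qk (d b) else d b = q\<^sup>2 * d a \<or> d a = q\<^sup>2 * d b)"

text \<open>The diagonal coefficient \<open>[T\<^sub>i]\<close> on a vector of weight \<open>d\<close>.\<close>
definition dcoef :: "complex \<Rightarrow> complex \<Rightarrow> complex \<Rightarrow> nat \<Rightarrow> (int \<Rightarrow> complex) \<Rightarrow> complex" where
  "dcoef q q0 qk i d =
     (if i = 0 then ((q0 - inverse q0) + (qk - inverse qk) * inverse (d 1)) / (1 - inverse (d 1) ^ 2)
      else (q - inverse q) / (1 - d (int i) * inverse (d (int i + 1))))"

definition par :: "complex \<Rightarrow> complex \<Rightarrow> nat \<Rightarrow> complex" where
  "par q q0 i = (if i = 0 then q0 else q)"

text \<open>The number under the square root in the seminormal formulas.\<close>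
definition rad :: "complex \<Rightarrow> complex \<Rightarrow> complex \<Rightarrow> nat \<Rightarrow> (int \<Rightarrow> complex) \<Rightarrow> complex" where
  "rad q q0 qk i d = - (dcoef q q0 qk i d - par q q0 i) * (dcoef q q0 qk i d + inverse (par q q0 i))"

lemma wtfunD: "wtfun d \<Longrightarrow> d (- i) = inverse (d i)" "wtfun d \<Longrightarrow> d i \<noteq> 0"
  by (auto simp: wtfun_def)

lemma wtfun_comp: "wtfun d \<Longrightarrow> y \<in> signed_perms k \<Longrightarrow> wtfun (d \<circ> y)"
  by (simp add: wtfun_def sp_neg)

lemma special_inverse: "special q0 qk g \<Longrightarrow> special q0 qk (inverse g)"
  by (auto simp: special_def)

lemma adj_neg: "wtfun d \<Longrightarrow> adj q q0 qk d a b \<Longrightarrow> adj q q0 qk d (- b) (- a)"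
  by (auto simp: adj_def wtfunD field_simps split: if_splits)

lemma adj_sym: "wtfun d \<Longrightarrow> adj q q0 qk d a b \<Longrightarrow> adj q q0 qk d b a"
  using special_inverse[of q0 qk "d b"] wtfunD(1)[of d "b"]
  by (auto simp: adj_def split: if_splits)

lemma adj_comp:
  "y \<in> signed_perms k \<Longrightarrow> adj q q0 qk (d \<circ> y) a b \<longleftrightarrow> adj q q0 qk d (y a) (y b)"
  using sp_eq_iff[of y k b "- a"] by (simp add: adj_def sp_neg)

lemma wt_ne_iff:
  assumes "wtfun d"
  shows "d (lo i) \<noteq> d (hi i) \<longleftrightarrow> (if i = 0 then (d 1)\<^sup>2 \<noteq> 1 else d (int i) \<noteq> d (int i + 1))"
proof -
  have "inverse (d 1) = d 1 \<longleftrightarrow> (d 1)\<^sup>2 = 1"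
    using wtfunD(2)[OF assms, of 1] by (auto simp: field_simps power2_eq_square)
  then show ?thesis using wtfunD(1)[OF assms, of 1] by (simp add: lo_def hi_def)
qed

text \<open>The definition with denominators cleared.  The reflected weight has \<open>\<gamma>\<^sub>1\<^sup>-\<^sup>1\<close> in place of
  \<open>\<gamma>\<^sub>1\<close>, and \<open>1 - \<gamma>\<^sub>1\<^sup>2\<close> is its denominator.\<close>
lemma dcoef_0_mult:
  assumes "wtfun d" "d (lo 0) \<noteq> d (hi 0)"
  shows "dcoef q q0 qk 0 d * ((d 1)\<^sup>2 - 1) = d 1 * ((q0 - inverse q0) * d 1 + (qk - inverse qk))"
    "dcoef q q0 qk 0 (d \<circ> simple_refl 0) * (1 - (d 1)\<^sup>2) = (q0 - inverse q0) + (qk - inverse qk) * d 1"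
proof -
  have x: "d 1 \<noteq> 0" "(d 1)\<^sup>2 \<noteq> 1" using wt_ne_iff[OF assms(1), of 0] assms wtfunD by auto
  then have "1 - inverse (d 1) ^ 2 \<noteq> 0" by (simp add: field_simps)
  then show "dcoef q q0 qk 0 d * ((d 1)\<^sup>2 - 1) = d 1 * ((q0 - inverse q0) * d 1 + (qk - inverse qk))"
    using x by (simp add: dcoef_def divide_simps) (simp add: algebra_simps power2_eq_square)
  have "d (simple_refl 0 1) = inverse (d 1)"
    using wtfunD(1)[OF assms(1), of 1] by (simp add: simple_refl_def)
  then show "dcoef q q0 qk 0 (d \<circ> simple_refl 0) * (1 - (d 1)\<^sup>2)
      = (q0 - inverse q0) + (qk - inverse qk) * d 1"
    using x by (simp add: dcoef_def)
qed

lemma dcoef_pos_mult: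
  assumes "wtfun d" "i \<noteq> 0" "d (lo i) \<noteq> d (hi i)"
  shows "dcoef q q0 qk i d * (d (int i + 1) - d (int i)) = (q - inverse q) * d (int i + 1)"
    "dcoef q q0 qk i (d \<circ> simple_refl i) * (d (int i) - d (int i + 1)) = (q - inverse q) * d (int i)"
proof -
  have n: "d (int i) \<noteq> d (int i + 1)" "d (int i) \<noteq> 0" "d (int i + 1) \<noteq> 0"
    using assms by (auto simp: wt_ne_iff wtfunD)
  then have "1 - d (int i) * inverse (d (int i + 1)) \<noteq> 0" "1 - d (int i + 1) * inverse (d (int i)) \<noteq> 0"
    by (auto simp: field_simps)
  moreover have "simple_refl i (int i) = int i + 1" "simple_refl i (int i + 1) = int i"
    using sr_lo[of i] sr_hi[of i] assms(2) by (auto simp: lo_def hi_def)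
  ultimately show "dcoef q q0 qk i d * (d (int i + 1) - d (int i)) = (q - inverse q) * d (int i + 1)"
    "dcoef q q0 qk i (d \<circ> simple_refl i) * (d (int i) - d (int i + 1)) = (q - inverse q) * d (int i)"
    using n assms(2) by (simp_all add: dcoef_def divide_simps)
qed

text \<open>The trace of \<open>T\<^sub>i\<close> on two weight lines that are exchanged by \<open>s\<^sub>i\<close>: the eigenvalues of
  \<open>T\<^sub>i\<close> are \<open>p\<close> and \<open>- p\<^sup>-\<^sup>1\<close>.\<close>
lemma dcoef_sum:
  assumes "wtfun d" "d (lo i) \<noteq> d (hi i)"
  shows "dcoef q q0 qk i d + dcoef q q0 qk i (d \<circ> simple_refl i) = par q q0 i - inverse (par q q0 i)"
proof (cases "i = 0")
  case True
  have "(d 1)\<^sup>2 - 1 \<noteq> 0" using True wt_ne_iff[OF assms(1)] assms(2) by auto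
  moreover have "(dcoef q q0 qk i d + dcoef q q0 qk i (d \<circ> simple_refl i)) * ((d 1)\<^sup>2 - 1)
      = (par q q0 i - inverse (par q q0 i)) * ((d 1)\<^sup>2 - 1)"
    using dcoef_0_mult[OF assms(1), of q q0 qk] assms(2) unfolding True par_def by simp algebra
  ultimately show ?thesis by simp
next
  case False
  have "d (int i + 1) - d (int i) \<noteq> 0" using False wt_ne_iff[OF assms(1)] assms(2) by auto
  moreover have "(dcoef q q0 qk i d + dcoef q q0 qk i (d \<circ> simple_refl i)) * (d (int i + 1) - d (int i))
      = (par q q0 i - inverse (par q q0 i)) * (d (int i + 1) - d (int i))"
    using dcoef_pos_mult[OF assms(1) False assms(2), of q q0 qk] False unfolding par_def by simp algebra
  ultimately show ?thesis by simp
qed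

lemma rad_eq:
  assumes "par q q0 i \<noteq> 0"
  shows "rad q q0 qk i d
    = - (dcoef q q0 qk i d)\<^sup>2 + (par q q0 i - inverse (par q q0 i)) * dcoef q q0 qk i d + 1"
  using assms by (simp add: rad_def algebra_simps power2_eq_square)

lemma rad_refl:
  assumes "wtfun d" "d (lo i) \<noteq> d (hi i)"
  shows "rad q q0 qk i (d \<circ> simple_refl i) = rad q q0 qk i d"
proof -
  let ?p = "par q q0 i"
  have "dcoef q q0 qk i (d \<circ> simple_refl i) = ?p - inverse ?p - dcoef q q0 qk i d"
    using dcoef_sum[OF assms, of q q0 qk] by (simp add: algebra_simps)
  then show ?thesis unfolding rad_def by (simp only:) (simp add: algebra_simps)
qed

text \<open>The numerators of \<open>[T\<^sub>0] - q\<^sub>0\<close> and \<open>[T\<^sub>0] + q\<^sub>0\<^sup>-\<^sup>1\<close> factor into linear factors.\<close>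
lemma dcoef_0_eq_iff:
  assumes "wtfun d" "d (lo 0) \<noteq> d (hi 0)" "q0 \<noteq> 0" "qk \<noteq> 0"
  shows "dcoef q q0 qk 0 d = q0 \<longleftrightarrow> d 1 = q0 * qk \<or> d 1 = - (q0 * inverse qk)"
    "dcoef q q0 qk 0 d + inverse q0 = 0 \<longleftrightarrow> d 1 = - (qk * inverse q0) \<or> d 1 = inverse (q0 * qk)"
proof -
  let ?x = "d 1" and ?e = "dcoef q q0 qk 0 d"
  have x: "?x\<^sup>2 - 1 \<noteq> 0" "?x \<noteq> 0" using wt_ne_iff[OF assms(1), of 0] assms(1,2) wtfunD by auto
  have e: "?e * (?x\<^sup>2 - 1) = ?x * ((q0 - inverse q0) * ?x + (qk - inverse qk))"
    using dcoef_0_mult[OF assms(1)] assms(2) by simp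
  have "(?e - q0) * (?x\<^sup>2 - 1) * (q0 * qk) = - (?x - q0 * qk) * (qk * ?x + q0)"
    using e assms by (simp add: left_diff_distrib) (simp add: field_simps power2_eq_square)
  then have "?e = q0 \<longleftrightarrow> ?x = q0 * qk \<or> qk * ?x + q0 = 0"
    using x assms by (metis (no_types, opaque_lifting) eq_iff_diff_eq_0 mult_eq_0_iff neg_equal_0_iff_equal)
  also have "qk * ?x + q0 = 0 \<longleftrightarrow> ?x = - (q0 * inverse qk)"
    using assms by (auto simp: field_simps eq_neg_iff_add_eq_0)
  finally show "?e = q0 \<longleftrightarrow> ?x = q0 * qk \<or> ?x = - (q0 * inverse qk)" .
  have "(?e + inverse q0) * (?x\<^sup>2 - 1) * (q0 * qk) = (q0 * ?x + qk) * (q0 * qk * ?x - 1)"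
    using e assms by (simp add: distrib_right) (simp add: field_simps power2_eq_square)
  then have "?e + inverse q0 = 0 \<longleftrightarrow> q0 * ?x + qk = 0 \<or> q0 * qk * ?x - 1 = 0"
    using x assms by (metis (no_types, opaque_lifting) mult_eq_0_iff)
  also have "q0 * ?x + qk = 0 \<longleftrightarrow> ?x = - (qk * inverse q0)"
    using assms by (auto simp: field_simps eq_neg_iff_add_eq_0)
  also have "q0 * qk * ?x - 1 = 0 \<longleftrightarrow> ?x = inverse (q0 * qk)"
    using assms by (auto simp: field_simps)
  finally show "?e + inverse q0 = 0 \<longleftrightarrow> ?x = - (qk * inverse q0) \<or> ?x = inverse (q0 * qk)" .
qed

lemma dcoef_pos_eq_iff:
  assumes "wtfun d" "d (lo i) \<noteq> d (hi i)" "i \<noteq> 0" "q \<noteq> 0"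
  shows "dcoef q q0 qk i d = q \<longleftrightarrow> d (int i + 1) = q\<^sup>2 * d (int i)"
    "dcoef q q0 qk i d + inverse q = 0 \<longleftrightarrow> d (int i) = q\<^sup>2 * d (int i + 1)"
proof -
  let ?x = "d (int i)" and ?y = "d (int i + 1)" and ?e = "dcoef q q0 qk i d"
  have x: "?y - ?x \<noteq> 0" using wt_ne_iff[OF assms(1)] assms(2,3) by auto
  have e: "?e * (?y - ?x) = (q - inverse q) * ?y"
    using dcoef_pos_mult(1)[OF assms(1,3,2)] .
  have "(?e - q) * (?y - ?x) * q = q\<^sup>2 * ?x - ?y"
    using e assms by (simp add: left_diff_distrib) (simp add: field_simps power2_eq_square)
  then show "?e = q \<longleftrightarrow> ?y = q\<^sup>2 * ?x"
    using x assms by (metis (no_types, opaque_lifting) eq_iff_diff_eq_0 mult_eq_0_iff)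
  have "(?e + inverse q) * (?y - ?x) * q = q\<^sup>2 * ?y - ?x"
    using e assms by (simp add: distrib_right) (simp add: field_simps power2_eq_square)
  then show "?e + inverse q = 0 \<longleftrightarrow> ?x = q\<^sup>2 * ?y"
    using x assms by (metis (no_types, opaque_lifting) eq_iff_diff_eq_0 mult_eq_0_iff)
qed

lemma rad_eq_0_iff:
  assumes "wtfun d" "d (lo i) \<noteq> d (hi i)" "q \<noteq> 0" "q0 \<noteq> 0" "qk \<noteq> 0"
  shows "rad q q0 qk i d = 0 \<longleftrightarrow> adj q q0 qk d (lo i) (hi i)"
proof (cases "i = 0")
  case True
  then show ?thesis
    using dcoef_0_eq_iff[of d q0 qk q] assms
    by (auto simp: rad_def par_def adj_def special_def lo_def hi_def)
next
  case False
  then show ?thesis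
    using dcoef_pos_eq_iff[of d i q q0 qk] assms
    by (auto simp: rad_def par_def adj_def lo_def hi_def)
qed

text \<open>The two rational identities behind the braid relations, with \<open>h = p - p\<^sup>-\<^sup>1\<close>.  They are
  polynomial identities once the denominators are cleared.\<close>
lemma rank2_identity_A:
  fixes x y z h :: complex
  assumes "x \<noteq> y" "y \<noteq> z" "x \<noteq> z"
    and "a * (y - x) = h * y" "b * (z - y) = h * z" "c * (z - x) = h * z"
  shows "a * b + c * (h - a - b) = 0"
proof -
  have "(a * b + c * (h - a - b)) * ((y - x) * (z - y) * (z - x)) = 0"
    using assms(4-) by algebra
  then show ?thesis using assms(1-3) by simp
qed

lemma rank2_identity_B:
  fixes x y h A B :: complex
  assumes "x \<noteq> y" "x * y \<noteq> 1" "x\<^sup>2 \<noteq> 1" "y\<^sup>2 \<noteq> 1"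
    and "b * (y - x) = h * y" "f * (x * y - 1) = h * (x * y)"
    and "e1 * (x\<^sup>2 - 1) = x * (A * x + B)" "e2 * (y\<^sup>2 - 1) = y * (A * y + B)"
  shows "b * e1 + e2 * (h - b) + f * (A - e1 - e2) = 0"
proof -
  have "(b * e1 + e2 * (h - b) + f * (A - e1 - e2))
      * ((y - x) * (x * y - 1) * (x\<^sup>2 - 1) * (y\<^sup>2 - 1)) = 0"
    using assms(5-) by algebra
  then show ?thesis using assms(1-4) by simp
qed

section \<open>Braid relations on weight vectors\<close>

locale lin_space =
  fixes M :: "('v::ab_group_add) hmod"
  assumes vs: "vector_space (hscl M)" and sub: "module.subspace (hscl M) (hcar M)"
begin

sublocale vector_space "hscl M" by (rule vs)

abbreviation scl (infixr "\<cdot>" 75) where "a \<cdot> v \<equiv> hscl M a v"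

lemma car_simps [simp]:
  "0 \<in> hcar M"
  "x \<in> hcar M \<Longrightarrow> y \<in> hcar M \<Longrightarrow> x + y \<in> hcar M"
  "x \<in> hcar M \<Longrightarrow> y \<in> hcar M \<Longrightarrow> x - y \<in> hcar M"
  "x \<in> hcar M \<Longrightarrow> - x \<in> hcar M"
  "x \<in> hcar M \<Longrightarrow> a \<cdot> x \<in> hcar M"
  by (simp_all add: sub subspace_0 subspace_add subspace_diff subspace_scale subspace_neg)

lemma linear_endoD:
  assumes "linear_endo M f"
  shows "x \<in> hcar M \<Longrightarrow> f x \<in> hcar M"
    and "x \<in> hcar M \<Longrightarrow> y \<in> hcar M \<Longrightarrow> f (x + y) = f x + f y"
    and "x \<in> hcar M \<Longrightarrow> f (a \<cdot> x) = a \<cdot> f x"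
  using assms by (auto simp: linear_endo_def)

lemma linear_endo_more:
  assumes f: "linear_endo M f"
  shows "f 0 = 0"
    and "x \<in> hcar M \<Longrightarrow> f (- x) = - f x"
    and "x \<in> hcar M \<Longrightarrow> y \<in> hcar M \<Longrightarrow> f (x - y) = f x - f y"
proof -
  show "f 0 = 0" using linear_endoD(3)[OF f, of 0 0] by simp
  show neg: "f (- x) = - f x" if "x \<in> hcar M" for x
    using linear_endoD(3)[OF f that, of "- 1"] by simp
  show "f (x - y) = f x - f y" if "x \<in> hcar M" "y \<in> hcar M"
    using linear_endoD(2)[OF f that(1), of "- y"] neg[OF that(2)] that by simp
qed

lemma linear_endo_sum:
  assumes f: "linear_endo M f" and "\<And>x. x \<in> A \<Longrightarrow> g x \<in> hcar M"
  shows "f (\<Sum>x\<in>A. g x) = (\<Sum>x\<in>A. f (g x)) \<and> (\<Sum>x\<in>A. g x) \<in> hcar M"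
  using assms(2)
  by (induction A rule: infinite_finite_induct)
     (auto simp: linear_endo_more[OF f] linear_endoD[OF f])

lemma linear_endo_intros:
  assumes f: "linear_endo M f" and g: "linear_endo M g"
  shows "linear_endo M (\<lambda>x. f (g x))" "linear_endo M (\<lambda>x. f x + g x)"
    "linear_endo M (\<lambda>x. a \<cdot> f x)" "linear_endo M (\<lambda>x. - f x)"
  unfolding linear_endo_def
  by (auto simp: linear_endoD[OF f] linear_endoD[OF g] scale_right_distrib mult.commute)

lemma linear_endo_ident: "linear_endo M (\<lambda>x. x)"
  by (simp add: linear_endo_def)

lemma linear_endo_eq_on_span:
  assumes f: "linear_endo M f" and g: "linear_endo M g" and B: "B \<subseteq> hcar M"
    and eq: "\<And>b. b \<in> B \<Longrightarrow> f b = g b" and x: "x \<in> span B"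
  shows "f x = g x"
proof -
  have "span B \<subseteq> {x \<in> hcar M. f x = g x}"
  proof (rule span_minimal)
    show "subspace {x \<in> hcar M. f x = g x}"
      by (rule subspaceI)
         (auto simp: linear_endo_more[OF f] linear_endo_more[OF g] linear_endoD[OF f] linear_endoD[OF g])
  qed (use B eq in auto)
  then show ?thesis using x by blast
qed

lemma linear_endo_span:
  assumes f: "linear_endo M f" and "B \<subseteq> hcar M" and "\<And>b. b \<in> B \<Longrightarrow> f b \<in> span B"
  shows "f ` span B \<subseteq> span B"
proof -
  have "span B \<subseteq> {x \<in> hcar M. f x \<in> span B}"
  proof (rule span_minimal)
    show "subspace {x \<in> hcar M. f x \<in> span B}"
      by (rule subspaceI)
         (auto simp: linear_endo_more[OF f] linear_endoD[OF f] span_zero span_add span_scale)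
  qed (use assms in auto)
  then show ?thesis by auto
qed

text \<open>Applying \<open>W\<^sub>j\<close> minus its eigenvalue on one summand removes this summand and only rescales the
  others, which gives an induction on the number of summands.  With \<open>U = {0}\<close> this is the linear
  independence of joint eigenvectors.\<close>
lemma joint_eigenvector_components:
  assumes "finite S" and U: "subspace U" "U \<subseteq> hcar M"
    and W: "\<And>j. j \<in> J \<Longrightarrow> linear_endo M (W j)" "\<And>j. j \<in> J \<Longrightarrow> W j ` U \<subseteq> U"
    and x: "\<And>s. s \<in> S \<Longrightarrow> x s \<in> hcar M" "\<And>s j. s \<in> S \<Longrightarrow> j \<in> J \<Longrightarrow> W j (x s) = l j s \<cdot> x s"
    and distinct: "\<And>s s'. s \<in> S \<Longrightarrow> s' \<in> S \<Longrightarrow> s \<noteq> s' \<Longrightarrow> \<exists>j\<in>J. l j s \<noteq> l j s'"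
    and "(\<Sum>s\<in>S. c s \<cdot> x s) \<in> U" and "s \<in> S"
  shows "c s \<cdot> x s \<in> U"
  using \<open>finite S\<close> x distinct assms(9,10)
proof (induction S arbitrary: c s rule: finite_induct)
  case (insert s0 S)
  let ?f = "\<Sum>s\<in>insert s0 S. c s \<cdot> x s"
  have rest: "c s \<cdot> x s \<in> U" if s: "s \<in> S" for s
  proof -
    obtain j where j: "j \<in> J" "l j s \<noteq> l j s0" using insert s by (metis insertCI)
    note f = W(1)[OF j(1)]
    have "W j ?f - l j s0 \<cdot> ?f = (\<Sum>s\<in>insert s0 S. W j (c s \<cdot> x s) - (l j s0 * c s) \<cdot> x s)"
      using linear_endo_sum[OF f, of "insert s0 S" "\<lambda>s. c s \<cdot> x s"] insert(4)
      by (simp add: sum_subtractf scale_sum_right del: sum.insert)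
    also have "\<dots> = (\<Sum>s\<in>insert s0 S. (c s * (l j s - l j s0)) \<cdot> x s)"
      using insert(4,5) j by (intro sum.cong)
        (auto simp: linear_endoD[OF f] scale_left_diff_distrib right_diff_distrib mult.commute)
    also have "\<dots> = (\<Sum>s\<in>S. (c s * (l j s - l j s0)) \<cdot> x s)"
      using insert by simp
    finally have "(\<Sum>s\<in>S. (c s * (l j s - l j s0)) \<cdot> x s) = W j ?f - l j s0 \<cdot> ?f" ..
    also have "\<dots> \<in> U"
      using U W(2)[OF j(1)] insert.prems(4) by (intro subspace_diff subspace_scale) auto
    finally have "(c s * (l j s - l j s0)) \<cdot> x s \<in> U"
      using insert.prems s by (intro insert.IH) auto
    from subspace_scale[OF U(1) this, of "inverse (l j s - l j s0)"]
    have "(inverse (l j s - l j s0) * (c s * (l j s - l j s0))) \<cdot> x s \<in> U" by simp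
    moreover have "inverse (l j s - l j s0) * (c s * (l j s - l j s0)) = c s" using j by simp
    ultimately show ?thesis by simp
  qed
  show ?case
  proof (cases "s = s0")
    case True
    have "?f - (\<Sum>s\<in>S. c s \<cdot> x s) \<in> U"
      by (intro subspace_diff subspace_sum U insert.prems(4) rest)
    also have "?f - (\<Sum>s\<in>S. c s \<cdot> x s) = c s0 \<cdot> x s0" using insert by simp
    finally show ?thesis using True by simp
  qed (use rest insert in auto)
qed simp

text \<open>Here \<open>v1, v2, v12, \<dots>\<close> stand for the images of \<open>v\<close> under words of intertwining operators.
  Expanding both sides of the braid relation in these seven vectors, all coefficients but those
  of the two longest words agree by \<open>rank2_identity_A\<close>.  So the braid relation for the
  operators \<open>A\<close>, \<open>B\<close> on \<open>v\<close> is equivalent to the one for the intertwining operators.\<close>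
lemma braid_A:
  assumes A: "linear_endo M A" and B: "linear_endo M B"
    and car: "v \<in> hcar M" "v1 \<in> hcar M" "v2 \<in> hcar M" "v12 \<in> hcar M" "v21 \<in> hcar M"
      "v121 \<in> hcar M" "v212 \<in> hcar M"
    and act: "A v = a \<cdot> v + v1" "B v = b \<cdot> v + v2"
      "A v1 = (h - a) \<cdot> v1 + ra \<cdot> v" "B v2 = (h - b) \<cdot> v2 + rb \<cdot> v"
      "B v1 = c \<cdot> v1 + v21" "A v2 = c \<cdot> v2 + v12"
      "A v21 = b \<cdot> v21 + v121" "B v12 = a \<cdot> v12 + v212"
    and r: "ra = - a\<^sup>2 + h * a + 1" "rb = - b\<^sup>2 + h * b + 1"
    and id: "a * b + c * (h - a - b) = 0"
  shows "A (B (A v)) - B (A (B v)) = v121 - v212"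
proof -
  note lin = linear_endoD[OF A] linear_endoD[OF B]
  note expand = scale_left_distrib scale_right_distrib scale_left_diff_distrib scale_right_diff_distrib
  have 1: "A (B (A v)) = (a\<^sup>2 * b + c * ra) \<cdot> v + (a * b + c * (h - a)) \<cdot> v1 + (a * c) \<cdot> v2
      + a \<cdot> v12 + b \<cdot> v21 + v121"
    using car by (simp add: lin act expand algebra_simps power2_eq_square)
  have 2: "B (A (B v)) = (b\<^sup>2 * a + c * rb) \<cdot> v + (b * c) \<cdot> v1 + (a * b + c * (h - b)) \<cdot> v2
      + a \<cdot> v12 + b \<cdot> v21 + v212"
    using car by (simp add: lin act expand algebra_simps power2_eq_square)
  have "a\<^sup>2 * b + c * ra = b\<^sup>2 * a + c * rb" "a * b + c * (h - a) = b * c" "a * c = a * b + c * (h - b)"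
    using id unfolding r by algebra+
  then show ?thesis unfolding 1 2 by simp
qed

text \<open>The analogous calculation for the relation of length four.\<close>
lemma braid_B:
  assumes A: "linear_endo M A" and B: "linear_endo M B"
    and car: "v \<in> hcar M" "vA \<in> hcar M" "vB \<in> hcar M" "vAB \<in> hcar M" "vBA \<in> hcar M"
      "vABA \<in> hcar M" "vBAB \<in> hcar M" "vABAB \<in> hcar M" "vBABA \<in> hcar M"
    and act: "A v = e1 \<cdot> v + vA" "B v = b \<cdot> v + vB"
      "A vA = (h0 - e1) \<cdot> vA + r1 \<cdot> v" "B vB = (h - b) \<cdot> vB + rb \<cdot> v"
      "B vA = f \<cdot> vA + vBA" "A vB = e2 \<cdot> vB + vAB"
      "B vBA = (h - f) \<cdot> vBA + rf \<cdot> vA" "A vAB = (h0 - e2) \<cdot> vAB + r2 \<cdot> vB"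
      "A vBA = e2 \<cdot> vBA + vABA" "B vAB = f \<cdot> vAB + vBAB"
      "A vBAB = e1 \<cdot> vBAB + vABAB" "B vABA = b \<cdot> vABA + vBABA"
    and r: "rb = - b\<^sup>2 + h * b + 1" "rf = - f\<^sup>2 + h * f + 1"
      "r1 = - e1\<^sup>2 + h0 * e1 + 1" "r2 = - e2\<^sup>2 + h0 * e2 + 1"
    and id: "b * e1 + e2 * (h - b) + f * (h0 - e1 - e2) = 0"
  shows "A (B (A (B v))) - B (A (B (A v))) = vABAB - vBABA"
proof -
  note lin = linear_endoD[OF A] linear_endoD[OF B]
  note expand = scale_left_distrib scale_right_distrib scale_left_diff_distrib scale_right_diff_distrib
  have 1: "B (A (B v)) = (b\<^sup>2 * e1 + e2 * rb) \<cdot> v + (b * e1 + e2 * (h - b)) \<cdot> vB + (b * f) \<cdot> vA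
      + b \<cdot> vBA + f \<cdot> vAB + vBAB"
    using car by (simp add: lin act expand algebra_simps power2_eq_square)
  have 2: "A (B (A v)) = (e1\<^sup>2 * b + f * r1) \<cdot> v + (e1 * b + f * (h0 - e1)) \<cdot> vA + (e1 * e2) \<cdot> vB
      + e1 \<cdot> vAB + e2 \<cdot> vBA + vABA"
    using car by (simp add: lin act expand algebra_simps power2_eq_square)
  have 3: "A (B (A (B v))) = ((b\<^sup>2 * e1 + e2 * rb) * e1 + b * f * r1) \<cdot> v
      + ((b * e1 + e2 * (h - b)) * e2 + f * r2) \<cdot> vB
      + (b\<^sup>2 * e1 + e2 * rb + b * f * (h0 - e1)) \<cdot> vA
      + (b * e2) \<cdot> vBA + (b * e1 + e2 * (h - b) + f * (h0 - e2)) \<cdot> vAB + e1 \<cdot> vBAB + b \<cdot> vABA + vABAB"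
    unfolding 1 using car
    by (simp add: lin) (simp add: act expand algebra_simps power2_eq_square)
  have 4: "B (A (B (A v))) = ((e1\<^sup>2 * b + f * r1) * b + e1 * e2 * rb) \<cdot> v
      + (e1\<^sup>2 * b + f * r1 + e1 * e2 * (h - b)) \<cdot> vB
      + ((e1 * b + f * (h0 - e1)) * f + e2 * rf) \<cdot> vA
      + (e1 * b + f * (h0 - e1) + e2 * (h - f)) \<cdot> vBA + (e1 * f) \<cdot> vAB + e1 \<cdot> vBAB + b \<cdot> vABA + vBABA"
    unfolding 2 using car
    by (simp add: lin) (simp add: act expand algebra_simps power2_eq_square)
  have "(b\<^sup>2 * e1 + e2 * rb) * e1 + b * f * r1 = (e1\<^sup>2 * b + f * r1) * b + e1 * e2 * rb"
    by algebra
  moreover have "(b * e1 + e2 * (h - b)) * e2 + f * r2 = e1\<^sup>2 * b + f * r1 + e1 * e2 * (h - b)"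
    "b\<^sup>2 * e1 + e2 * rb + b * f * (h0 - e1) = (e1 * b + f * (h0 - e1)) * f + e2 * rf"
    "b * e2 = e1 * b + f * (h0 - e1) + e2 * (h - f)"
    "b * e1 + e2 * (h - b) + f * (h0 - e2) = e1 * f"
    using id unfolding r by algebra+
  ultimately show ?thesis unfolding 3 4 by simp
qed

text \<open>If only the line of \<open>v\<close> and one further weight line \<open>u\<close> survive from the orbit of a rank two
  group of type \<open>B\<^sub>2\<close>, then the braid relation restricts the diagonal coefficients: for
  \<open>2 \<times> 2\<close> matrices, \<open>(AB)\<^sup>2 - (BA)\<^sup>2 = tr(AB) (AB - BA)\<close>.\<close>
lemma braid_rank2_obstruction:
  assumes A: "linear_endo M A" and B: "linear_endo M B" and car: "v \<in> hcar M" "u \<in> hcar M"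
    and act: "A v = a \<cdot> v" "A u = a' \<cdot> u" "B v = e \<cdot> v + u" "B u = e' \<cdot> u + r \<cdot> v"
    and braid: "A (B (A (B v))) = B (A (B (A v)))"
  shows "((a' - a) * (a * e + a' * e')) \<cdot> u = 0"
proof -
  note lin = linear_endoD[OF A] linear_endoD[OF B]
  note expand = scale_left_distrib scale_right_distrib scale_left_diff_distrib scale_right_diff_distrib
  have 1: "A (B (A (B v))) = (a * (a * e * e + a' * r)) \<cdot> v + (a' * (a * e + a' * e')) \<cdot> u"
    using car by (simp add: lin act expand algebra_simps)
  have 2: "B (A (B (A v))) = (a * (a * e * e + a' * r)) \<cdot> v + (a * (a * e + a' * e')) \<cdot> u"
    using car by (simp add: lin act expand algebra_simps)
  show ?thesis using braid unfolding 1 2 by (simp add: left_diff_distrib scale_left_diff_distrib)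
qed

end

section \<open>Intertwining operators\<close>

locale hecke_params =
  fixes k :: nat and q q0 qk :: complex
  assumes k_pos: "k \<ge> 1"
    and nonzero: "q \<noteq> 0" "q0 \<noteq> 0" "qk \<noteq> 0"
    and not_root: "\<forall>n::nat. n \<ge> 1 \<longrightarrow> q ^ n \<noteq> 1"
    and generic1: "q0 * qk \<notin> {1, - 1, q, inverse q, - q, - inverse q,
                      q ^ 2, inverse (q ^ 2), - (q ^ 2), - inverse (q ^ 2)}"
    and generic2: "- (inverse q0 * qk) \<notin> {1, - 1, q, inverse q, - q, - inverse q,
                      q ^ 2, inverse (q ^ 2), - (q ^ 2), - inverse (q ^ 2)}"
    and generic3: "q0 * qk \<noteq> - (inverse q0 * qk)"
    and generic4: "q0 * qk \<noteq> inverse (- (inverse q0 * qk))"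
begin

declare One_nat_def [simp del] add_Suc_right [simp del]

abbreviation "dc \<equiv> dcoef q q0 qk"
abbreviation "rd \<equiv> rad q q0 qk"
abbreviation "pr \<equiv> par q q0"
abbreviation "adjc \<equiv> adj q q0 qk"
abbreviation "s \<equiv> simple_refl"

lemma pr_nz: "pr i \<noteq> 0"
  using nonzero by (simp add: par_def)

lemma q2: "q\<^sup>2 \<noteq> 1" "q\<^sup>2 \<noteq> - 1" "q - inverse q \<noteq> 0"
proof -
  show 1: "q\<^sup>2 \<noteq> 1" using not_root by auto
  have "q ^ 4 \<noteq> 1" using not_root by auto
  then show "q\<^sup>2 \<noteq> - 1" by (auto simp: power2_eq_square power4_eq_xxxx)
  show "q - inverse q \<noteq> 0" using 1 nonzero by (auto simp: field_simps power2_eq_square)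
qed

lemma q0_sq: "q0\<^sup>2 \<noteq> - 1"
proof
  assume "q0\<^sup>2 = - 1"
  then have "inverse q0 = - q0" by (intro inverse_unique) (simp add: power2_eq_square)
  then show False using generic3 by simp
qed

lemma qk_sq: "qk\<^sup>2 \<noteq> - 1"
  using generic4 nonzero by (auto simp: field_simps power2_eq_square)

text \<open>In terms of squares, the excluded values form a set that is stable under inversion.\<close>
lemma generic_sq:
  assumes "g \<notin> {1, - 1, q, inverse q, - q, - inverse q,
               q ^ 2, inverse (q ^ 2), - (q ^ 2), - inverse (q ^ 2)}"
  shows "g\<^sup>2 \<noteq> q\<^sup>2" "g\<^sup>2 * q\<^sup>2 \<noteq> 1" "g\<^sup>2 \<noteq> (q\<^sup>2)\<^sup>2" "g\<^sup>2 * (q\<^sup>2)\<^sup>2 \<noteq> 1"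
proof -
  show "g\<^sup>2 \<noteq> q\<^sup>2" "g\<^sup>2 \<noteq> (q\<^sup>2)\<^sup>2"
    using assms unfolding power2_eq_iff by blast+
  have inv: "(g * r)\<^sup>2 \<noteq> 1" if "g \<noteq> inverse r" "g \<noteq> - inverse r" for r
  proof
    assume "(g * r)\<^sup>2 = 1"
    then have "r * g = 1 \<or> r * (- g) = 1" by (auto simp: power2_eq_1_iff mult.commute)
    then show False using that inverse_unique[of r g] inverse_unique[of r "- g"] by auto
  qed
  show "g\<^sup>2 * q\<^sup>2 \<noteq> 1" "g\<^sup>2 * (q\<^sup>2)\<^sup>2 \<noteq> 1"
    using assms inv[of q] inv[of "q\<^sup>2"] by (auto simp: power_mult_distrib)
qed

lemma special_sq:
  assumes "special q0 qk g"
  shows "g\<^sup>2 \<noteq> q\<^sup>2" "g\<^sup>2 * q\<^sup>2 \<noteq> 1" "g\<^sup>2 \<noteq> (q\<^sup>2)\<^sup>2" "g\<^sup>2 * (q\<^sup>2)\<^sup>2 \<noteq> 1"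
proof -
  define ok where "ok g \<longleftrightarrow> g \<noteq> 0 \<and> g\<^sup>2 \<noteq> q\<^sup>2 \<and> g\<^sup>2 * q\<^sup>2 \<noteq> 1 \<and> g\<^sup>2 \<noteq> (q\<^sup>2)\<^sup>2 \<and> g\<^sup>2 * (q\<^sup>2)\<^sup>2 \<noteq> 1"
    for g
  have inv: "ok (inverse g)" if "ok g" for g
    using that nonzero(1) unfolding ok_def power_inverse by (auto simp: field_simps)
  have "ok (q0 * qk)" "ok (- (inverse q0 * qk))"
    using generic_sq[OF generic1] generic_sq[OF generic2] nonzero unfolding ok_def by auto
  with inv have "ok (q0 * qk)" "ok (- (inverse q0 * qk))" "ok (inverse (q0 * qk))"
    "ok (inverse (- (inverse q0 * qk)))" by blast+
  moreover have "inverse (- (inverse q0 * qk)) = - (q0 * inverse qk)" "inverse q0 * qk = qk * inverse q0"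
    using nonzero by (auto simp: field_simps)
  ultimately have "ok g" using assms unfolding special_def by (auto simp: mult.commute)
  then show "g\<^sup>2 \<noteq> q\<^sup>2" "g\<^sup>2 * q\<^sup>2 \<noteq> 1" "g\<^sup>2 \<noteq> (q\<^sup>2)\<^sup>2" "g\<^sup>2 * (q\<^sup>2)\<^sup>2 \<noteq> 1"
    unfolding ok_def by blast+
qed

lemma special_sq_q2:
  assumes "special q0 qk g" "y\<^sup>2 = 1"
  shows "y \<noteq> q\<^sup>2 * g" "g \<noteq> q\<^sup>2 * y"
  using special_sq(3,4)[OF assms(1)] assms(2) by (auto simp: power_mult_distrib mult.commute)

text \<open>The coefficient of the Jordan block of \<open>W\<^sub>1\<close> that \<open>T\<^sub>0\<close> produces from a vector with
  \<open>\<gamma>\<^sub>1 = g\<close>.  It factors, and its zeros are excluded by the assumptions on the parameters.\<close>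
lemma wall_coeff_nz:
  assumes "g\<^sup>2 = 1"
  shows "(q0 - inverse q0) * g + (qk - inverse qk) \<noteq> 0" "(q0 - inverse q0) + (qk - inverse qk) * g \<noteq> 0"
proof -
  have g: "g = 1 \<or> g = - 1" using assms by (simp add: power2_eq_1_iff)
  have "q0 + qk * g \<noteq> 0"
  proof
    assume "q0 + qk * g = 0"
    then have "q0 = - (qk * g)" by (simp add: eq_neg_iff_add_eq_0)
    then have "inverse q0 * qk = 1 \<or> inverse q0 * qk = - 1" using g nonzero by auto
    then show False using generic2 by auto
  qed
  moreover have "q0 * qk - g \<noteq> 0" using g generic1 by auto
  moreover have "(q0 + qk * g) * (q0 * qk - g)
      = ((q0 - inverse q0) + (qk - inverse qk) * g) * (q0 * qk)"
    using g nonzero by (auto simp: field_simps)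
  ultimately show *: "(q0 - inverse q0) + (qk - inverse qk) * g \<noteq> 0" by auto
  show "(q0 - inverse q0) * g + (qk - inverse qk) \<noteq> 0" using * g by (auto simp: algebra_simps)
qed

text \<open>The weight has trivial stabilizer in each of the rank two groups generated by two
  non-commuting simple reflections (and in each group generated by one simple reflection).\<close>
definition regular :: "(int \<Rightarrow> complex) \<Rightarrow> bool" where
  "regular d \<longleftrightarrow> (\<forall>i<k. d (lo i) \<noteq> d (hi i)) \<and>
     (\<forall>i. 1 \<le> i \<and> i + 2 \<le> k \<longrightarrow> d (int i) \<noteq> d (int i + 2)) \<and>
     (2 \<le> k \<longrightarrow> d 1 \<noteq> d (- 2) \<and> d 2 \<noteq> d (- 2))"

lemma s_neg: "s i (- x) = - s i x"
  by (simp add: simple_refl_eq_swap signed_swap_neg lo_def hi_def)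

lemma s_eval:
  "x \<ge> 0 \<Longrightarrow> s i x = (if i = 0 then if x = 1 then - 1 else x
     else if x = int i then int i + 1 else if x = int i + 1 then int i else x)"
  by (auto simp: simple_refl_eq_swap signed_swap_def lo_def hi_def)

lemma odd_eqI:
  assumes "\<And>x::int. x \<ge> 0 \<Longrightarrow> f x = g x" "\<And>x. f (- x) = - f x" "\<And>x. g (- x) = - g x"
  shows "f x = (g x :: int)"
  using assms(1)[of x] assms(1)[of "- x"] assms(2)[of x] assms(3)[of x] by (cases "x \<ge> 0") auto

lemma braid_refl_A:
  assumes "1 \<le> i"
  shows "s i (s (i + 1) (s i x)) = s (i + 1) (s i (s (i + 1) x))"
    "s i (int i) = int i + 1" "s i (int i + 1) = int i" "s i (int i + 2) = int i + 2"
    "s (i + 1) (int i) = int i" "s (i + 1) (int i + 1) = int i + 2" "s (i + 1) (int i + 2) = int i + 1"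
proof -
  show "s i (s (i + 1) (s i x)) = s (i + 1) (s i (s (i + 1) x))"
    by (rule odd_eqI) (use assms in \<open>simp_all add: s_neg s_eval\<close>)
qed (use assms in \<open>simp_all add: s_eval\<close>)

lemma braid_refl_B:
  "s 0 (s 1 (s 0 (s 1 x))) = s 1 (s 0 (s 1 (s 0 x)))"
  "s 0 1 = - 1" "s 0 2 = 2" "s 0 (- 1) = 1" "s 0 (- 2) = - 2"
  "s 1 1 = 2" "s 1 2 = 1" "s 1 (- 1) = - 2" "s 1 (- 2) = - 1"
proof -
  show "s 0 (s 1 (s 0 (s 1 x))) = s 1 (s 0 (s 1 (s 0 x)))"
    by (rule odd_eqI) (simp_all add: s_neg s_eval)
qed (simp_all add: s_neg s_eval)

lemma commute_refl:
  assumes "i + 2 \<le> j"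
  shows "s i (s j x) = s j (s i x)" "s j (lo i) = lo i" "s j (hi i) = hi i"
    "s i (lo j) = lo j" "s i (hi j) = hi j"
proof -
  show "s i (s j x) = s j (s i x)"
    by (rule odd_eqI) (use assms in \<open>simp_all add: s_neg s_eval\<close>)
qed (use assms in \<open>simp_all add: s_neg s_eval lo_def hi_def\<close>)

lemma dc_pos: "i \<noteq> 0 \<Longrightarrow> dc i d = (q - inverse q) / (1 - d (lo i) * inverse (d (hi i)))"
  by (simp add: dcoef_def lo_def hi_def)

lemma dc_cong: "d (lo i) = d' (lo i) \<Longrightarrow> d (hi i) = d' (hi i) \<Longrightarrow> dc i d = dc i d'"
  by (auto simp: dcoef_def lo_def hi_def)

lemma rd_cong: "dc i d = dc j d' \<Longrightarrow> pr i = pr j \<Longrightarrow> rd i d = rd j d'"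
  by (simp add: rad_def)

text \<open>Along the two reduced words of the longest element the same positive roots occur in opposite
  order, so the same diagonal coefficients occur.\<close>
lemma braid_dc_A:
  assumes "1 \<le> i"
  shows "dc i (d \<circ> s (i + 1)) = dc (i + 1) (d \<circ> s i)"
    "dc i (d \<circ> s i \<circ> s (i + 1)) = dc (i + 1) d"
    "dc (i + 1) (d \<circ> s (i + 1) \<circ> s i) = dc i d"
proof -
  have "lo i = int i" "hi i = int i + 1" "lo (i + 1) = int i + 1" "hi (i + 1) = int i + 2"
    using assms by (auto simp: lo_def hi_def)
  then show "dc i (d \<circ> s (i + 1)) = dc (i + 1) (d \<circ> s i)"
    "dc i (d \<circ> s i \<circ> s (i + 1)) = dc (i + 1) d"
    "dc (i + 1) (d \<circ> s (i + 1) \<circ> s i) = dc i d"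
    using assms by (simp_all add: dc_pos braid_refl_A[OF assms])
qed

lemma braid_dc_B:
  assumes d: "wtfun d"
  shows "dc 1 (d \<circ> s 1 \<circ> s 0) = dc 1 (d \<circ> s 0)" "dc 0 (d \<circ> s 0 \<circ> s 1) = dc 0 (d \<circ> s 1)"
    "dc 0 (d \<circ> s 1 \<circ> s 0 \<circ> s 1) = dc 0 d" "dc 1 (d \<circ> s 0 \<circ> s 1 \<circ> s 0) = dc 1 d"
proof -
  have "d (- 1) = inverse (d 1)" "d (- 2) = inverse (d 2)" "d 1 \<noteq> 0" "d 2 \<noteq> 0"
    using d by (auto simp: wtfunD)
  then show "dc 1 (d \<circ> s 1 \<circ> s 0) = dc 1 (d \<circ> s 0)" "dc 0 (d \<circ> s 0 \<circ> s 1) = dc 0 (d \<circ> s 1)"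
    "dc 0 (d \<circ> s 1 \<circ> s 0 \<circ> s 1) = dc 0 d" "dc 1 (d \<circ> s 0 \<circ> s 1 \<circ> s 0) = dc 1 d"
    by (auto simp: dcoef_def braid_refl_B mult.commute)
qed

end

text \<open>The linear and quadratic relations suffice to relate the braid relations for the \<open>T\<^sub>i\<close> to those
  for the intertwining operators.  This is used in both directions: to derive the latter in a
  given module, and to verify the former in the modules of the theorem.\<close>
locale quad_mod = hecke_params k q q0 qk + lin_space M
  for k q q0 qk and M :: "('v::ab_group_add) hmod" +
  assumes T_lin: "i < k \<Longrightarrow> linear_endo M (hT M i)"
    and T_quad: "i < k \<Longrightarrow> quadratic_rel M (hT M i) (pr i)"
begin

text \<open>On the weight space of weight \<open>d\<close>, this is the intertwining operator
  \<open>\<tau>\<^sub>i = T\<^sub>i - [T\<^sub>i]\<close> to the weight space of weight \<open>d \<circ> s\<^sub>i\<close>.\<close>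
definition tau :: "nat \<Rightarrow> (int \<Rightarrow> complex) \<Rightarrow> 'v \<Rightarrow> 'v" where
  "tau i d v = hT M i v - dc i d \<cdot> v"

lemma T_car [simp]: "i < k \<Longrightarrow> v \<in> hcar M \<Longrightarrow> hT M i v \<in> hcar M"
  using linear_endoD(1)[OF T_lin] .

lemma tau_car [simp]: "i < k \<Longrightarrow> v \<in> hcar M \<Longrightarrow> tau i d v \<in> hcar M"
  by (simp add: tau_def)

lemma tau_lin: "i < k \<Longrightarrow> linear_endo M (tau i d)"
  unfolding linear_endo_def
  by (auto simp: tau_def linear_endoD[OF T_lin] scale_right_distrib scale_right_diff_distrib mult.commute)

lemma tau_0 [simp]: "i < k \<Longrightarrow> tau i d 0 = 0"
  using linear_endo_more(1)[OF tau_lin] .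

lemma T_eq_tau: "hT M i v = dc i d \<cdot> v + tau i d v"
  by (simp add: tau_def)

lemma TT:
  assumes "i < k" "v \<in> hcar M"
  shows "hT M i (hT M i v) = (pr i - inverse (pr i)) \<cdot> hT M i v + v"
proof -
  have "hT M i (hT M i v + inverse (pr i) \<cdot> v) - pr i \<cdot> (hT M i v + inverse (pr i) \<cdot> v) = 0"
    using T_quad[OF assms(1)] assms(2) by (simp add: quadratic_rel_def Let_def)
  then show ?thesis
    using assms pr_nz[of i]
    by (simp add: linear_endoD[OF T_lin] scale_right_distrib scale_left_diff_distrib algebra_simps)
qed

lemma T_tau:
  assumes i: "i < k" and v: "v \<in> hcar M"
  shows "hT M i (tau i d v) = (pr i - inverse (pr i) - dc i d) \<cdot> tau i d v + rd i d \<cdot> v"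
proof -
  have lin: "hT M i (tau i d v) = hT M i (hT M i v) - dc i d \<cdot> hT M i v"
    using i v by (simp add: tau_def linear_endo_more[OF T_lin] linear_endoD[OF T_lin])
  show ?thesis
    unfolding lin unfolding TT[OF i v] rad_eq[OF pr_nz] tau_def
    by (simp add: scale_left_distrib scale_right_distrib scale_left_diff_distrib
        scale_right_diff_distrib power2_eq_square) (simp add: algebra_simps)
qed

text \<open>So \<open>\<tau>\<^sub>i\<close> is invertible between the two weight spaces unless \<open>rad\<close> vanishes, which by
  \<open>rad_eq_0_iff\<close> happens on the hyperplanes of \<open>P(c)\<close>.\<close>
lemma tau_tau:
  assumes i: "i < k" and v: "v \<in> hcar M" and d: "wtfun d" "d (lo i) \<noteq> d (hi i)"
  shows "tau i (d \<circ> s i) (tau i d v) = rd i d \<cdot> v"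
proof -
  have "dc i (d \<circ> s i) = pr i - inverse (pr i) - dc i d"
    using dcoef_sum[OF d, of q q0 qk] by (simp add: algebra_simps)
  then show ?thesis
    using T_tau[OF i v, of d] by (subst tau_def) simp
qed

lemma braid_tau_A:
  assumes i: "1 \<le> i" "i + 1 < k" and d: "wtfun d" "regular d" and v: "v \<in> hcar M"
  shows "hT M i (hT M (i+1) (hT M i v)) - hT M (i+1) (hT M i (hT M (i+1) v)) =
    tau i (d \<circ> s i \<circ> s (i+1)) (tau (i+1) (d \<circ> s i) (tau i d v)) -
    tau (i+1) (d \<circ> s (i+1) \<circ> s i) (tau i (d \<circ> s (i+1)) (tau (i+1) d v))"
proof -
  let ?j = "i + 1" and ?h = "q - inverse q"
  let ?v1 = "tau i d v" and ?v2 = "tau ?j d v"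
  let ?v12 = "tau i (d \<circ> s ?j) ?v2" and ?v21 = "tau ?j (d \<circ> s i) ?v1"
  note br = braid_refl_A[OF i(1)]
  have ij: "i < k" "?j < k" using i by auto
  have pr: "pr i = q" "pr ?j = q" using i by (auto simp: par_def)
  have lohi: "lo i = int i" "hi i = int i + 1" "lo ?j = int i + 1" "hi ?j = int i + 2"
    using i by (auto simp: lo_def hi_def)
  define x y z where "x = d (int i)" "y = d (int i + 1)" "z = d (int i + 2)"
  note xyz = x_y_z_def
  have ne: "x \<noteq> y" "y \<noteq> z" "x \<noteq> z"
  proof -
    have "d (lo i) \<noteq> d (hi i)" "d (lo ?j) \<noteq> d (hi ?j)" "d (int i) \<noteq> d (int i + 2)"
      using d(2) i unfolding regular_def by auto
    then show "x \<noteq> y" "y \<noteq> z" "x \<noteq> z"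
      by (simp_all add: xyz lohi)
  qed
  have nz: "x \<noteq> 0" "y \<noteq> 0" "z \<noteq> 0" using d(1) by (auto simp: xyz wtfunD)
  define a b c where "a = dc i d" "b = dc ?j d" "c = dc ?j (d \<circ> s i)"
  note abc = a_b_c_def
  have e: "c = dc i (d \<circ> s ?j)" "b = dc i (d \<circ> s i \<circ> s ?j)" "a = dc ?j (d \<circ> s ?j \<circ> s i)"
    unfolding abc using braid_dc_A[OF i(1)] by simp_all
  have mult: "a * (y - x) = ?h * y" "b * (z - y) = ?h * z" "c * (z - x) = ?h * z"
    using i ne nz unfolding abc
    by (simp_all add: dc_pos lohi br xyz[symmetric] divide_simps)
  have id: "a * b + c * (?h - a - b) = 0"
    by (rule rank2_identity_A[OF ne mult])
  show ?thesis
  proof (rule braid_A[OF T_lin[OF ij(1)] T_lin[OF ij(2)], where a = a and b = b and c = c and h = ?h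
        and ra = "rd i d" and rb = "rd ?j d"])
    show "hT M i (?v1) = (?h - a) \<cdot> ?v1 + rd i d \<cdot> v"
      using T_tau[OF ij(1) v] unfolding pr abc by blast
    show "hT M ?j (?v2) = (?h - b) \<cdot> ?v2 + rd ?j d \<cdot> v"
      using T_tau[OF ij(2) v] unfolding pr abc by blast
    show "rd i d = - a\<^sup>2 + ?h * a + 1" "rd ?j d = - b\<^sup>2 + ?h * b + 1"
      using rad_eq[OF pr_nz, of qk i d] rad_eq[OF pr_nz, of qk ?j d] unfolding pr abc by blast+
    show "hT M i v = a \<cdot> v + ?v1" "hT M ?j v = b \<cdot> v + ?v2"
      "hT M ?j (?v1) = c \<cdot> ?v1 + ?v21"
      by (simp_all add: abc tau_def)
    show "hT M i (?v2) = c \<cdot> ?v2 + ?v12"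
      unfolding e by (rule T_eq_tau)
    show "hT M i (?v21) = b \<cdot> ?v21 +
        tau i (d \<circ> s i \<circ> s ?j) (?v21)"
      unfolding e by (rule T_eq_tau)
    show "hT M ?j (?v12) = a \<cdot> ?v12 +
        tau ?j (d \<circ> s ?j \<circ> s i) (?v12)"
      unfolding e by (rule T_eq_tau)
  qed (use ij v id in simp_all)
qed

lemma braid_tau_B:
  assumes k2: "2 \<le> k" and d: "wtfun d" "regular d" and v: "v \<in> hcar M"
  shows "hT M 0 (hT M 1 (hT M 0 (hT M 1 v))) - hT M 1 (hT M 0 (hT M 1 (hT M 0 v))) =
    tau 0 (d \<circ> s 1 \<circ> s 0 \<circ> s 1) (tau 1 (d \<circ> s 1 \<circ> s 0) (tau 0 (d \<circ> s 1) (tau 1 d v))) -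
    tau 1 (d \<circ> s 0 \<circ> s 1 \<circ> s 0) (tau 0 (d \<circ> s 0 \<circ> s 1) (tau 1 (d \<circ> s 0) (tau 0 d v)))"
proof -
  let ?h = "q - inverse q" and ?g = "q0 - inverse q0" and ?m = "qk - inverse qk"
  let ?vA = "tau 0 d v" and ?vB = "tau 1 d v"
  let ?vAB = "tau 0 (d \<circ> s 1) ?vB" and ?vBA = "tau 1 (d \<circ> s 0) ?vA"
  let ?vABA = "tau 0 (d \<circ> s 0 \<circ> s 1) ?vBA" and ?vBAB = "tau 1 (d \<circ> s 1 \<circ> s 0) ?vAB"
  note br = braid_refl_B
  have ij: "0 < k" "1 < k" using k2 by auto
  have pr: "pr 0 = q0" "pr 1 = q" by (auto simp: par_def)
  have s1: "s 1 \<in> signed_perms k" using sp_sr ij by blast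
  have wt: "wtfun (d \<circ> s 1)" by (rule wtfun_comp[OF d(1) s1])
  define x y where "x = d 1" "y = d 2"
  note xy = x_y_def
  have inv: "d (- 1) = inverse x" "d (- 2) = inverse y" using d(1) by (auto simp: xy wtfunD)
  have nz: "x \<noteq> 0" "y \<noteq> 0" using d(1) by (auto simp: xy wtfunD)
  have "d (lo 0) \<noteq> d (hi 0)" "d (lo 1) \<noteq> d (hi 1)" "d 1 \<noteq> d (- 2)" "d 2 \<noteq> d (- 2)"
    using d(2) k2 unfolding regular_def by auto
  then have ne: "x \<noteq> y" "x * y \<noteq> 1" "x\<^sup>2 \<noteq> 1" "y\<^sup>2 \<noteq> 1"
    using nz by (auto simp: lo_def hi_def inv xy[symmetric] field_simps power2_eq_square)
  define e1 e2 b f where "e1 = dc 0 d" "e2 = dc 0 (d \<circ> s 1)" "b = dc 1 d" "f = dc 1 (d \<circ> s 0)"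
  note abc = e1_e2_b_f_def
  have e: "f = dc 1 (d \<circ> s 1 \<circ> s 0)" "e2 = dc 0 (d \<circ> s 0 \<circ> s 1)"
    "e1 = dc 0 (d \<circ> s 1 \<circ> s 0 \<circ> s 1)" "b = dc 1 (d \<circ> s 0 \<circ> s 1 \<circ> s 0)"
    unfolding abc using braid_dc_B[OF d(1)] by (simp_all)
  have mult: "b * (y - x) = ?h * y" "f * (x * y - 1) = ?h * (x * y)"
    using ne nz unfolding abc
    by (simp_all add: dc_pos lo_def hi_def br inv xy[symmetric] divide_simps)
  have mult2: "e1 * (x\<^sup>2 - 1) = x * (?g * x + ?m)" "e2 * (y\<^sup>2 - 1) = y * (?g * y + ?m)"
  proof -
    show "e1 * (x\<^sup>2 - 1) = x * (?g * x + ?m)"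
      using dcoef_0_mult(1)[OF d(1)] d(2) ij unfolding regular_def abc xy by blast
    have "(d \<circ> s 1) (lo 0) \<noteq> (d \<circ> s 1) (hi 0)"
      using ne(4) nz
      by (auto simp: lo_def hi_def br inv xy[symmetric] field_simps power2_eq_square)
    from dcoef_0_mult(1)[OF wt this, of q q0 qk] show "e2 * (y\<^sup>2 - 1) = y * (?g * y + ?m)"
      by (simp only: abc xy comp_apply[of d "s 1" 1] br)
  qed
  have id: "b * e1 + e2 * (?h - b) + f * (?g - e1 - e2) = 0"
    by (rule rank2_identity_B[OF ne mult mult2])
  show ?thesis
  proof (rule braid_B[OF T_lin[OF ij(1)] T_lin[OF ij(2)], where ?e1.0 = e1 and ?e2.0 = e2 and b = b and f = f
        and h = ?h and ?h0.0 = ?g and ?r1.0 = "rd 0 d" and ?r2.0 = "rd 0 (d \<circ> s 1)" and rb = "rd 1 d"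
        and rf = "rd 1 (d \<circ> s 0)"])
    show "hT M 0 v = e1 \<cdot> v + ?vA" "hT M 1 v = b \<cdot> v + ?vB"
      "hT M 1 ?vA = f \<cdot> ?vA + ?vBA"
      "hT M 0 ?vB = e2 \<cdot> ?vB + ?vAB"
      by (simp_all add: abc tau_def)
    show "hT M 0 ?vA = (?g - e1) \<cdot> ?vA + rd 0 d \<cdot> v"
      "hT M 1 ?vB = (?h - b) \<cdot> ?vB + rd 1 d \<cdot> v"
      "hT M 1 ?vBA = (?h - f) \<cdot> ?vBA + rd 1 (d \<circ> s 0) \<cdot> ?vA"
      "hT M 0 ?vAB = (?g - e2) \<cdot> ?vAB + rd 0 (d \<circ> s 1) \<cdot> ?vB"
      using ij v by (simp_all add: T_tau pr abc)
    show "rd 1 d = - b\<^sup>2 + ?h * b + 1" "rd 1 (d \<circ> s 0) = - f\<^sup>2 + ?h * f + 1"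
      "rd 0 d = - e1\<^sup>2 + ?g * e1 + 1" "rd 0 (d \<circ> s 1) = - e2\<^sup>2 + ?g * e2 + 1"
      using rad_eq[OF pr_nz, of qk 1] rad_eq[OF pr_nz, of qk 0]
      by (simp_all add: pr abc)
    show "hT M 0 ?vBA = e2 \<cdot> ?vBA + ?vABA"
      unfolding e(2) by (rule T_eq_tau)
    show "hT M 1 ?vAB = f \<cdot> ?vAB + ?vBAB"
      unfolding e(1) by (rule T_eq_tau)
    show "hT M 0 ?vBAB = e1 \<cdot> ?vBAB + tau 0 (d \<circ> s 1 \<circ> s 0 \<circ> s 1) ?vBAB"
      unfolding e(3) by (rule T_eq_tau)
    show "hT M 1 ?vABA = b \<cdot> ?vABA + tau 1 (d \<circ> s 0 \<circ> s 1 \<circ> s 0) ?vABA"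
      unfolding e(4) by (rule T_eq_tau)
  qed (use ij v id in simp_all)
qed

lemma commute_tau:
  assumes ij: "i < k" "j < k" "i + 2 \<le> j" and v: "v \<in> hcar M"
    and TT: "hT M i (hT M j v) = hT M j (hT M i v)"
  shows "tau i (d \<circ> s j) (tau j d v) = tau j (d \<circ> s i) (tau i d v)"
proof -
  have e: "dc i (d \<circ> s j) = dc i d" "dc j (d \<circ> s i) = dc j d"
    using commute_refl[OF ij(3)] by (auto intro: dc_cong)
  show ?thesis
    using ij v TT unfolding tau_def e
    by (simp add: linear_endo_more[OF T_lin] linear_endoD[OF T_lin] scale_right_diff_distrib
        algebra_simps)
qed

end

locale hecke_mod = hecke_params k q q0 qk
  for k q q0 qk and M :: "('v::ab_group_add) hmod" +
  assumes hecke: "hecke_module k q q0 qk M"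

sublocale hecke_mod \<subseteq> quad_mod k q q0 qk M
proof (intro quad_mod.intro lin_space.intro quad_mod_axioms.intro hecke_params_axioms)
  note c = hecke[unfolded hecke_module_def]
  note h = c[THEN conjunct1] c[THEN conjunct2, THEN conjunct1]
    c[THEN conjunct2, THEN conjunct2, THEN conjunct1]
    c[THEN conjunct2, THEN conjunct2, THEN conjunct2, THEN conjunct2, THEN conjunct2]
  show "vector_space (hscl M)" "module.subspace (hscl M) (hcar M)" by (rule h)+
  show "linear_endo M (hT M i)" if "i < k" for i using h(3) that by blast
  show "quadratic_rel M (hT M i) (pr i)" if "i < k" for i
    using h(4) that by (cases "i = 0") (auto simp: par_def)
qed

context hecke_mod
begin

lemma W_lin: "j \<le> k \<Longrightarrow> linear_endo M (hW M j)"
  and W_bij: "j \<le> k \<Longrightarrow> bij_betw (hW M j) (hcar M) (hcar M)"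
  using hecke[unfolded hecke_module_def, THEN conjunct2, THEN conjunct2, THEN conjunct2, THEN conjunct1]
  by simp_all

lemma relations:
  assumes "v \<in> hcar M"
  shows "i < k \<Longrightarrow> hW M 0 (hT M i v) = hT M i (hW M 0 v)"
    and "k \<ge> 2 \<Longrightarrow> hT M 0 (hT M 1 (hT M 0 (hT M 1 v))) = hT M 1 (hT M 0 (hT M 1 (hT M 0 v)))"
    and "1 \<le> i \<Longrightarrow> i + 1 < k \<Longrightarrow>
      hT M i (hT M (i+1) (hT M i v)) = hT M (i+1) (hT M i (hT M (i+1) v))"
    and "i < k \<Longrightarrow> j < k \<Longrightarrow> i + 2 \<le> j \<Longrightarrow> hT M i (hT M j v) = hT M j (hT M i v)"
    and "j \<le> k \<Longrightarrow> j \<noteq> 1 \<Longrightarrow> hT M 0 (hW M j v) = hW M j (hT M 0 v)"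
    and "1 \<le> i \<Longrightarrow> i < k \<Longrightarrow> j \<le> k \<Longrightarrow> j \<noteq> i \<Longrightarrow> j \<noteq> i + 1 \<Longrightarrow> hT M i (hW M j v) = hW M j (hT M i v)"
    and "1 \<le> i \<Longrightarrow> i < k \<Longrightarrow>
      hT M i (hW M i v) = hW M (i+1) (hT M i v) + (q - inverse q) \<cdot> (- hW M (i+1) v)"
    and "1 \<le> i \<Longrightarrow> i < k \<Longrightarrow>
      hT M i (hW M (i+1) v) = hW M i (hT M i v) + (q - inverse q) \<cdot> (hW M (i+1) v)"
    and "hT M 0 (hW M 1 v) = hWinv M 1 (hT M 0 v) + (q0 - inverse q0) \<cdot> (hW M 1 v)
      + (qk - inverse qk) \<cdot> (hWinv M 1 (hW M 1 v))"
  by (-, use bspec[OF hecke[unfolded hecke_module_def, THEN conjunct2, THEN conjunct2, THEN conjunct2,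
      THEN conjunct2, THEN conjunct1] assms] in \<open>blast+\<close>)

lemma W_Winv: "j \<le> k \<Longrightarrow> v \<in> hcar M \<Longrightarrow> hW M j (hWinv M j v) = v"
  unfolding hWinv_def using W_bij[of j] by (simp add: bij_betw_inv_into_right)

lemma Winv_W: "j \<le> k \<Longrightarrow> v \<in> hcar M \<Longrightarrow> hWinv M j (hW M j v) = v"
  unfolding hWinv_def using W_bij[of j] by (simp add: bij_betw_inv_into_left)

lemma Winv_car: "j \<le> k \<Longrightarrow> v \<in> hcar M \<Longrightarrow> hWinv M j v \<in> hcar M"
  unfolding hWinv_def using W_bij[of j] by (metis bij_betw_imp_surj_on inv_into_into)

lemma Winv_eqI: "j \<le> k \<Longrightarrow> u \<in> hcar M \<Longrightarrow> hW M j u = v \<Longrightarrow> hWinv M j v = u"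
  using Winv_W by blast

lemma Winv_lin: "j \<le> k \<Longrightarrow> linear_endo M (hWinv M j)"
  unfolding linear_endo_def
  by (auto simp: Winv_car linear_endoD[OF W_lin] W_Winv intro!: Winv_eqI)

lemma Winv_eigen:
  assumes "j \<le> k" "v \<in> hcar M" "hW M j v = a \<cdot> v" "a \<noteq> 0"
  shows "hWinv M j v = inverse a \<cdot> v"
  using assms by (intro Winv_eqI) (auto simp: linear_endoD[OF W_lin])

lemma eigenvalue_nz:
  assumes "j \<le> k" "v \<in> hcar M" "v \<noteq> 0" "hW M j v = a \<cdot> v"
  shows "a \<noteq> 0"
proof
  assume "a = 0"
  then have "hW M j v = hW M j 0" using assms(4) linear_endo_more(1)[OF W_lin[OF assms(1)]] by simp
  then show False using assms W_bij[of j] car_simps(1) unfolding bij_betw_def inj_on_def by blast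
qed

definition wv :: "complex \<Rightarrow> (int \<Rightarrow> complex) \<Rightarrow> 'v \<Rightarrow> bool" where
  "wv z d v \<longleftrightarrow> v \<in> hcar M \<and> hW M 0 v = z \<cdot> v \<and> (\<forall>j\<in>{1..k}. hW M j v = d (int j) \<cdot> v)"

lemma wv_0 [simp]: "wv z d 0"
  using linear_endo_more(1)[OF W_lin] by (simp add: wv_def)

lemma wvD:
  "wv z d v \<Longrightarrow> v \<in> hcar M" "wv z d v \<Longrightarrow> hW M 0 v = z \<cdot> v"
  "wv z d v \<Longrightarrow> 1 \<le> j \<Longrightarrow> j \<le> k \<Longrightarrow> hW M j v = d (int j) \<cdot> v"
  by (auto simp: wv_def)

text \<open>The calculations of the intertwining property, and of the Jordan block that appears
  when it breaks down, both start from the cross relations applied to a weight vector.\<close>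
lemma W_T_weight:
  assumes v: "wv z d v" and d: "wtfun d"
  shows "1 \<le> i \<Longrightarrow> i < k \<Longrightarrow>
      hW M (i+1) (hT M i v) = d (int i) \<cdot> hT M i v + ((q - inverse q) * d (int i + 1)) \<cdot> v"
    and "1 \<le> i \<Longrightarrow> i < k \<Longrightarrow>
      hW M i (hT M i v) = d (int i + 1) \<cdot> hT M i v - ((q - inverse q) * d (int i + 1)) \<cdot> v"
    and "hWinv M 1 (hT M 0 v)
      = d 1 \<cdot> hT M 0 v - ((q0 - inverse q0) * d 1 + (qk - inverse qk)) \<cdot> v"
proof -
  note car = wvD(1)[OF v]
  { assume i: "1 \<le> i" "i < k"
    have w: "hW M i v = d (int i) \<cdot> v" "hW M (i+1) v = d (int i + 1) \<cdot> v"
      using wvD(3)[OF v, of i] wvD(3)[OF v, of "i + 1"] i by (auto simp: add.commute)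
    show "hW M (i+1) (hT M i v) = d (int i) \<cdot> hT M i v + ((q - inverse q) * d (int i + 1)) \<cdot> v"
      using relations(7)[OF car i] i car unfolding w
      by (simp add: linear_endoD[OF T_lin])
    show "hW M i (hT M i v) = d (int i + 1) \<cdot> hT M i v - ((q - inverse q) * d (int i + 1)) \<cdot> v"
      using relations(8)[OF car i] i car unfolding w
      by (simp add: linear_endoD[OF T_lin]) }
  have w: "hW M 1 v = d 1 \<cdot> v" using wvD(3)[OF v, of 1] k_pos by simp
  have iw: "hWinv M 1 (d 1 \<cdot> v) = v" using Winv_W[OF k_pos car] w by simp
  show "hWinv M 1 (hT M 0 v)
      = d 1 \<cdot> hT M 0 v - ((q0 - inverse q0) * d 1 + (qk - inverse qk)) \<cdot> v"
    using relations(9)[OF car] k_pos car unfolding w iw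
    by (simp add: linear_endoD[OF T_lin] scale_left_distrib algebra_simps)
qed

text \<open>The coefficient \<open>[T\<^sub>i]\<close> is chosen so that the inhomogeneous terms of the cross relations cancel.\<close>
lemma tau_wv:
  assumes v: "wv z d v" and d: "wtfun d" and i: "i < k" and ne: "d (lo i) \<noteq> d (hi i)"
  shows "wv z (d \<circ> s i) (tau i d v)"
proof -
  let ?u = "tau i d v"
  note car = wvD(1)[OF v]
  have u: "?u \<in> hcar M" using i car by simp
  have other: "hW M j ?u = a \<cdot> ?u"
    if "hW M j v = a \<cdot> v" "hT M i (hW M j v) = hW M j (hT M i v)" "j \<le> k" for j a
    using that i car unfolding tau_def
    by (simp add: linear_endoD[OF T_lin] linear_endoD[OF W_lin] linear_endo_more[OF W_lin]
        scale_right_diff_distrib mult.commute)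
  have W0: "hW M 0 ?u = z \<cdot> ?u"
    using other[of 0 z] wvD(2)[OF v] relations(1)[OF car i] by simp
  have "hW M j ?u = d (s i (int j)) \<cdot> ?u" if j: "1 \<le> j" "j \<le> k" for j
  proof (cases "i = 0")
    case True
    show ?thesis
    proof (cases "j = 1")
      case True
      let ?c = "(q0 - inverse q0) * d 1 + (qk - inverse qk)"
      note W = W_T_weight(3)[OF v d]
      have nz: "d 1 \<noteq> 0" using d by (simp add: wtfunD)
      have w: "hW M 1 v = d 1 \<cdot> v" using wvD(3)[OF v, of 1] k_pos by simp
      have "hWinv M 1 ?u = hWinv M 1 (hT M 0 v) - dc 0 d \<cdot> (inverse (d 1) \<cdot> v)"
        using \<open>i = 0\<close> i car k_pos Winv_eigen[OF k_pos car w nz] unfolding tau_def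
        by (simp add: linear_endo_more[OF Winv_lin] linear_endoD[OF Winv_lin])
      also have "\<dots> = d 1 \<cdot> hT M 0 v - (?c + dc 0 d * inverse (d 1)) \<cdot> v"
        unfolding W by (simp add: scale_left_distrib)
      also have "?c + dc 0 d * inverse (d 1) = d 1 * dc 0 d"
      proof -
        have "dc 0 d * ((d 1)\<^sup>2 - 1) = d 1 * ?c"
          using dcoef_0_mult(1)[OF d] ne \<open>i = 0\<close> by simp
        then have "d 1 * (?c + dc 0 d * inverse (d 1)) = d 1 * (d 1 * dc 0 d)"
          using nz by (simp add: distrib_left) (simp add: algebra_simps power2_eq_square)
        then show ?thesis using nz by simp
      qed
      finally have "hWinv M 1 ?u = d 1 \<cdot> ?u"
        using \<open>i = 0\<close> by (simp add: tau_def scale_right_diff_distrib)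
      then have "?u = hW M 1 (d 1 \<cdot> ?u)" using W_Winv[OF k_pos u] by simp
      also have "\<dots> = d 1 \<cdot> hW M 1 ?u" using u k_pos by (simp add: linear_endoD[OF W_lin])
      finally have "inverse (d 1) \<cdot> ?u = inverse (d 1) \<cdot> d 1 \<cdot> hW M 1 ?u" by simp
      then have "hW M 1 ?u = inverse (d 1) \<cdot> ?u" using nz by simp
      then show ?thesis
        using True \<open>i = 0\<close> d by (simp add: braid_refl_B wtfunD)
    next
      case False
      then have "s i (int j) = int j" using \<open>i = 0\<close> j by (simp add: s_eval)
      then show ?thesis
        using other[of j] wvD(3)[OF v j] relations(5)[OF car, of j] j False \<open>i = 0\<close> by simp
    qed
  next
    case False
    then have i1: "1 \<le> i" by simp
    note W = W_T_weight(1,2)[OF v d i1 i]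
    have w: "hW M i v = d (int i) \<cdot> v" "hW M (i+1) v = d (int i + 1) \<cdot> v"
      using wvD(3)[OF v, of i] wvD(3)[OF v, of "i + 1"] i i1 by (auto simp: add.commute)
    have m: "dc i d * (d (int i + 1) - d (int i)) = (q - inverse q) * d (int i + 1)"
      using dcoef_pos_mult(1)[OF d False ne] .
    consider "j = i" | "j = i + 1" | "j \<noteq> i" "j \<noteq> i + 1" by blast
    then show ?thesis
    proof cases
      case 1
      have "hW M i ?u = d (int i + 1) \<cdot> hT M i v - ((q - inverse q) * d (int i + 1) + dc i d * d (int i)) \<cdot> v"
        using i i1 car unfolding tau_def
        by (simp add: linear_endo_more[OF W_lin] linear_endoD[OF W_lin] W w scale_left_distrib)
      also have "(q - inverse q) * d (int i + 1) + dc i d * d (int i) = d (int i + 1) * dc i d"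
        using m by (simp add: algebra_simps)
      finally show ?thesis using 1 i1 by (simp add: tau_def scale_right_diff_distrib s_eval)
    next
      case 2
      have "hW M (i+1) ?u = d (int i) \<cdot> hT M i v + ((q - inverse q) * d (int i + 1) - dc i d * d (int i + 1)) \<cdot> v"
        using i i1 car unfolding tau_def
        by (simp add: linear_endo_more[OF W_lin] linear_endoD[OF W_lin] W w scale_left_diff_distrib
           )
      also have "(q - inverse q) * d (int i + 1) - dc i d * d (int i + 1) = - (d (int i) * dc i d)"
        using m by (simp add: algebra_simps)
      finally show ?thesis using 2 i1
        by (simp add: tau_def scale_right_diff_distrib s_eval add.commute)
    next
      case 3
      then have "s i (int j) = int j" using i1 j by (simp add: s_eval)
      then show ?thesis
        using other[of j] wvD(3)[OF v j] relations(6)[OF car i1 i j(2) 3] j by simp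
    qed
  qed
  then show ?thesis using u W0 by (simp add: wv_def)
qed

end

section \<open>Weights of calibrated modules\<close>

locale calib = hecke_mod k q q0 qk M
  for k q q0 qk and M :: "('v::ab_group_add) hmod" +
  assumes calibrated: "calibrated k M"
begin

text \<open>A diagonalizable operator has no Jordan block: in an eigenbasis, \<open>y\<close> has coefficients
  \<open>c\<^sub>b (l\<^sub>b - a)\<close> while \<open>(W\<^sub>j - a) y = 0\<close> says that \<open>c\<^sub>b (l\<^sub>b - a)\<^sup>2 = 0\<close>.\<close>
lemma semisimple:
  assumes x: "x \<in> hcar M" and j: "j \<le> k"
    and y: "hW M j x = a \<cdot> x + y" "hW M j y = a \<cdot> y" "y \<in> hcar M"
  shows "y = 0"
proof -
  obtain B where B: "B \<subseteq> hcar M" "independent B" "span B = hcar M"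
    and eig: "\<forall>b\<in>B. \<forall>j\<le>k. \<exists>a. hW M j b = a \<cdot> b"
    using calibrated unfolding calibrated_def by blast
  have "\<forall>b\<in>B. \<exists>a. hW M j b = a \<cdot> b" using eig j by blast
  then obtain l where l: "\<And>b. b \<in> B \<Longrightarrow> hW M j b = l b \<cdot> b" by metis
  obtain t c where t: "finite t" "t \<subseteq> B" "x = (\<Sum>b\<in>t. c b \<cdot> b)"
    using x B(3) unfolding span_explicit by blast
  have Wsum: "hW M j (\<Sum>b\<in>t. f b \<cdot> b) = (\<Sum>b\<in>t. (f b * l b) \<cdot> b)" for f
  proof -
    have "f b \<cdot> b \<in> hcar M" if "b \<in> t" for b using that t B by (intro car_simps) auto
    then have "hW M j (\<Sum>b\<in>t. f b \<cdot> b) = (\<Sum>b\<in>t. hW M j (f b \<cdot> b))"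
      using linear_endo_sum[OF W_lin[OF j], of t "\<lambda>b. f b \<cdot> b"] by blast
    also have "\<dots> = (\<Sum>b\<in>t. (f b * l b) \<cdot> b)"
      using t B l by (intro sum.cong) (auto simp: linear_endoD[OF W_lin[OF j]] subset_iff)
    finally show ?thesis .
  qed
  have ysum: "y = (\<Sum>b\<in>t. (c b * (l b - a)) \<cdot> b)"
  proof -
    have "y = hW M j x - a \<cdot> x" using y(1) by simp
    also have "\<dots> = (\<Sum>b\<in>t. (c b * l b) \<cdot> b) - (\<Sum>b\<in>t. (a * c b) \<cdot> b)"
      unfolding t(3) Wsum by (simp add: scale_sum_right)
    also have "\<dots> = (\<Sum>b\<in>t. (c b * (l b - a)) \<cdot> b)"
      unfolding sum_subtractf[symmetric]
      by (intro sum.cong refl) (simp add: scale_left_diff_distrib right_diff_distrib mult.commute)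
    finally show ?thesis .
  qed
  have "(\<Sum>b\<in>t. (c b * (l b - a) * (l b - a)) \<cdot> b) = hW M j y - a \<cdot> y"
    unfolding ysum Wsum scale_sum_right sum_subtractf[symmetric]
    by (intro sum.cong refl, simp only: scale_scale scale_left_diff_distrib[symmetric])
       (rule arg_cong2[where f = "hscl M"], simp_all add: algebra_simps)
  also have "\<dots> = 0" using y(2) by simp
  finally have "c b * (l b - a) * (l b - a) = 0" if "b \<in> t" for b
    using independentD[OF B(2) t(1,2) _ that, of "\<lambda>b. c b * (l b - a) * (l b - a)"] by blast
  then have "c b * (l b - a) = 0" if "b \<in> t" for b using that by force
  then show "y = 0" unfolding ysum by (intro sum.neutral) simp
qed

text \<open>If \<open>\<gamma>\<close> lies on the wall of \<open>s\<^sub>i\<close> then \<open>T\<^sub>i v\<close> lies in a Jordan block of size two.\<close>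
lemma weight_off_wall:
  assumes v: "wv z d v" "v \<noteq> 0" and d: "wtfun d" and i: "i < k"
  shows "d (lo i) \<noteq> d (hi i)"
proof
  assume eq: "d (lo i) = d (hi i)"
  note car = wvD(1)[OF v(1)]
  show False
  proof (cases "i = 0")
    case True
    let ?c = "(q0 - inverse q0) * d 1 + (qk - inverse qk)"
    have sq: "(d 1)\<^sup>2 = 1" using wt_ne_iff[OF d, of 0] eq True by auto
    have T: "hT M 0 v \<in> hcar M" using True i car by simp
    have w: "hW M 1 v = d 1 \<cdot> v" using wvD(3)[OF v(1), of 1] k_pos by simp
    have "hT M 0 v = hW M 1 (hWinv M 1 (hT M 0 v))" using W_Winv[OF k_pos T] by simp
    also have "\<dots> = d 1 \<cdot> hW M 1 (hT M 0 v) - (?c * d 1) \<cdot> v"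
      unfolding W_T_weight(3)[OF v(1) d] using T car k_pos
      by (simp add: linear_endo_more[OF W_lin] linear_endoD[OF W_lin] w)
    finally have "d 1 \<cdot> hT M 0 v = d 1 \<cdot> (d 1 \<cdot> hW M 1 (hT M 0 v) - (?c * d 1) \<cdot> v)" by simp
    then have "hW M 1 (hT M 0 v) = d 1 \<cdot> hT M 0 v + ?c \<cdot> v"
      using sq by (simp add: scale_right_diff_distrib power2_eq_square mult.left_commute)
    moreover have "hW M 1 (?c \<cdot> v) = d 1 \<cdot> ?c \<cdot> v"
      using car k_pos w by (simp add: linear_endoD[OF W_lin] mult.commute)
    ultimately have "?c \<cdot> v = 0" using car by (intro semisimple[OF T k_pos, where a = "d 1"]) simp_all
    then show False using wall_coeff_nz(1)[OF sq] v(2) by simp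
  next
    case False
    then have i1: "1 \<le> i" by simp
    let ?x = "d (int i)"
    have eq': "d (int i + 1) = ?x" using eq False by (simp add: lo_def hi_def)
    have T: "hT M i v \<in> hcar M" using i car by simp
    have w: "hW M (i+1) v = ?x \<cdot> v"
      using wvD(3)[OF v(1), of "i + 1"] i eq' by (simp add: add.commute)
    have "hW M (i+1) (hT M i v) = ?x \<cdot> hT M i v + ((q - inverse q) * ?x) \<cdot> v"
      using W_T_weight(1)[OF v(1) d i1 i] eq' by simp
    moreover have "hW M (i+1) (((q - inverse q) * ?x) \<cdot> v) = ?x \<cdot> ((q - inverse q) * ?x) \<cdot> v"
      using car i w by (simp add: linear_endoD[OF W_lin] mult.commute)
    ultimately have "((q - inverse q) * ?x) \<cdot> v = 0"
      using car i by (intro semisimple[OF T, where a = ?x and j = "i + 1"]) simp_all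
    then show False using q2(3) wtfunD(2)[OF d] v(2) by simp
  qed
qed

text \<open>If \<open>\<tau>\<^sub>i v = 0\<close> then \<open>v\<close> is an eigenvector of \<open>T\<^sub>i\<close>, and its eigenvalue \<open>[T\<^sub>i]\<close> must be one of the
  two roots of the quadratic relation.\<close>
lemma tau_eq_0D:
  assumes v: "wv z d v" "v \<noteq> 0" and d: "wtfun d" and i: "i < k" and t: "tau i d v = 0"
  shows "hT M i v = dc i d \<cdot> v" "rd i d = 0" "adjc d (lo i) (hi i)"
proof -
  note ne = weight_off_wall[OF v d i]
  show "hT M i v = dc i d \<cdot> v" using t by (simp add: tau_def)
  have "rd i d \<cdot> v = 0" using tau_tau[OF i wvD(1)[OF v(1)] d ne] t i by simp
  then show "rd i d = 0" using v(2) by simp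
  then show "adjc d (lo i) (hi i)" using rad_eq_0_iff[OF d ne nonzero] by simp
qed

text \<open>At a zero of \<open>rad\<close> the two coefficients are the two different roots \<open>p\<close>, \<open>- p\<^sup>-\<^sup>1\<close> of the
  quadratic relation.\<close>
lemma opposite_coefs:
  assumes d: "wtfun d" "d (lo i) \<noteq> d (hi i)" and 0: "rd i d = 0" and p: "(pr i)\<^sup>2 \<noteq> - 1"
  shows "dc i d * dc i (d \<circ> s i) = - 1" "dc i (d \<circ> s i) \<noteq> dc i d"
proof -
  show 1: "dc i d * dc i (d \<circ> s i) = - 1"
    using 0 rad_eq[OF pr_nz, of qk i d] dcoef_sum[OF d, of q q0 qk] by algebra
  have "inverse ((pr i)\<^sup>2) \<noteq> - 1" using p by (metis inverse_inverse_eq inverse_minus_eq inverse_1)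
  moreover have "dc i d = pr i \<or> dc i d = - inverse (pr i)"
    using 0 by (auto simp: rad_def add_eq_0_iff2)
  ultimately have "(dc i d)\<^sup>2 \<noteq> - 1" using p by (auto simp: power_inverse)
  then show "dc i (d \<circ> s i) \<noteq> dc i d" using 1 by (auto simp: power2_eq_square)
qed

text \<open>If \<open>\<gamma>\<^sub>i = \<gamma>\<^sub>i\<^sub>+\<^sub>2\<close>, the intertwining operators of \<open>s\<^sub>i\<close> and \<open>s\<^sub>i\<^sub>+\<^sub>1\<close> lead to weights on a wall, so
  both kill \<open>v\<close>.  Then \<open>T\<^sub>i\<close> and \<open>T\<^sub>i\<^sub>+\<^sub>1\<close> act on \<open>v\<close> by scalars, which the braid relation forces to be
  equal, whereas they are the two different roots of the quadratic relation.\<close>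
lemma weight_A2:
  assumes v: "wv z d v" "v \<noteq> 0" and d: "wtfun d" and i: "1 \<le> i" "i + 2 \<le> k"
  shows "d (int i) \<noteq> d (int i + 2)"
proof
  assume eq: "d (int i) = d (int i + 2)"
  let ?j = "i + 1"
  have ij: "i < k" "?j < k" using i by auto
  note br = braid_refl_A[OF i(1)]
  have lohi: "lo i = int i" "hi i = int i + 1" "lo ?j = int i + 1" "hi ?j = int i + 2"
    using i by (auto simp: lo_def hi_def)
  note car = wvD(1)[OF v(1)]
  have wt: "wtfun (d \<circ> s i)" "wtfun (d \<circ> s ?j)" using wtfun_comp[OF d] sp_sr ij by blast+
  have 1: "tau i d v = 0"
    using weight_off_wall[OF tau_wv[OF v(1) d ij(1) weight_off_wall[OF v d ij(1)]] _ wt(1) ij(2)] eq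
    by (auto simp: lohi br)
  have 2: "tau ?j d v = 0"
    using weight_off_wall[OF tau_wv[OF v(1) d ij(2) weight_off_wall[OF v d ij(2)]] _ wt(2) ij(1)] eq
    by (auto simp: lohi br)
  define a b where ab: "a = dc i d" "b = dc ?j d"
  have T: "hT M i v = a \<cdot> v" "hT M ?j v = b \<cdot> v"
    using tau_eq_0D(1)[OF v d] 1 2 ij by (auto simp: ab)
  have pr: "pr i = q" "pr ?j = q" using i by (auto simp: par_def)
  have sq: "a\<^sup>2 = (q - inverse q) * a + 1" "b\<^sup>2 = (q - inverse q) * b + 1"
    using tau_eq_0D(2)[OF v d ij(1) 1] tau_eq_0D(2)[OF v d ij(2) 2]
      rad_eq[OF pr_nz, of qk i d] rad_eq[OF pr_nz, of qk ?j d] unfolding pr ab by algebra+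
  have "b = dc i (d \<circ> s i)" using i eq unfolding ab by (simp add: dc_pos lohi br)
  then have sum: "a + b = q - inverse q"
    using dcoef_sum[OF d weight_off_wall[OF v d ij(1)], of q q0 qk] by (simp add: ab pr)
  have "hT M i (hT M ?j (hT M i v)) = (a * b * a) \<cdot> v"
    "hT M ?j (hT M i (hT M ?j v)) = (b * a * b) \<cdot> v"
    using T car ij by (simp_all add: linear_endoD[OF T_lin] mult.commute mult.left_commute)
  then have "(a * b * a) \<cdot> v = (b * a * b) \<cdot> v"
    using relations(3)[OF car i(1)] ij by auto
  then have "a * b * a = b * a * b" using v(2) by simp
  moreover have "a \<noteq> 0" "b \<noteq> 0" using sq by auto
  ultimately have "a = b" by simp
  then have h: "q - inverse q = 2 * a" using sum by simp
  have "a\<^sup>2 = - 1" using sq(1) unfolding h by algebra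
  then have "(q - inverse q)\<^sup>2 = - 4" unfolding h by (simp add: power_mult_distrib)
  moreover have "q * inverse q = 1" using nonzero(1) by simp
  ultimately have "(q\<^sup>2 + 1)\<^sup>2 = 0" by algebra
  then show False using q2(2) by (simp add: eq_neg_iff_add_eq_0)
qed

text \<open>Both conditions are proved as in type \<open>A\<^sub>2\<close>.  One of \<open>\<tau>\<^sub>0\<close>, \<open>\<tau>\<^sub>1\<close> kills \<open>v\<close>, since it leads to a wall;
  so \<open>\<gamma>\<close> satisfies one of the equations that define \<open>P\<close>.  If the other operator kills \<open>v\<close> as
  well, a second such equation holds, and the two together contradict the assumptions on the
  parameters.  If it does not, \<open>v\<close> and its image \<open>u\<close> form the situation of
  \<open>braid_rank2_obstruction\<close>, and the resulting equation is again excluded.\<close>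
lemma weight_B2:
  assumes v: "wv z d v" "v \<noteq> 0" and d: "wtfun d" and k2: "2 \<le> k"
  shows "d 1 \<noteq> d (- 2)" "d 2 \<noteq> d (- 2)"
proof -
  note br = braid_refl_B
  have ij: "0 < k" "1 < k" using k2 by auto
  have lohi: "lo 0 = - 1" "hi 0 = 1" "lo 1 = 1" "hi 1 = 2" by (auto simp: lo_def hi_def)
  note car = wvD(1)[OF v(1)]
  have wt: "wtfun (d \<circ> s 0)" "wtfun (d \<circ> s 1)" using wtfun_comp[OF d] sp_sr ij by blast+
  note off = weight_off_wall[OF v d]
  note tw = tau_wv[OF v(1) d]
  define x y where "x = d 1" "y = d 2"
  note xy = x_y_def
  have inv: "d (- 1) = inverse x" "d (- 2) = inverse y" using d by (auto simp: xy wtfunD)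
  have nz: "x \<noteq> 0" "y \<noteq> 0" using d by (auto simp: xy wtfunD)
  have pr: "pr 0 = q0" "pr 1 = q" by (auto simp: par_def)
  note braid = relations(2)[OF car k2]
  show "d 1 \<noteq> d (- 2)"
  proof
    assume eq: "d 1 = d (- 2)"
    then have yx: "x * y = 1" "y = inverse x" using nz by (auto simp: xy[symmetric] inv)
    \<comment> \<open>\<open>s\<^sub>0\<close> leads to the weight \<open>(y, y)\<close>, which lies on the wall of \<open>s\<^sub>1\<close>.\<close>
    have 0: "tau 0 d v = 0"
      using weight_off_wall[OF tw[OF ij(1) off[OF ij(1)]] _ wt(1) ij(2)] eq
      by (auto simp: lohi br inv xy[symmetric])
    note D = tau_eq_0D[OF v d ij(1) 0]
    have spx: "special q0 qk x" using D(3) by (simp add: adj_def lohi xy)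
    have e: "dc 0 d = q0 \<or> dc 0 d + inverse q0 = 0" using D(2) by (auto simp: rad_def par_def)
    let ?u = "tau 1 d v"
    show False
    proof (cases "?u = 0")
      case True
      have "adjc d 1 2" using tau_eq_0D(3)[OF v d ij(2) True] by (simp add: lohi)
      then have "y = q\<^sup>2 * x \<or> x = q\<^sup>2 * y" by (simp add: adj_def xy)
      then have "q\<^sup>2 * x\<^sup>2 = 1 \<or> x\<^sup>2 = q\<^sup>2" using yx nz by (auto simp: power2_eq_square field_simps)
      then show False using special_sq[OF spx] by (auto simp: mult.commute)
    next
      case False
      have u: "wv z (d \<circ> s 1) ?u" by (rule tw[OF ij(2) off[OF ij(2)]])
      have wt': "wtfun (d \<circ> s 1 \<circ> s 0)" using wtfun_comp[OF wt(2)] sp_sr ij by blast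
      have 1: "tau 0 (d \<circ> s 1) ?u = 0"
        using weight_off_wall[OF tau_wv[OF u wt(2) ij(1) weight_off_wall[OF u False wt(2) ij(1)]] _ wt' ij(2)] eq
        by (auto simp: comp_def lohi br inv xy[symmetric] yx(2))
      have e2: "dc 0 (d \<circ> s 1) = dc 0 (d \<circ> s 0)"
        using yx(2) by (intro dc_cong) (auto simp: lohi br inv xy[symmetric])
      have T: "hT M 0 v = dc 0 d \<cdot> v" "hT M 0 ?u = dc 0 (d \<circ> s 0) \<cdot> ?u"
        using D(1) tau_eq_0D(1)[OF u False wt(2) ij(1) 1] by (simp_all add: e2)
      have "((dc 0 (d \<circ> s 0) - dc 0 d) * (dc 0 d * dc 1 d + dc 0 (d \<circ> s 0) * dc 1 (d \<circ> s 1))) \<cdot> ?u = 0"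
      proof (rule braid_rank2_obstruction[OF T_lin[OF ij(1)] T_lin[OF ij(2)] car _ T _ _ braid])
        show "hT M 1 v = dc 1 d \<cdot> v + ?u" by (rule T_eq_tau)
        show "hT M 1 ?u = dc 1 (d \<circ> s 1) \<cdot> ?u + rd 1 d \<cdot> v"
          using tau_tau[OF ij(2) car d off[OF ij(2)]] T_eq_tau[of 1 ?u "d \<circ> s 1"] by simp
      qed (use ij car in simp)
      then have z: "dc 0 (d \<circ> s 0) = dc 0 d \<or> dc 0 d * dc 1 d + dc 0 (d \<circ> s 0) * dc 1 (d \<circ> s 1) = 0"
        using False by auto
      note opp = opposite_coefs[OF d off[OF ij(1)] D(2), unfolded pr, OF q0_sq]
      note ee = opp(1) and ne = opp(2)
      have m: "dc 1 d * (y - x) = (q - inverse q) * y" "dc 1 (d \<circ> s 1) * (x - y) = (q - inverse q) * x"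
        using dcoef_pos_mult[OF d _ off[OF ij(2)], of q q0 qk] by (simp_all add: xy)
      have "dc 0 d * y = dc 0 (d \<circ> s 0) * x"
      proof -
        have "(q - inverse q) * (dc 0 d * y - dc 0 (d \<circ> s 0) * x)
            = (y - x) * (dc 0 d * dc 1 d + dc 0 (d \<circ> s 0) * dc 1 (d \<circ> s 1))"
          using m by algebra
        also have "\<dots> = 0" using z ne by simp
        finally show ?thesis using q2(3) by simp
      qed
      then have sq: "(dc 0 d)\<^sup>2 = - x\<^sup>2" using ee yx by algebra
      consider "dc 0 d = q0" "x = q0 * qk" | "dc 0 d = q0" "x = - (q0 * inverse qk)"
        | "dc 0 d + inverse q0 = 0" "x = - (qk * inverse q0)"
        | "dc 0 d + inverse q0 = 0" "x = inverse (q0 * qk)"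
        using e dcoef_0_eq_iff[OF d off[OF ij(1)] nonzero(2,3), of q] unfolding xy by blast
      then have "qk\<^sup>2 = - 1"
      proof cases
        case 1
        with sq have "q0\<^sup>2 * (qk\<^sup>2 + 1) = 0" by algebra
        then show ?thesis using nonzero by (simp add: eq_neg_iff_add_eq_0)
      next
        case 2
        with sq have "q0\<^sup>2 = - (q0\<^sup>2 * inverse qk ^ 2)" by algebra
        then have "q0\<^sup>2 * (qk\<^sup>2 + 1) = 0" using nonzero by (simp add: field_simps)
        then show ?thesis using nonzero by (simp add: eq_neg_iff_add_eq_0)
      next
        case 3
        with sq have "inverse q0 ^ 2 * (qk\<^sup>2 + 1) = 0" by algebra
        then show ?thesis using nonzero by (simp add: eq_neg_iff_add_eq_0)
      next
        case 4
        with sq have "inverse q0 ^ 2 = - (inverse (q0 * qk) ^ 2)" by algebra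
        then have "inverse q0 ^ 2 * (qk\<^sup>2 + 1) = 0" using nonzero by (simp add: field_simps)
        then show ?thesis using nonzero by (simp add: eq_neg_iff_add_eq_0)
      qed
      then show False using qk_sq by simp
    qed
  qed
  show "d 2 \<noteq> d (- 2)"
  proof
    assume eq: "d 2 = d (- 2)"
    then have yy: "y = inverse y" by (simp add: xy[symmetric] inv)
    then have "y * y = 1" using nz by (metis right_inverse)
    with yy have sq: "y\<^sup>2 = 1" "inverse y = y" by (simp_all add: power2_eq_square)
    \<comment> \<open>\<open>s\<^sub>1\<close> leads to the weight \<open>(y, x)\<close> with \<open>y = \<plusminus>1\<close>, which lies on the wall of \<open>s\<^sub>0\<close>.\<close>
    have 0: "tau 1 d v = 0"
      using weight_off_wall[OF tw[OF ij(2) off[OF ij(2)]] _ wt(2) ij(1)] eq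
      by (auto simp: lohi br)
    note D = tau_eq_0D[OF v d ij(2) 0]
    have adj: "y = q\<^sup>2 * x \<or> x = q\<^sup>2 * y" using D(3) by (simp add: adj_def lohi xy)
    let ?u = "tau 0 d v"
    have nu: "?u \<noteq> 0"
    proof
      assume "?u = 0"
      from tau_eq_0D(3)[OF v d ij(1) this] have "special q0 qk x" by (simp add: adj_def lohi xy)
      then show False using special_sq_q2[OF _ sq(1)] adj by blast
    qed
    have u: "wv z (d \<circ> s 0) ?u" by (rule tw[OF ij(1) off[OF ij(1)]])
    have wt': "wtfun (d \<circ> s 0 \<circ> s 1)" using wtfun_comp[OF wt(1)] sp_sr ij by blast
    have 1: "tau 1 (d \<circ> s 0) ?u = 0"
      using weight_off_wall[OF tau_wv[OF u wt(1) ij(2) weight_off_wall[OF u nu wt(1) ij(2)]] _ wt' ij(1)] eq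
      by (auto simp: comp_def lohi br)
    have a2: "dc 1 (d \<circ> s 0) = dc 1 (d \<circ> s 1)"
    proof -
      have "inverse x * inverse y = y * inverse x" using sq by simp
      then show ?thesis by (simp add: dc_pos lohi br inv xy[symmetric])
    qed
    have T: "hT M 1 v = dc 1 d \<cdot> v" "hT M 1 ?u = dc 1 (d \<circ> s 1) \<cdot> ?u"
      using D(1) tau_eq_0D(1)[OF u nu wt(1) ij(2) 1] by (simp_all add: a2)
    have "((dc 1 (d \<circ> s 1) - dc 1 d) * (dc 1 d * dc 0 d + dc 1 (d \<circ> s 1) * dc 0 (d \<circ> s 0))) \<cdot> ?u = 0"
    proof (rule braid_rank2_obstruction[OF T_lin[OF ij(2)] T_lin[OF ij(1)] car _ T _ _ braid[symmetric]])
      show "hT M 0 v = dc 0 d \<cdot> v + ?u" by (rule T_eq_tau)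
      show "hT M 0 ?u = dc 0 (d \<circ> s 0) \<cdot> ?u + rd 0 d \<cdot> v"
        using tau_tau[OF ij(1) car d off[OF ij(1)]] T_eq_tau[of 0 ?u "d \<circ> s 0"] by simp
    qed (use ij car in simp)
    then have z: "dc 1 (d \<circ> s 1) = dc 1 d \<or> dc 1 d * dc 0 d + dc 1 (d \<circ> s 1) * dc 0 (d \<circ> s 0) = 0"
      using nu by auto
    have "rd 1 d = 0" using D(2) .
    then have e: "dc 1 d = q \<or> dc 1 d + inverse q = 0" by (auto simp: rad_def par_def)
    note opp = opposite_coefs[OF d off[OF ij(2)] D(2), unfolded pr, OF q2(2)]
    note ee = opp(1) and ne = opp(2)
    let ?A = "q0 - inverse q0" and ?B = "qk - inverse qk"
    have m: "dc 0 d * (x\<^sup>2 - 1) = x * (?A * x + ?B)" "dc 0 (d \<circ> s 0) * (1 - x\<^sup>2) = ?A + ?B * x"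
      using dcoef_0_mult[OF d off[OF ij(1)], of q q0 qk] by (simp_all add: xy)
    have ax: "(dc 1 d)\<^sup>2 * x = y"
    proof -
      from e consider "dc 1 d = q" | "dc 1 d + inverse q = 0" by blast
      then show ?thesis
      proof cases
        case 1
        then show ?thesis using dcoef_pos_eq_iff(1)[OF d off[OF ij(2)], of q q0 qk] nonzero by (simp add: xy)
      next
        case 2
        then have "x = q\<^sup>2 * y"
          using dcoef_pos_eq_iff(2)[OF d off[OF ij(2)], of q q0 qk] nonzero by (simp add: xy)
        moreover from 2 have "dc 1 d = - inverse q" by (simp add: add_eq_0_iff2)
        ultimately show ?thesis using nonzero by (simp add: power_inverse)
      qed
    qed
    have "dc 1 d * dc 0 d + dc 1 (d \<circ> s 1) * dc 0 (d \<circ> s 0) = 0" using z ne by blast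
    then have E: "(dc 1 d)\<^sup>2 * dc 0 d = dc 0 (d \<circ> s 0)" using ee by algebra
    have "(dc 1 d)\<^sup>2 * (x * (?A * x + ?B)) + (?A + ?B * x) = 0"
      unfolding m[symmetric] E[symmetric] by (simp add: algebra_simps)
    then have "((dc 1 d)\<^sup>2 * x) * (?A * x + ?B) + (?A + ?B * x) = 0" by (simp only: mult.assoc)
    then have "(x * y + 1) * (?A + ?B * y) = 0" using sq(1) unfolding ax by algebra
    moreover have "?A + ?B * y \<noteq> 0" using wall_coeff_nz(2)[OF sq(1)] .
    ultimately have "x * y = - 1" by (simp add: eq_neg_iff_add_eq_0)
    from adj have "q\<^sup>2 = - 1"
    proof
      assume "y = q\<^sup>2 * x"
      then have "1 = q\<^sup>2 * (x * y)" using sq(1) by (simp add: power2_eq_square mult.assoc)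
      with \<open>x * y = - 1\<close> show "q\<^sup>2 = - 1" by (simp add: minus_equation_iff)
    next
      assume "x = q\<^sup>2 * y"
      with \<open>x * y = - 1\<close> sq(1) show "q\<^sup>2 = - 1" by (simp add: power2_eq_square mult.assoc)
    qed
    then show False using q2(2) by simp
  qed
qed

theorem weight_regular:
  assumes "wv z d v" "v \<noteq> 0" "wtfun d"
  shows "regular d"
  using weight_off_wall[OF assms] weight_A2[OF assms] weight_B2[OF assms]
  unfolding regular_def by blast

end

section \<open>The structure of irreducible calibrated modules\<close>

text \<open>This makes the weights of the basis vectors below pairwise different.\<close>
lemma weights_differ:
  assumes d: "wtfun d" and sp: "w \<in> signed_perms k" "w' \<in> signed_perms k"
    and sorted: "fibre_sorted k d w" "fibre_sorted k d w'" and ne: "w \<noteq> w'"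
  shows "\<exists>j\<in>{1..k}. d (inv w (int j)) \<noteq> d (inv w' (int j))"
proof (rule ccontr)
  assume "\<not> ?thesis"
  then have e: "d (inv w (int j)) = d (inv w' (int j))" if "1 \<le> j" "j \<le> k" for j using that by auto
  have "d (inv w x) = d (inv w' x)" if x: "x \<in> idx k" for x
  proof (cases "x > 0")
    case True
    then show ?thesis using e[of "nat x"] x by (auto simp: idx_def)
  next
    case False
    then have "d (inv w (- x)) = d (inv w' (- x))" using e[of "nat (- x)"] x by (auto simp: idx_def)
    then show ?thesis
      using wtfunD(1)[OF d] sp_neg[OF sp_inv[OF sp(1)], of x] sp_neg[OF sp_inv[OF sp(2)], of x] by simp
  qed
  then show False using fibre_sorted_unique[OF sp sorted] ne by blast
qed

text \<open>The arrangements in which no pair of labels with \<open>d a = d b\<close> or \<open>adj d a b\<close> is reversed.  Seen from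
  a member \<open>w\<^sub>0\<close> of \<open>\<F>\<^sup>(\<^sup>c\<^sup>,\<^sup>J\<^sup>)\<close>, these are the elements \<open>w\<^sub>0 w\<^sup>-\<^sup>1\<close> with
  \<open>w \<in> \<F>\<^sup>(\<^sup>c\<^sup>,\<^sup>J\<^sup>)\<close>; this is \<open>Fset_admissible\<close> below.\<close>
definition admissible ::
  "nat \<Rightarrow> complex \<Rightarrow> complex \<Rightarrow> complex \<Rightarrow> (int \<Rightarrow> complex) \<Rightarrow> (int \<Rightarrow> int) set" where
  "admissible k q q0 qk d = {y \<in> signed_perms k. \<forall>a\<in>idx k. \<forall>b\<in>idx k.
     a < b \<and> (d a = d b \<or> adj q q0 qk d a b) \<longrightarrow> inv y a < inv y b}"

text \<open>The set is convex for the weak order: undoing a descent does not leave it.\<close>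
lemma admissible_descent:
  assumes y: "y \<in> admissible k q q0 qk d" and d: "wtfun d" and i: "i < k" "y (lo i) > y (hi i)"
  shows "y \<circ> simple_refl i \<in> admissible k q q0 qk d"
    "d (y (lo i)) \<noteq> d (y (hi i))" "\<not> adj q q0 qk d (y (lo i)) (y (hi i))"
proof -
  have sp: "y \<in> signed_perms k" using y by (simp add: admissible_def)
  have car: "y (lo i) \<in> idx k" "y (hi i) \<in> idx k" using lo_hi_idx[OF i(1)] sp by auto
  have no: "\<not> (d a = d b \<or> adj q q0 qk d a b)"
    if "a = y (hi i)" "b = y (lo i)" for a b
  proof
    assume "d a = d b \<or> adj q q0 qk d a b"
    then have "inv y a < inv y b" using y car i that unfolding admissible_def by auto
    then have "hi i < lo i" using sp that by simp
    then show False using lo_less_hi[of i] by simp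
  qed
  then show "d (y (lo i)) \<noteq> d (y (hi i))" by metis
  show "\<not> adj q q0 qk d (y (lo i)) (y (hi i))" using no adj_sym[OF d] by blast
  have "inv (y \<circ> simple_refl i) a < inv (y \<circ> simple_refl i) b"
    if ab: "a \<in> idx k" "b \<in> idx k" "a < b" "d a = d b \<or> adj q q0 qk d a b" for a b
  proof (rule ccontr)
    assume "\<not> ?thesis"
    moreover have "inv y a < inv y b" using y ab unfolding admissible_def by blast
    ultimately have "a = y (lo i) \<and> b = y (hi i) \<or> a = - y (hi i) \<and> b = - y (lo i)"
      using order_change[OF sp i(1) ab(1,2)] by blast
    then show False using i(2) ab(3) by linarith
  qed
  then show "y \<circ> simple_refl i \<in> admissible k q q0 qk d"
    using sp_comp[OF sp sp_sr[OF i(1)]] unfolding admissible_def by blast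
qed

context hecke_mod
begin

lemma submodule_span:
  assumes B: "B \<subseteq> hcar M" and T: "\<And>i b. i < k \<Longrightarrow> b \<in> B \<Longrightarrow> hT M i b \<in> span B"
    and W: "\<And>j b. j \<le> k \<Longrightarrow> b \<in> B \<Longrightarrow> \<exists>a. hW M j b = a \<cdot> b"
  shows "submodule k M (span B)"
proof -
  have Wb: "hW M j b \<in> span B" if "j \<le> k" "b \<in> B" for j b
    using W[OF that] span_scale[OF span_base[OF that(2)]] by metis
  have Winvb: "hWinv M j b \<in> span B" if jb: "j \<le> k" "b \<in> B" for j b
  proof (cases "b = 0")
    case True
    then show ?thesis using linear_endo_more(1)[OF Winv_lin[OF jb(1)]] by (simp add: span_zero)
  next
    case False
    obtain a where a: "hW M j b = a \<cdot> b" using W[OF jb] by blast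
    have "b \<in> hcar M" using jb B by blast
    then have "hWinv M j b = inverse a \<cdot> b"
      using Winv_eigen[OF jb(1) _ a] eigenvalue_nz[OF jb(1) _ False a] by blast
    then show ?thesis using jb by (auto intro: span_scale span_base)
  qed
  show ?thesis
    unfolding submodule_def
  proof (intro conjI allI impI)
    show "span B \<subseteq> hcar M" by (rule span_minimal[OF B sub])
    show "subspace (span B)" by (rule subspace_span)
    show "hT M i ` span B \<subseteq> span B" if "i < k" for i
      by (rule linear_endo_span[OF T_lin[OF that] B T[OF that]])
    show "hW M j ` span B \<subseteq> span B" if "j \<le> k" for j
      by (rule linear_endo_span[OF W_lin[OF that] B Wb[OF that]])
    show "hWinv M j ` span B \<subseteq> span B" if "j \<le> k" for j
      by (rule linear_endo_span[OF Winv_lin[OF that] B Winvb[OF that]])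
  qed
qed

end

text \<open>An irreducible calibrated module with a weight vector \<open>v\<close>, from which a basis is constructed.\<close>
locale based = calib k q q0 qk M
  for k q q0 qk and M :: "('v::ab_group_add) hmod" +
  fixes z :: complex and d :: "int \<Rightarrow> complex" and v :: 'v
  assumes irreducible: "irreducible_module k q q0 qk M"
    and d: "wtfun d" and v: "wv z d v" "v \<noteq> 0"
begin

abbreviation "SP \<equiv> signed_perms k"
abbreviation "Adm \<equiv> admissible k q q0 qk d"

text \<open>\<open>vec y\<close> is obtained from \<open>v\<close> by applying the intertwining operators along a reduced word
  of \<open>y\<close>; its weight is \<open>d \<circ> y\<close>.  The choice of the word is irrelevant by \<open>vec_descent\<close> below.\<close>
function vec :: "(int \<Rightarrow> int) \<Rightarrow> 'v" where
  "vec y = (if y \<in> SP \<and> y \<noteq> id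
     then let i = (SOME i. i < k \<and> y (lo i) > y (hi i)) in tau i (d \<circ> (y \<circ> s i)) (vec (y \<circ> s i))
     else v)"
  by auto

lemma descent_exists:
  assumes "y \<in> SP" "y \<noteq> id"
  shows "\<exists>i. i < k \<and> y (lo i) > y (hi i)"
proof -
  obtain i where i: "i < k" "\<not> y (lo i) < y (hi i)" using sp_no_descent[OF assms(1)] assms(2) by blast
  then have "y (lo i) > y (hi i)"
    using sp_eq_iff[OF assms(1), of "lo i" "hi i"] lo_less_hi[of i] by force
  then show ?thesis using i by blast
qed

termination
proof (relation "measure (disp k)")
  fix y i assume y: "y \<in> SP \<and> y \<noteq> id" and i: "i = (SOME i. i < k \<and> y (lo i) > y (hi i))"
  have "\<exists>i. i < k \<and> y (lo i) > y (hi i)" using descent_exists y by blast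
  from someI_ex[OF this] have "i < k \<and> y (lo i) > y (hi i)" unfolding i[symmetric] .
  then show "(y \<circ> s i, y) \<in> measure (disp k)" using disp_descent y by auto
qed simp

declare vec.simps [simp del]

lemma vec_id: "vec id = v"
  by (simp add: vec.simps[of id])

lemma wt_comp: "y \<in> SP \<Longrightarrow> wtfun (d \<circ> y)"
  using wtfun_comp[OF d] .

lemma sp_s [simp]: "y \<in> SP \<Longrightarrow> i < k \<Longrightarrow> y \<circ> s i \<in> SP"
  using sp_comp sp_sr by blast

definition vec_ok :: "(int \<Rightarrow> int) \<Rightarrow> bool" where
  "vec_ok y \<longleftrightarrow> wv z (d \<circ> y) (vec y) \<and>
     (\<forall>i<k. y (lo i) > y (hi i) \<longrightarrow> vec y = tau i (d \<circ> (y \<circ> s i)) (vec (y \<circ> s i)))"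

text \<open>Matsumoto's argument: two descents of \<open>y\<close> are both undone by passing to the minimal
  representative \<open>x\<close> of the coset of \<open>y\<close> under the rank two subgroup that they generate, and the
  two paths from \<open>x\<close> to \<open>y\<close> agree by the braid relation for the intertwining operators.\<close>
lemma diamond:
  assumes y: "y \<in> SP" and IH: "\<And>x. x \<in> SP \<Longrightarrow> disp k x < disp k y \<Longrightarrow> vec_ok x"
    and i: "i < k" "y (lo i) > y (hi i)" and j: "j < k" "y (lo j) > y (hi j)" and ij: "i < j"
  shows "tau i (d \<circ> (y \<circ> s i)) (vec (y \<circ> s i)) = tau j (d \<circ> (y \<circ> s j)) (vec (y \<circ> s j))"
proof -
  define small where "small x \<longleftrightarrow> x \<in> SP \<and> disp k x < disp k y" for x
  have sm0: "small (y \<circ> s m)" if "m < k" "y (lo m) > y (hi m)" for m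
    using that y disp_descent[OF y] unfolding small_def by simp
  have sm: "small (x \<circ> s m)" if "small x" "m < k" "x (lo m) > x (hi m)" for x m
    using that disp_descent[of x k m] unfolding small_def by auto
  have step: "vec x = tau m (d \<circ> (x \<circ> s m)) (vec (x \<circ> s m))"
    if "small x" "m < k" "x (lo m) > x (hi m)" for x m
    using IH[of x] that unfolding small_def vec_ok_def by blast
  have wvx: "wv z (d \<circ> x) (vec x)" if "small x" for x
    using IH[of x] that unfolding small_def vec_ok_def by blast
  have reg: "vec x = 0 \<or> regular (d \<circ> x)" "wtfun (d \<circ> x)" if "small x" for x
    using weight_regular[OF wvx[OF that]] wt_comp that unfolding small_def by blast+
  consider (far) "i + 2 \<le> j" | (A) "1 \<le> i" "j = i + 1" | (B) "i = 0" "j = 1" using ij by linarith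
  then show ?thesis
  proof cases
    case far
    note c = commute_refl[OF far]
    let ?x = "y \<circ> s i \<circ> s j"
    have x: "?x = y \<circ> s j \<circ> s i" by (simp add: fun_eq_iff c)
    have 1: "(y \<circ> s i) (lo j) > (y \<circ> s i) (hi j)" "(y \<circ> s j) (lo i) > (y \<circ> s j) (hi i)"
      using i j by (auto simp: c)
    have sx: "small ?x" using sm[OF sm0[OF i] j(1)] 1 by blast
    have car: "vec ?x \<in> hcar M" using wvD(1)[OF wvx[OF sx]] .
    have "tau i (d \<circ> (y \<circ> s i)) (vec (y \<circ> s i)) = tau i (d \<circ> ?x \<circ> s j) (tau j (d \<circ> ?x) (vec ?x))"
      using step[OF sm0[OF i] j(1)] 1 by (simp add: comp_assoc[symmetric])
    also have "\<dots> = tau j (d \<circ> ?x \<circ> s i) (tau i (d \<circ> ?x) (vec ?x))"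
      using commute_tau[OF i(1) j(1) far car] relations(4)[OF car i(1) j(1) far] by blast
    also have "\<dots> = tau j (d \<circ> (y \<circ> s j)) (vec (y \<circ> s j))"
      using step[OF sm0[OF j] i(1)] 1 unfolding x by (simp add: comp_assoc[symmetric])
    finally show ?thesis .
  next
    case A
    note br = braid_refl_A[OF A(1)]
    have lohi: "lo i = int i" "hi i = int i + 1" "lo j = int i + 1" "hi j = int i + 2"
      using A by (auto simp: lo_def hi_def)
    let ?x = "y \<circ> s i \<circ> s j \<circ> s i"
    have x: "?x = y \<circ> s j \<circ> s i \<circ> s j" using A by (simp add: fun_eq_iff br)
    have dsc: "y (int i) > y (int i + 1)" "y (int i + 1) > y (int i + 2)"
      using i j by (auto simp: lohi)
    have 1: "(y \<circ> s i) (lo j) > (y \<circ> s i) (hi j)" "(y \<circ> s i \<circ> s j) (lo i) > (y \<circ> s i \<circ> s j) (hi i)"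
      "(y \<circ> s j) (lo i) > (y \<circ> s j) (hi i)" "(y \<circ> s j \<circ> s i) (lo j) > (y \<circ> s j \<circ> s i) (hi j)"
      using dsc unfolding comp_apply lohi
      by (simp_all add: A(2) br)
    note si = sm0[OF i] sm[OF sm0[OF i] j(1) 1(1)]
    note sj = sm0[OF j] sm[OF sm0[OF j] i(1) 1(3)]
    have sx: "small ?x" using sm[OF si(2) i(1) 1(2)] .
    have car: "vec ?x \<in> hcar M" using wvD(1)[OF wvx[OF sx]] .
    have k: "i + 1 < k" using A j by simp
    have e1: "d \<circ> ?x \<circ> s i = d \<circ> (y \<circ> s i \<circ> s j)" "d \<circ> (y \<circ> s i \<circ> s j) \<circ> s j = d \<circ> (y \<circ> s i)"
      by (simp_all add: fun_eq_iff)
    have e2: "d \<circ> (y \<circ> s j \<circ> s i \<circ> s j) \<circ> s j = d \<circ> (y \<circ> s j \<circ> s i)" "d \<circ> (y \<circ> s j \<circ> s i) \<circ> s i = d \<circ> (y \<circ> s j)"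
      by (simp_all add: fun_eq_iff)
    have l: "tau i (d \<circ> (y \<circ> s i)) (vec (y \<circ> s i))
        = tau i (d \<circ> ?x \<circ> s i \<circ> s j) (tau j (d \<circ> ?x \<circ> s i) (tau i (d \<circ> ?x) (vec ?x)))"
      unfolding e1 step[OF si(1) j(1) 1(1)] step[OF si(2) i(1) 1(2)] by (rule refl)
    have r: "tau j (d \<circ> (y \<circ> s j)) (vec (y \<circ> s j))
        = tau j (d \<circ> ?x \<circ> s j \<circ> s i) (tau i (d \<circ> ?x \<circ> s j) (tau j (d \<circ> ?x) (vec ?x)))"
      unfolding e2 step[OF sj(1) i(1) 1(3)] step[OF sj(2) j(1) 1(4)] x by (rule refl)
    show ?thesis
    proof (cases "vec ?x = 0")
      case True
      then show ?thesis unfolding l r using i j by simp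
    next
      case False
      then show ?thesis
        unfolding l r
        using braid_tau_A[OF A(1) k reg(2)[OF sx] _ car] reg(1)[OF sx] relations(3)[OF car A(1) k] A(2)
        by simp
    qed
  next
    case B
    note br = braid_refl_B
    have lohi: "lo 0 = - 1" "hi 0 = 1" "lo 1 = 1" "hi 1 = 2" by (auto simp: lo_def hi_def)
    note neg = sp_neg[OF y]
    let ?x = "y \<circ> s 0 \<circ> s 1 \<circ> s 0 \<circ> s 1"
    have x: "?x = y \<circ> s 1 \<circ> s 0 \<circ> s 1 \<circ> s 0" by (simp add: fun_eq_iff br)
    have dsc: "y 1 < 0" "y 1 > y 2" using i j unfolding B lohi neg by auto
    have 1: "(y \<circ> s 0) (lo 1) > (y \<circ> s 0) (hi 1)" "(y \<circ> s 0 \<circ> s 1) (lo 0) > (y \<circ> s 0 \<circ> s 1) (hi 0)"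
      "(y \<circ> s 0 \<circ> s 1 \<circ> s 0) (lo 1) > (y \<circ> s 0 \<circ> s 1 \<circ> s 0) (hi 1)"
      "(y \<circ> s 1) (lo 0) > (y \<circ> s 1) (hi 0)" "(y \<circ> s 1 \<circ> s 0) (lo 1) > (y \<circ> s 1 \<circ> s 0) (hi 1)"
      "(y \<circ> s 1 \<circ> s 0 \<circ> s 1) (lo 0) > (y \<circ> s 1 \<circ> s 0 \<circ> s 1) (hi 0)"
      using dsc by (auto simp: lohi br neg)
    have ij: "0 < k" "1 < k" using i j B by auto
    note s0 = sm0[OF i, unfolded B] and s1 = sm0[OF j, unfolded B]
    note si = s0 sm[OF s0 ij(2) 1(1)] sm[OF sm[OF s0 ij(2) 1(1)] ij(1) 1(2)]
    note sj = s1 sm[OF s1 ij(1) 1(4)] sm[OF sm[OF s1 ij(1) 1(4)] ij(2) 1(5)]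
    have sx: "small ?x" using sm[OF si(3) ij(2) 1(3)] .
    have car: "vec ?x \<in> hcar M" using wvD(1)[OF wvx[OF sx]] .
    have e1: "d \<circ> ?x \<circ> s 1 = d \<circ> (y \<circ> s 0 \<circ> s 1 \<circ> s 0)" 
      "d \<circ> (y \<circ> s 0 \<circ> s 1 \<circ> s 0) \<circ> s 0 = d \<circ> (y \<circ> s 0 \<circ> s 1)"
      "d \<circ> (y \<circ> s 0 \<circ> s 1) \<circ> s 1 = d \<circ> (y \<circ> s 0)"
      by (simp_all add: fun_eq_iff)
    have e2: "d \<circ> (y \<circ> s 1 \<circ> s 0 \<circ> s 1 \<circ> s 0) \<circ> s 0 = d \<circ> (y \<circ> s 1 \<circ> s 0 \<circ> s 1)" 
      "d \<circ> (y \<circ> s 1 \<circ> s 0 \<circ> s 1) \<circ> s 1 = d \<circ> (y \<circ> s 1 \<circ> s 0)"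
      "d \<circ> (y \<circ> s 1 \<circ> s 0) \<circ> s 0 = d \<circ> (y \<circ> s 1)"
      by (simp_all add: fun_eq_iff)
    have l: "tau 0 (d \<circ> (y \<circ> s 0)) (vec (y \<circ> s 0)) = tau 0 (d \<circ> ?x \<circ> s 1 \<circ> s 0 \<circ> s 1)
        (tau 1 (d \<circ> ?x \<circ> s 1 \<circ> s 0) (tau 0 (d \<circ> ?x \<circ> s 1) (tau 1 (d \<circ> ?x) (vec ?x))))"
      unfolding e1 step[OF si(1) ij(2) 1(1)] step[OF si(2) ij(1) 1(2)] step[OF si(3) ij(2) 1(3)]
      by (rule refl)
    have r: "tau 1 (d \<circ> (y \<circ> s 1)) (vec (y \<circ> s 1)) = tau 1 (d \<circ> ?x \<circ> s 0 \<circ> s 1 \<circ> s 0)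
        (tau 0 (d \<circ> ?x \<circ> s 0 \<circ> s 1) (tau 1 (d \<circ> ?x \<circ> s 0) (tau 0 (d \<circ> ?x) (vec ?x))))"
      unfolding e2 step[OF sj(1) ij(1) 1(4)] step[OF sj(2) ij(2) 1(5)] step[OF sj(3) ij(1) 1(6)] x
      by (rule refl)
    have k2: "2 \<le> k" using ij by simp
    have "tau 0 (d \<circ> (y \<circ> s 0)) (vec (y \<circ> s 0)) = tau 1 (d \<circ> (y \<circ> s 1)) (vec (y \<circ> s 1))"
    proof (cases "vec ?x = 0")
      case True
      then show ?thesis unfolding l r using ij by simp
    next
      case False
      then show ?thesis
        unfolding l r
        using braid_tau_B[OF k2 reg(2)[OF sx] _ car] reg(1)[OF sx] relations(2)[OF car k2] by simp
    qed
    then show ?thesis unfolding B .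
  qed
qed

lemma vec_ok: "y \<in> SP \<Longrightarrow> vec_ok y"
proof (induction "disp k y" arbitrary: y rule: less_induct)
  case less
  show ?case
  proof (cases "y = id")
    case True
    have "\<not> hi i < lo i" for i using lo_less_hi[of i] by simp
    then show ?thesis using v True by (simp add: vec_ok_def vec_id)
  next
    case False
    define i where "i = (SOME i. i < k \<and> y (lo i) > y (hi i))"
    have i: "i < k" "y (lo i) > y (hi i)"
      unfolding i_def using someI_ex[OF descent_exists[OF less.prems False]] by auto
    have e: "vec y = tau i (d \<circ> (y \<circ> s i)) (vec (y \<circ> s i))"
      using less.prems False by (simp add: vec.simps[of y] i_def[symmetric] Let_def)
    have IH: "\<And>x. x \<in> SP \<Longrightarrow> disp k x < disp k y \<Longrightarrow> vec_ok x" using less.hyps by blast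
    have sp: "y \<circ> s i \<in> SP" using less.prems i by simp
    have w: "wv z (d \<circ> (y \<circ> s i)) (vec (y \<circ> s i))"
      using IH[OF sp disp_descent[OF less.prems i]] unfolding vec_ok_def by blast
    have "wv z (d \<circ> y) (vec y)"
    proof (cases "vec (y \<circ> s i) = 0")
      case True
      then show ?thesis using e i by simp
    next
      case False
      note wt = wt_comp[OF sp]
      have dd: "d \<circ> (y \<circ> s i) \<circ> s i = d \<circ> y" by (simp add: fun_eq_iff)
      show ?thesis
        using tau_wv[OF w wt i(1) weight_off_wall[OF w False wt i(1)]] unfolding e dd .
    qed
    moreover have "vec y = tau j (d \<circ> (y \<circ> s j)) (vec (y \<circ> s j))" if j: "j < k" "y (lo j) > y (hi j)" for j
    proof (cases i j rule: linorder_cases)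
      case less
      show ?thesis unfolding e by (rule diamond[OF \<open>y \<in> SP\<close> IH i j less])
    next
      case equal
      then show ?thesis using e by blast
    next
      case greater
      show ?thesis unfolding e by (rule diamond[OF \<open>y \<in> SP\<close> IH j i greater, symmetric])
    qed
    ultimately show ?thesis unfolding vec_ok_def by blast
  qed
qed

lemma vec_wv: "y \<in> SP \<Longrightarrow> wv z (d \<circ> y) (vec y)"
  using vec_ok unfolding vec_ok_def by blast

lemma vec_car: "y \<in> SP \<Longrightarrow> vec y \<in> hcar M"
  using wvD(1)[OF vec_wv] .

lemma vec_off_wall: "y \<in> SP \<Longrightarrow> vec y \<noteq> 0 \<Longrightarrow> i < k \<Longrightarrow> (d \<circ> y) (lo i) \<noteq> (d \<circ> y) (hi i)"
  using weight_off_wall[OF vec_wv _ wt_comp] .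

lemma vec_descent:
  "y \<in> SP \<Longrightarrow> i < k \<Longrightarrow> y (lo i) > y (hi i) \<Longrightarrow> vec y = tau i (d \<circ> (y \<circ> s i)) (vec (y \<circ> s i))"
  using vec_ok unfolding vec_ok_def by blast

text \<open>In the basis of the vectors \<open>vec y\<close>, the operator \<open>T\<^sub>i\<close> has coefficient 1 along ascents.\<close>
definition coef :: "nat \<Rightarrow> (int \<Rightarrow> int) \<Rightarrow> complex" where
  "coef i y = (if y (lo i) < y (hi i) then 1 else rd i (d \<circ> y))"

text \<open>Along an ascent this is the definition of \<open>vec\<close>; along a descent it follows from
  \<open>\<tau>\<^sub>i\<^sup>2 = rad\<close>.\<close>
lemma T_vec:
  assumes y: "y \<in> SP" and i: "i < k"
  shows "hT M i (vec y) = dc i (d \<circ> y) \<cdot> vec y + coef i y \<cdot> vec (y \<circ> s i)"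
proof (cases "y (lo i) < y (hi i)")
  case True
  have "(y \<circ> s i) (lo i) > (y \<circ> s i) (hi i)" using True by simp
  from vec_descent[OF sp_s[OF y i] i this] have "vec (y \<circ> s i) = tau i (d \<circ> y) (vec y)"
    by (simp add: comp_def)
  then show ?thesis using True T_eq_tau[of i "vec y" "d \<circ> y"] by (simp add: coef_def)
next
  case False
  then have "y (lo i) > y (hi i)"
    using sp_eq_iff[OF y, of "lo i" "hi i"] lo_less_hi[of i] by force
  note e = vec_descent[OF y i this]
  have sp: "y \<circ> s i \<in> SP" using y i by simp
  show ?thesis
  proof (cases "vec (y \<circ> s i) = 0")
    case True
    then have "vec y = 0" using e i by simp
    then show ?thesis using True linear_endo_more(1)[OF T_lin[OF i]] by simp
  next
    case nz: False
    note w = vec_wv[OF sp] and wt = wt_comp[OF sp]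
    note off = vec_off_wall[OF sp nz i]
    have dd: "d \<circ> (y \<circ> s i) \<circ> s i = d \<circ> y" by (simp add: fun_eq_iff)
    have "tau i (d \<circ> y) (vec y) = rd i (d \<circ> (y \<circ> s i)) \<cdot> vec (y \<circ> s i)"
      using tau_tau[OF i wvD(1)[OF w] wt off] unfolding dd e[symmetric] .
    also have "rd i (d \<circ> (y \<circ> s i)) = rd i (d \<circ> y)"
      using rad_refl[OF wt off, of q q0 qk] unfolding dd by (rule sym)
    finally have t: "tau i (d \<circ> y) (vec y) = rd i (d \<circ> y) \<cdot> vec (y \<circ> s i)" .
    show ?thesis
      unfolding T_eq_tau[of i "vec y" "d \<circ> y"] t coef_def using False by (simp only: if_False)
  qed
qed

lemma W_vec:
  assumes "y \<in> SP"
  shows "hW M 0 (vec y) = z \<cdot> vec y" "1 \<le> j \<Longrightarrow> j \<le> k \<Longrightarrow> hW M j (vec y) = d (y (int j)) \<cdot> vec y"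
  using wvD[OF vec_wv[OF assms]] by auto

lemma W_vec_ex: "y \<in> SP \<Longrightarrow> j \<le> k \<Longrightarrow> \<exists>a. hW M j (vec y) = a \<cdot> vec y"
  using W_vec[of y] by (cases "j = 0") auto

lemma submodule_vec:
  assumes S: "S \<subseteq> SP" and cl: "\<And>y i. y \<in> S \<Longrightarrow> i < k \<Longrightarrow> y \<circ> s i \<notin> S \<Longrightarrow> coef i y \<cdot> vec (y \<circ> s i) = 0"
  shows "submodule k M (span (vec ` S))"
proof (rule submodule_span)
  show "vec ` S \<subseteq> hcar M" using S vec_car by blast
  show "\<exists>a. hW M j b = a \<cdot> b" if "j \<le> k" "b \<in> vec ` S" for j b
    using that S W_vec_ex by blast
  show "hT M i b \<in> span (vec ` S)" if i: "i < k" and b: "b \<in> vec ` S" for i b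
  proof -
    obtain y where y: "y \<in> S" "b = vec y" using b by blast
    have "coef i y \<cdot> vec (y \<circ> s i) \<in> span (vec ` S)"
      using cl[OF y(1) i] by (cases "y \<circ> s i \<in> S") (auto intro: span_scale span_base span_zero)
    moreover have "dc i (d \<circ> y) \<cdot> vec y \<in> span (vec ` S)"
      using y by (auto intro: span_scale span_base)
    ultimately show ?thesis
      unfolding y(2) T_vec[OF subsetD[OF S y(1)] i] by (rule span_add[rotated])
  qed
qed

lemma submodule_car: "submodule k M U \<Longrightarrow> U = {0} \<or> U = hcar M"
  using irreducible unfolding irreducible_module_def by blast

lemma span_vec: "span (vec ` SP) = hcar M"
proof -
  have "submodule k M (span (vec ` SP))" by (rule submodule_vec) auto
  moreover have "v \<in> span (vec ` SP)" using vec_id sp_id by (metis image_eqI span_base)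
  ultimately show ?thesis using submodule_car v(2) by blast
qed

text \<open>A path of nonzero vectors never crosses a hyperplane of \<open>Z\<close>, because there the weight would lie on
  the wall of a simple reflection.\<close>
lemma vec_nz_sorted:
  assumes "y \<in> SP" "vec y \<noteq> 0"
  shows "fibre_sorted k d (inv y)"
  using assms
proof (induction rule: sp_induct)
  case id
  then show ?case by (simp add: fibre_sorted_def)
next
  case (descent y i)
  let ?x = "y \<circ> s i"
  have x: "?x \<in> SP" "vec ?x \<noteq> 0"
    using descent.hyps descent.prems vec_descent[OF descent.hyps] by auto
  have ne: "d (?x (lo i)) \<noteq> d (?x (hi i))"
    using vec_off_wall[OF x descent.hyps(2)] by simp
  show ?case
    unfolding fibre_sorted_def
  proof (intro ballI impI, rule ccontr)
    fix a b assume ab: "a \<in> idx k" "b \<in> idx k" "a < b \<and> d a = d b" "\<not> inv y a < inv y b"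
    have "inv ?x a < inv ?x b"
      using descent.IH[OF x(2)] ab unfolding fibre_sorted_def by blast
    from order_change[OF x(1) descent.hyps(2) ab(1,2) this] ab(4)
    have "a = ?x (lo i) \<and> b = ?x (hi i) \<or> a = - ?x (hi i) \<and> b = - ?x (lo i)" by simp
    then show False using ne ab(3) wtfunD(1)[OF d] by auto
  qed
qed

lemma distinct_weights:
  assumes "y \<in> SP" "vec y \<noteq> 0" "y' \<in> SP" "vec y' \<noteq> 0" "y \<noteq> y'"
  shows "\<exists>j\<in>{1..k}. d (y (int j)) \<noteq> d (y' (int j))"
proof -
  have "inv y \<noteq> inv y'" using assms inv_inv_sp by metis
  from weights_differ[OF d sp_inv[OF assms(1)] sp_inv[OF assms(3)]
      vec_nz_sorted[OF assms(1,2)] vec_nz_sorted[OF assms(3,4)] this]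
  show ?thesis using assms by simp
qed

lemma vec_independent:
  assumes S: "S \<subseteq> {y \<in> SP. vec y \<noteq> 0}" and "(\<Sum>y\<in>S. c y \<cdot> vec y) = 0" and y: "y \<in> S"
  shows "c y = 0"
proof -
  have "c y \<cdot> vec y \<in> {0}"
  proof (rule joint_eigenvector_components[where S = S and J = "{1..k}" and W = "hW M" and x = vec
        and l = "\<lambda>j y. d (y (int j))"])
    show "finite S" using S finite_subset[OF _ finite_sp] by blast
    show "\<And>j. j \<in> {1..k} \<Longrightarrow> hW M j ` {0} \<subseteq> {0}"
      using linear_endo_more(1)[OF W_lin] by auto
    show "\<And>s s'. s \<in> S \<Longrightarrow> s' \<in> S \<Longrightarrow> s \<noteq> s' \<Longrightarrow> \<exists>j\<in>{1..k}. d (s (int j)) \<noteq> d (s' (int j))"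
      using distinct_weights S by blast
    show "subspace {0}" by (rule subspace_single_0)
  qed (use S assms in \<open>auto simp: vec_car W_lin W_vec\<close>)
  then show ?thesis using S y by auto
qed

lemma vec_inj: "inj_on vec {y \<in> SP. vec y \<noteq> 0}"
proof (rule inj_onI, rule ccontr)
  fix x x' assume H: "x \<in> {y \<in> SP. vec y \<noteq> 0}" "x' \<in> {y \<in> SP. vec y \<noteq> 0}" "vec x = vec x'" "x \<noteq> x'"
  have "(\<Sum>y\<in>{x, x'}. (if y = x then 1 else - 1) \<cdot> vec y) = 0" using H by simp
  then have "(if x = x then 1 else - 1 :: complex) = 0"
    by (rule vec_independent[rotated]) (use H in auto)
  then show False by simp
qed

text \<open>If \<open>y\<close> reverses a pair \<open>a < b\<close> with \<open>adjc d a b\<close>, then the vectors \<open>vec x\<close> for which \<open>x\<close>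
  reverses this pair span a submodule: a path can leave this set only along a descent at which
  \<open>coef\<close> vanishes.  It does not contain \<open>v\<close>.\<close>
lemma vec_nz_iff:
  assumes y: "y \<in> SP"
  shows "vec y \<noteq> 0 \<longleftrightarrow> y \<in> Adm"
proof
  assume nz: "vec y \<noteq> 0"
  show "y \<in> Adm"
  proof (rule ccontr)
    assume "y \<notin> Adm"
    then obtain a b where ab: "a \<in> idx k" "b \<in> idx k" "a < b" "\<not> inv y a < inv y b"
      and bad: "d a = d b \<or> adjc d a b" using y unfolding admissible_def by blast
    have "d a \<noteq> d b" using vec_nz_sorted[OF y nz] ab unfolding fibre_sorted_def by blast
    then have adj: "adjc d a b" using bad by blast
    define S where "S = {x \<in> SP. \<not> inv x a < inv x b}"
    have "submodule k M (span (vec ` S))"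
    proof (rule submodule_vec)
      show "S \<subseteq> SP" by (auto simp: S_def)
      fix x i assume x: "x \<in> S" and i: "i < k" and out: "x \<circ> s i \<notin> S"
      have sp: "x \<in> SP" using x by (simp add: S_def)
      let ?x = "x \<circ> s i"
      have spx: "?x \<in> SP" using sp i by simp
      then have "inv ?x a < inv ?x b" using out by (simp add: S_def)
      moreover have "\<not> inv (?x \<circ> s i) a < inv (?x \<circ> s i) b" using x by (simp add: S_def)
      ultimately have c: "a = ?x (lo i) \<and> b = ?x (hi i) \<or> a = - ?x (hi i) \<and> b = - ?x (lo i)"
        using order_change[OF spx i ab(1,2)] by blast
      then have gt: "\<not> x (lo i) < x (hi i)" using ab(3) by auto
      show "coef i x \<cdot> vec ?x = 0"
      proof (cases "vec x = 0")
        case True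
        have "hT M i (vec x) = 0" using True linear_endo_more(1)[OF T_lin[OF i]] by simp
        then show ?thesis using T_vec[OF sp i] True by simp
      next
        case False
        have "adjc d (x (lo i)) (x (hi i))"
          using c adj adj_sym[OF d] adj_neg[OF d, of q q0 qk a b] by auto
        then have "adjc (d \<circ> x) (lo i) (hi i)" by (simp add: adj_comp[OF sp])
        then have "rd i (d \<circ> x) = 0"
          using rad_eq_0_iff[OF wt_comp[OF sp] vec_off_wall[OF sp False i] nonzero]
          by blast
        then show ?thesis using gt by (simp add: coef_def)
      qed
    qed
    moreover have "vec y \<in> span (vec ` S)" using y ab by (auto simp: S_def intro: span_base)
    ultimately have "v \<in> span (vec ` S)" using submodule_car nz wvD(1)[OF v(1)] by blast
    also have "span (vec ` S) = span (vec ` {x \<in> S. vec x \<noteq> 0})"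
    proof -
      have "vec ` S - {0} = vec ` {x \<in> S. vec x \<noteq> 0} - {0}" by auto
      from arg_cong[OF this, of span] show ?thesis unfolding span_delete_0 .
    qed
    finally have "v \<in> span (vec ` {x \<in> S. vec x \<noteq> 0})" .
    moreover have fin: "finite {x \<in> S. vec x \<noteq> 0}"
      by (rule finite_subset[OF _ finite_sp[of k]]) (auto simp: S_def)
    moreover have inj: "inj_on vec {x \<in> S. vec x \<noteq> 0}"
      by (rule inj_on_subset[OF vec_inj]) (auto simp: S_def)
    ultimately obtain c where c: "v = (\<Sum>x\<in>vec ` {x \<in> S. vec x \<noteq> 0}. c x \<cdot> x)"
      unfolding span_finite[OF finite_imageI[OF fin]] by blast
    let ?S = "{x \<in> S. vec x \<noteq> 0}"
    have notin: "id \<notin> ?S" using ab by (simp add: S_def)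
    define c' where "c' y = (if y = id then - 1 else c (vec y))" for y
    have "(\<Sum>x\<in>insert id ?S. c' x \<cdot> vec x) = - v + (\<Sum>x\<in>?S. c' x \<cdot> vec x)"
      using fin notin by (simp add: vec_id c'_def)
    also have "(\<Sum>x\<in>?S. c' x \<cdot> vec x) = (\<Sum>x\<in>?S. c (vec x) \<cdot> vec x)"
      using notin by (intro sum.cong) (auto simp: c'_def)
    also have "\<dots> = v" using c sum.reindex[OF inj, of "\<lambda>x. c x \<cdot> x"] by (simp only: comp_def)
    finally have 0: "(\<Sum>x\<in>insert id ?S. c' x \<cdot> vec x) = 0" by (simp only: left_minus)
    have "c' id = 0"
      by (rule vec_independent[OF _ 0]) (use v vec_id in \<open>auto simp: S_def\<close>)
    then have False by (simp add: c'_def)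
    then show False by simp
  qed
next
  assume "y \<in> Adm"
  with y show "vec y \<noteq> 0"
  proof (induction rule: sp_induct)
    case id
    then show ?case using v unfolding vec_id by simp
  next
    case (descent y i)
    note a = admissible_descent[OF descent.prems d descent.hyps(2,3)]
    let ?x = "y \<circ> s i"
    have sp: "?x \<in> SP" using descent.hyps by simp
    note nz = descent.IH[OF a(1)]
    have "\<not> adjc (d \<circ> ?x) (lo i) (hi i)"
      using a(3) adj_sym[OF d] by (auto simp: adj_comp[OF sp])
    then have "rd i (d \<circ> ?x) \<noteq> 0"
      using rad_eq_0_iff[OF wt_comp[OF sp] vec_off_wall[OF sp nz descent.hyps(2)] nonzero]
      by blast
    then have "rd i (d \<circ> ?x) \<cdot> vec ?x \<noteq> 0" using nz scale_eq_0_iff by blast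
    then have "tau i (d \<circ> ?x \<circ> s i) (tau i (d \<circ> ?x) (vec ?x)) \<noteq> 0"
      unfolding tau_tau[OF descent.hyps(2) vec_car[OF sp] wt_comp[OF sp]
          vec_off_wall[OF sp nz descent.hyps(2)]] .
    then show ?case
      unfolding vec_descent[OF descent.hyps] using tau_0[OF descent.hyps(2)] by metis
  qed
qed

lemma Adm_SP: "Adm \<subseteq> SP"
  by (auto simp: admissible_def)

lemma Adm_eq: "Adm = {y \<in> SP. vec y \<noteq> 0}"
  using vec_nz_iff Adm_SP by blast

lemma basis:
  "independent (vec ` Adm)" "span (vec ` Adm) = hcar M"
proof -
  have fin: "finite Adm" using finite_subset[OF Adm_SP finite_sp] .
  show "independent (vec ` Adm)"
  proof
    assume "dependent (vec ` Adm)"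
    then obtain u where u: "\<exists>x\<in>vec ` Adm. u x \<noteq> 0" "(\<Sum>x\<in>vec ` Adm. u x \<cdot> x) = 0"
      unfolding dependent_finite[OF finite_imageI[OF fin]] by blast
    have "(\<Sum>y\<in>Adm. u (vec y) \<cdot> vec y) = 0"
      using u(2) sum.reindex[OF vec_inj, of "\<lambda>x. u x \<cdot> x"] by (simp add: Adm_eq)
    then show False using vec_independent[of Adm "\<lambda>y. u (vec y)"] u(1) Adm_eq by blast
  qed
  have "vec ` SP - {0} = vec ` Adm - {0}" using vec_nz_iff Adm_SP by blast
  from arg_cong[OF this, of span] show "span (vec ` Adm) = hcar M"
    unfolding span_delete_0 span_vec ..
qed

lemma Adm_regular: "y \<in> Adm \<Longrightarrow> regular (d \<circ> y)"
  using weight_regular[OF vec_wv _ wt_comp] vec_nz_iff Adm_SP by blast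

end

section \<open>Isomorphisms\<close>

lemma hmod_iso_refl: "hmod_iso k M M"
  unfolding hmod_iso_def by (rule exI[of _ id]) simp

lemma hmod_iso_trans:
  assumes "hmod_iso k M N" "hmod_iso k N P"
  shows "hmod_iso k M P"
proof -
  obtain f where f: "bij_betw f (hcar M) (hcar N)"
    "\<forall>x\<in>hcar M. \<forall>y\<in>hcar M. f (x + y) = f x + f y"
    "\<forall>a. \<forall>x\<in>hcar M. f (hscl M a x) = hscl N a (f x)"
    "\<forall>i<k. \<forall>x\<in>hcar M. f (hT M i x) = hT N i (f x)"
    "\<forall>j\<le>k. \<forall>x\<in>hcar M. f (hW M j x) = hW N j (f x)"
    using assms(1) unfolding hmod_iso_def by blast
  obtain g where g: "bij_betw g (hcar N) (hcar P)"
    "\<forall>x\<in>hcar N. \<forall>y\<in>hcar N. g (x + y) = g x + g y"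
    "\<forall>a. \<forall>x\<in>hcar N. g (hscl N a x) = hscl P a (g x)"
    "\<forall>i<k. \<forall>x\<in>hcar N. g (hT N i x) = hT P i (g x)"
    "\<forall>j\<le>k. \<forall>x\<in>hcar N. g (hW N j x) = hW P j (g x)"
    using assms(2) unfolding hmod_iso_def by blast
  have "f x \<in> hcar N" if "x \<in> hcar M" for x using f(1) that by (rule bij_betwE[THEN bspec])
  then show ?thesis
    unfolding hmod_iso_def using f g bij_betw_trans[OF f(1) g(1)]
    by (intro exI[of _ "g \<circ> f"]) simp
qed

context hecke_mod
begin

lemma hmod_iso_sym:
  assumes "hmod_iso k M N"
  shows "hmod_iso k N M"
proof -
  obtain f where f: "bij_betw f (hcar M) (hcar N)"
    "\<forall>x\<in>hcar M. \<forall>y\<in>hcar M. f (x + y) = f x + f y"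
    "\<forall>a. \<forall>x\<in>hcar M. f (a \<cdot> x) = hscl N a (f x)"
    "\<forall>i<k. \<forall>x\<in>hcar M. f (hT M i x) = hT N i (f x)"
    "\<forall>j\<le>k. \<forall>x\<in>hcar M. f (hW M j x) = hW N j (f x)"
    using assms unfolding hmod_iso_def by blast
  define g where "g = inv_into (hcar M) f"
  have gf: "g (f x) = x" if "x \<in> hcar M" for x
    unfolding g_def using bij_betw_inv_into_left[OF f(1) that] .
  have "\<exists>x\<in>hcar M. y = f x" if "y \<in> hcar N" for y
    using that f(1) by (auto simp: bij_betw_def)
  moreover have "g (f x + f y) = x + y" if "x \<in> hcar M" "y \<in> hcar M" for x y
    using gf[of "x + y"] f(2) that by simp
  moreover have "g (hscl N a (f x)) = a \<cdot> x" if "x \<in> hcar M" for a x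
    using gf[of "a \<cdot> x"] f(3) that by simp
  moreover have "g (hT N i (f x)) = hT M i x" if "x \<in> hcar M" "i < k" for i x
    using gf[of "hT M i x"] f(4) that by simp
  moreover have "g (hW N j (f x)) = hW M j x" if "x \<in> hcar M" "j \<le> k" for j x
    using gf[of "hW M j x"] f(5) that linear_endoD(1)[OF W_lin] by simp
  ultimately show ?thesis
    unfolding hmod_iso_def using bij_betw_inv_into[OF f(1), folded g_def] gf
    by (intro exI[of _ g]) (metis (no_types, lifting))
qed

end

text \<open>The set of those \<open>y\<close> with \<open>vec y \<noteq> 0\<close> and the matrices of the generators in the basis \<open>vec\<close>
  depend only on the weight \<open>(z, d)\<close>, so \<open>vec y \<mapsto> vec y\<close> is an isomorphism.\<close>
theorem irreducible_iso_if_common_weight: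
  fixes M :: "('v::ab_group_add) hmod" and N :: "('u::ab_group_add) hmod"
  assumes "based k q q0 qk M z d v" "based k q q0 qk N z d u"
  shows "hmod_iso k M N"
proof -
  interpret A: based k q q0 qk M z d v by fact
  interpret B: based k q q0 qk N z d u by fact
  interpret P: vector_space_pair "hscl M" "hscl N"
    using A.vs B.vs by (simp add: vector_space_pair_def)
  note ind = A.basis(1)
  obtain g where lin: "Vector_Spaces.linear (hscl M) (hscl N) g"
    and g: "\<forall>x\<in>A.vec ` A.Adm. g x = B.vec (inv_into A.Adm A.vec x)"
    using P.linear_independent_extend[OF ind, of "\<lambda>x. B.vec (inv_into A.Adm A.vec x)"] by blast
  have injA: "inj_on A.vec A.Adm" "inj_on B.vec A.Adm"
    using A.vec_inj B.vec_inj A.Adm_eq B.Adm_eq by simp_all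
  have gvec: "g (A.vec y) = B.vec y" if y: "y \<in> signed_perms k" for y
  proof (cases "y \<in> A.Adm")
    case True
    then show ?thesis using g injA by simp
  next
    case False
    then show ?thesis using A.vec_nz_iff[OF y] B.vec_nz_iff[OF y] P.linear_0[OF lin] by simp
  qed
  note add = P.linear_add[OF lin] and scale = P.linear_scale[OF lin]
  have img: "g ` A.vec ` A.Adm = B.vec ` A.Adm"
    using gvec A.Adm_SP by (force simp: image_image)
  have "g ` hcar M = hcar N"
    unfolding A.basis(2)[symmetric] P.linear_span_image[OF lin, symmetric] img B.basis(2) ..
  moreover have "inj_on g (hcar M)"
    unfolding A.basis(2)[symmetric]
  proof (rule P.linear_inj_on_span_independent_image[OF lin])
    show "B.independent (g ` A.vec ` A.Adm)" unfolding img by (rule B.basis(1))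
    show "inj_on g (A.vec ` A.Adm)"
    proof (rule inj_onI)
      fix x y assume "x \<in> A.vec ` A.Adm" "y \<in> A.vec ` A.Adm" "g x = g y"
      then obtain a b where "a \<in> A.Adm" "b \<in> A.Adm" and xy: "x = A.vec a" "y = A.vec b" by blast
      moreover from this have "B.vec a = B.vec b"
        using \<open>g x = g y\<close> gvec[of a] gvec[of b] A.Adm_SP by (simp add: subset_iff)
      ultimately have "a = b" using injA by (auto dest: inj_onD)
      then show "x = y" using xy by simp
    qed
  qed
  ultimately have bij: "bij_betw g (hcar M) (hcar N)" by (simp add: bij_betw_def)
  \<comment> \<open>It suffices to compare two operators on the vectors \<open>vec y\<close>.\<close>
  have ext: "g (f x) = h (g x)"
    if f: "linear_endo M f" and h: "linear_endo N h" and x: "x \<in> hcar M"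
      and e: "\<And>y. y \<in> A.Adm \<Longrightarrow> g (f (A.vec y)) = h (B.vec y)" for f h x
  proof -
    have gc: "g x \<in> hcar N" if "x \<in> hcar M" for x using bij that by (rule bij_betwE[THEN bspec])
    have "A.span (A.vec ` A.Adm) \<subseteq> {x \<in> hcar M. g (f x) = h (g x)}"
    proof (rule A.span_minimal)
      show "A.vec ` A.Adm \<subseteq> {x \<in> hcar M. g (f x) = h (g x)}"
        using e gvec A.Adm_SP A.vec_car by (auto simp: subset_iff)
      show "A.subspace {x \<in> hcar M. g (f x) = h (g x)}"
        by (rule A.subspaceI)
           (auto simp: A.linear_endo_more[OF f] B.linear_endo_more[OF h] A.linear_endoD[OF f]
              B.linear_endoD[OF h] gc add scale P.linear_0[OF lin])
    qed
    then show ?thesis using x A.basis(2) by blast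
  qed
  have T: "g (hT M i x) = hT N i (g x)" if "i < k" "x \<in> hcar M" for i x
  proof (rule ext[OF A.T_lin B.T_lin that(2)])
    fix y assume "y \<in> A.Adm"
    then have y: "y \<in> signed_perms k" using A.Adm_SP by blast
    show "g (hT M i (A.vec y)) = hT N i (B.vec y)"
      unfolding A.T_vec[OF y that(1)] B.T_vec[OF y that(1)] add scale
        gvec[OF y] gvec[OF A.sp_s[OF y that(1)]] A.coef_def B.coef_def ..
  qed (use that in auto)
  have W: "g (hW M j x) = hW N j (g x)" if "j \<le> k" "x \<in> hcar M" for j x
  proof (rule ext[OF A.W_lin B.W_lin that(2)])
    fix y assume "y \<in> A.Adm"
    then have y: "y \<in> signed_perms k" using A.Adm_SP by blast
    show "g (hW M j (A.vec y)) = hW N j (B.vec y)"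
      using A.W_vec[OF y] B.W_vec[OF y] that(1) by (cases "j = 0") (simp_all add: scale gvec[OF y])
  qed (use that in auto)
  show ?thesis
    unfolding hmod_iso_def using bij T W by (intro exI[of _ g]) (simp add: add scale)
qed

section \<open>Local regions\<close>

lemma wtfun_gam: "c \<in> cvecs k \<Longrightarrow> wtfun (gam tau c)"
  by (simp add: wtfun_def gam_def tpow_def cvecs_def exp_minus)

text \<open>Here \<open>lt\<close> is the chosen logarithm of \<open>t\<close>.\<close>
locale hecke_log = hecke_params k q q0 qk for k q q0 qk +
  fixes lt r1 r2 :: complex
  assumes exp_lt: "exp (lt / 2) = q"
    and r1: "- tpow lt r1 = - (qk * inverse q0)" and r2: "- tpow lt r2 = qk * q0"
begin

lemma tpow_1: "tpow lt 1 = q\<^sup>2"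
proof -
  have "exp lt = exp (lt / 2 + lt / 2)" by simp
  also have "\<dots> = q\<^sup>2" by (simp only: exp_add exp_lt power2_eq_square)
  finally show ?thesis by (simp add: tpow_def)
qed

lemma tpow_simps:
  "tpow lt (a + b) = tpow lt a * tpow lt b" "tpow lt (a - b) = tpow lt a / tpow lt b"
  "tpow lt (- a) = inverse (tpow lt a)" "tpow lt 0 = 1" "tpow lt a \<noteq> 0"
  by (auto simp: tpow_def algebra_simps exp_add exp_diff exp_minus)

lemma Zset_roots:
  assumes c: "c \<in> cvecs k"
  shows "Zset k lt c = pair_roots k (\<lambda>a b. gam lt c a = gam lt c b)"
proof (subst pair_roots_eqI[symmetric])
  show "gam lt c (- b) = gam lt c (- a)" if "gam lt c a = gam lt c b" for a b
    using that wtfunD(1)[OF wtfun_gam[OF c]] by simp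
  have n: "c (- i) = - c i" for i using c by (simp add: cvecs_def)
  have 1: "same_pow lt (c i) (c (- i)) \<longleftrightarrow> gam lt c (- i) = gam lt c i" for i
    by (auto simp: same_pow_def gam_def)
  have 2: "same_pow lt (c j - c i) 0 \<longleftrightarrow> gam lt c i = gam lt c j" for i j
    using tpow_simps(5)[of "c i"] by (auto simp: same_pow_def gam_def tpow_simps)
  have 3: "same_pow lt (c j + c i) 0 \<longleftrightarrow> gam lt c (- i) = gam lt c j" for i j
    using 2[of j "- i"] by (simp add: n)
  show "Zset k lt c = {eps i |i. 1 \<le> i \<and> i \<le> int k \<and> gam lt c (- i) = gam lt c i} \<union>
    {eps j - eps i |i j. 0 < i \<and> i < j \<and> j \<le> int k \<and> gam lt c i = gam lt c j} \<union>
    {eps j + eps i |i j. 0 < i \<and> i < j \<and> j \<le> int k \<and> gam lt c (- i) = gam lt c j}"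
    unfolding Zset_def 1 2 3 ..
qed

lemma Pset_roots:
  assumes c: "c \<in> cvecs k"
  shows "Pset k lt r1 r2 c = pair_roots k (adjc (gam lt c))"
proof (subst pair_roots_eqI[symmetric])
  show "adjc (gam lt c) (- b) (- a)" if "adjc (gam lt c) a b" for a b
    using adj_neg[OF wtfun_gam[OF c] that] .
  have n: "c (- i) = - c i" for i using c by (simp add: cvecs_def)
  have r: "tpow lt r1 = qk * inverse q0" "tpow lt r2 = - (qk * q0)"
    using r1 r2[symmetric] by simp_all
  have m: "- x = y \<longleftrightarrow> x = - y" for x y :: complex by auto
  have 1: "(\<exists>r\<in>{r1, - r1, r2, - r2}. same_pow lt (c i) r) \<longleftrightarrow> adjc (gam lt c) (- i) i" for i
    using nonzero unfolding same_pow_def adj_def special_def gam_def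
    by (auto simp: tpow_simps r m mult.commute)
  have 2: "(\<exists>e\<in>{1, - 1}. same_pow lt (c j - c i) e) \<longleftrightarrow> adjc (gam lt c) i j" if "j \<noteq> - i" for i j
    using nonzero tpow_simps(5)[of "c i"] tpow_simps(5)[of "c j"] that
    unfolding same_pow_def adj_def gam_def by (auto simp: tpow_simps tpow_1 field_simps)
  have 3: "(\<exists>e\<in>{1, - 1}. same_pow lt (c j + c i) e) \<longleftrightarrow> adjc (gam lt c) (- i) j" if "j \<noteq> i" for i j
    using 2[of j "- i"] that by (simp add: n)
  show "Pset k lt r1 r2 c = {eps i |i. 1 \<le> i \<and> i \<le> int k \<and> adjc (gam lt c) (- i) i} \<union>
    {eps j - eps i |i j. 0 < i \<and> i < j \<and> j \<le> int k \<and> adjc (gam lt c) i j} \<union>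
    {eps j + eps i |i j. 0 < i \<and> i < j \<and> j \<le> int k \<and> adjc (gam lt c) (- i) j}"
    unfolding Pset_def 1
  proof (intro arg_cong2[where f = "(\<union>)"] refl Collect_cong)
    show "(\<exists>i j. f = eps j - eps i \<and> 0 < i \<and> i < j \<and> j \<le> int k \<and> (\<exists>e\<in>{1, - 1}. same_pow lt (c j - c i) e))
      = (\<exists>i j. f = eps j - eps i \<and> 0 < i \<and> i < j \<and> j \<le> int k \<and> adjc (gam lt c) i j)" for f
      by (intro ex_cong1 conj_cong refl, rule 2) simp
    show "(\<exists>i j. f = eps j + eps i \<and> 0 < i \<and> i < j \<and> j \<le> int k \<and> (\<exists>e\<in>{1, - 1}. same_pow lt (c j + c i) e))
      = (\<exists>i j. f = eps j + eps i \<and> 0 < i \<and> i < j \<and> j \<le> int k \<and> adjc (gam lt c) (- i) j)" for f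
      by (intro ex_cong1 conj_cong refl, rule 3) simp
  qed
qed

lemma pair_roots_inter:
  assumes "\<And>a b. Q a b \<Longrightarrow> Q (- b) (- a)"
  shows "pair_roots k Q' \<inter> pair_roots k Q = pair_roots k (\<lambda>a b. Q' a b \<and> Q a b)"
  using pair_roots_mem[of Q, OF assms] unfolding pair_roots_def by blast

text \<open>In terms of pairs of indices, \<open>R(w) \<inter> Z(c) = \<emptyset>\<close> says that \<open>w\<close> is increasing on the fibres of
  \<open>\<gamma>\<close>.\<close>
lemma Fset_iff:
  assumes c: "c \<in> cvecs k"
  shows "w \<in> Fset k lt r1 r2 c J \<longleftrightarrow> w \<in> signed_perms k \<and> fibre_sorted k (gam lt c) w \<and>
    J = pair_roots k (\<lambda>a b. w a > w b \<and> adjc (gam lt c) a b)"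
proof (cases "w \<in> signed_perms k")
  case True
  note wt = wtfun_gam[OF c, of lt]
  have Z: "Rset k w \<inter> Zset k lt c = pair_roots k (\<lambda>a b. w a > w b \<and> gam lt c a = gam lt c b)"
    unfolding Rset_roots[OF True] Zset_roots[OF c]
    by (rule pair_roots_inter) (simp add: wtfunD(1)[OF wt])
  have lin: "w a < w b \<longleftrightarrow> \<not> w b < w a" if "a < b" for a b
    using that sp_eq_iff[OF True, of a b] by linarith
  have "Rset k w \<inter> Zset k lt c = {} \<longleftrightarrow> fibre_sorted k (gam lt c) w"
    unfolding Z pair_roots_def fibre_sorted_def
    by (auto simp: lin)
  moreover have "Rset k w \<inter> Pset k lt r1 r2 c = pair_roots k (\<lambda>a b. w a > w b \<and> adjc (gam lt c) a b)"
    unfolding Rset_roots[OF True] Pset_roots[OF c] by (rule pair_roots_inter) (rule adj_neg[OF wt])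
  ultimately show ?thesis using True unfolding Fset_def by blast
qed (simp add: Fset_def)

lemma Fset_SP: "w \<in> Fset k lt r1 r2 c J \<Longrightarrow> w \<in> signed_perms k"
  by (simp add: Fset_def)

text \<open>Membership in \<open>\<F>\<^sup>(\<^sup>c\<^sup>,\<^sup>J\<^sup>)\<close> means to arrange all pairs of \<open>Z(c)\<close> and \<open>P(c)\<close> in the same order as the
  given member \<open>w\<^sub>0\<close>.  Relabelling by \<open>w\<^sub>0\<close> turns this order into the natural one.\<close>
lemma Fset_admissible:
  assumes c: "c \<in> cvecs k" and w0: "w0 \<in> Fset k lt r1 r2 c J" and w: "w \<in> signed_perms k"
  shows "w \<in> Fset k lt r1 r2 c J \<longleftrightarrow> w0 \<circ> inv w \<in> admissible k q q0 qk (gam lt c \<circ> inv w0)"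
proof -
  let ?g = "gam lt c"
  note wt = wtfun_gam[OF c, of lt] and sp = Fset_SP[OF w0]
  define bad where "bad a b \<longleftrightarrow> ?g a = ?g b \<or> adjc ?g a b" for a b
  have bad_sym: "bad a b \<longleftrightarrow> bad b a" for a b using adj_sym[OF wt] by (auto simp: bad_def)
  have f0: "fibre_sorted k ?g w0" "J = pair_roots k (\<lambda>a b. w0 a > w0 b \<and> adjc ?g a b)"
    using w0 Fset_iff[OF c] by auto
  have inv_neg: "w (- b) > w (- a) \<and> adjc ?g (- b) (- a)" if "w a > w b \<and> adjc ?g a b"
    "w \<in> signed_perms k" for w a b
    using that adj_neg[OF wt, of q q0 qk a b] by (simp add: sp_neg)
  have mem: "pair_root a b \<in> pair_roots k (\<lambda>a b. w a > w b \<and> adjc ?g a b) \<longleftrightarrow> w a > w b \<and> adjc ?g a b"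
    if "a \<in> idx k" "b \<in> idx k" "a < b" "w \<in> signed_perms k" for a b w
    using pair_roots_mem[of "\<lambda>a b. w a > w b \<and> adjc ?g a b", OF inv_neg, OF _ that(4) that(1-3)] by blast
  have lin: "w a < w b \<or> w b < w a" if "a \<noteq> b" "w \<in> signed_perms k" for w a b
    using that sp_eq_iff[of w k a b] by linarith
  have "w \<in> Fset k lt r1 r2 c J \<longleftrightarrow>
      (\<forall>a\<in>idx k. \<forall>b\<in>idx k. a < b \<and> bad a b \<longrightarrow> (w a < w b \<longleftrightarrow> w0 a < w0 b))" (is "_ \<longleftrightarrow> ?R")
  proof
    assume "w \<in> Fset k lt r1 r2 c J"
    then have f: "fibre_sorted k ?g w" "J = pair_roots k (\<lambda>a b. w a > w b \<and> adjc ?g a b)"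
      using Fset_iff[OF c] by auto
    show ?R
    proof (intro ballI impI)
      fix a b assume ab: "a \<in> idx k" "b \<in> idx k" "a < b \<and> bad a b"
      show "w a < w b \<longleftrightarrow> w0 a < w0 b"
      proof (cases "?g a = ?g b")
        case True
        then show ?thesis using f f0 ab unfolding fibre_sorted_def by blast
      next
        case False
        then have "adjc ?g a b" using ab by (simp add: bad_def)
        then have "w a > w b \<longleftrightarrow> w0 a > w0 b"
          using mem[of a b w] mem[of a b w0] ab w sp f(2) f0(2) by simp
        then show ?thesis using lin[of a b w] lin[of a b w0] w sp ab by auto
      qed
    qed
  next
    assume R: ?R
    have "fibre_sorted k ?g w"
      using R f0(1) unfolding fibre_sorted_def bad_def by blast
    moreover have "pair_roots k (\<lambda>a b. w a > w b \<and> adjc ?g a b) = pair_roots k (\<lambda>a b. w0 a > w0 b \<and> adjc ?g a b)"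
    proof -
      have "w a > w b \<longleftrightarrow> w0 a > w0 b" if "a \<in> idx k" "b \<in> idx k" "a < b" "adjc ?g a b" for a b
        using R that lin[of a b w] lin[of a b w0] w sp unfolding bad_def by (metis less_asym less_irrefl)
      then show ?thesis unfolding pair_roots_def by blast
    qed
    ultimately show "w \<in> Fset k lt r1 r2 c J" using Fset_iff[OF c] w f0(2) by blast
  qed
  also have "\<dots> \<longleftrightarrow> (\<forall>a\<in>idx k. \<forall>b\<in>idx k. w0 a < w0 b \<and> bad a b \<longrightarrow> w a < w b)"
    (is "_ \<longleftrightarrow> ?R'")
  proof
    assume R: ?R
    show ?R'
    proof (intro ballI impI)
      fix a b assume ab: "a \<in> idx k" "b \<in> idx k" "w0 a < w0 b \<and> bad a b"
      have "(a < b \<longrightarrow> (w a < w b \<longleftrightarrow> w0 a < w0 b)) \<and> (b < a \<longrightarrow> (w b < w a \<longleftrightarrow> w0 b < w0 a))"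
        using R ab bad_sym by blast
      then show "w a < w b" using ab lin[of a b w] w by (cases a b rule: linorder_cases) auto
    qed
  next
    assume R': ?R'
    show ?R
    proof (intro ballI impI)
      fix a b assume ab: "a \<in> idx k" "b \<in> idx k" "a < b \<and> bad a b"
      then have "w0 a < w0 b \<longrightarrow> w a < w b" "w0 b < w0 a \<longrightarrow> w b < w a" using R' bad_sym by blast+
      then show "w a < w b \<longleftrightarrow> w0 a < w0 b" using ab lin[of a b w0] sp by auto
    qed
  qed
  also have "\<dots> \<longleftrightarrow> (\<forall>a\<in>idx k. \<forall>b\<in>idx k. a < b \<and> bad (inv w0 a) (inv w0 b) \<longrightarrow> w (inv w0 a) < w (inv w0 b))"
  proof -
    have "inv w0 a \<in> idx k" "w0 a \<in> idx k" if "a \<in> idx k" for a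
      using that sp sp_inv[OF sp] by auto
    then show ?thesis using sp by (metis sp_inv_f sp_f_inv)
  qed
  also have "\<dots> \<longleftrightarrow> w0 \<circ> inv w \<in> admissible k q q0 qk (?g \<circ> inv w0)"
    using sp_comp[OF sp sp_inv[OF w]] inv_sp_comp[OF sp sp_inv[OF w]] w
    unfolding admissible_def bad_def by (simp add: adj_comp[OF sp_inv[OF sp]])
  finally show ?thesis .
qed

end

section \<open>The modules attached to skew local regions\<close>

lemma vector_space_fscale: "vector_space fscale"
  by unfold_locales (auto simp: fscale_def fun_eq_iff algebra_simps)

lemma fscale_apply: "fscale a f x = a * f x"
  by (simp add: fscale_def)

lemma sum_fun_apply: "(\<Sum>w\<in>F. g w) u = (\<Sum>w\<in>F. g w u :: complex)"
  by (induction F rule: infinite_finite_induct) auto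

lemma lin_ext_apply: "lin_ext F g f u = (\<Sum>w\<in>F. f w * g w u)"
  by (simp add: lin_ext_def sum_fun_apply fscale_apply)

lemma lin_ext_vsym:
  assumes "finite F"
  shows "lin_ext F g (vsym F w) = (if w \<in> F then g w else 0)"
proof
  fix u
  have "(\<Sum>w'\<in>F. vsym F w w' * g w' u) = (\<Sum>w'\<in>F. if w' = w then g w' u else 0)"
    by (rule sum.cong) (auto simp: vsym_def)
  also have "\<dots> = (if w \<in> F then g w else 0) u"
    using assms by (auto simp: sum.delta')
  finally show "lin_ext F g (vsym F w) u = (if w \<in> F then g w else 0) u"
    by (simp add: lin_ext_apply)
qed

context hecke_log
begin

lemma same_pow_act:
  assumes "w \<in> signed_perms k" "c \<in> cvecs k"
  shows "same_pow lt (act w c i) (act w c j) \<longleftrightarrow> gam lt c (inv w i) = gam lt c (inv w j)"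
    "same_pow lt (act w c i) (- act w c j) \<longleftrightarrow> gam lt c (inv w i) = gam lt c (inv w (- j))"
proof -
  show *: "same_pow lt (act w c i) (act w c j) \<longleftrightarrow> gam lt c (inv w i) = gam lt c (inv w j)" for i j
    by (auto simp: same_pow_def act_def gam_def)
  show "same_pow lt (act w c i) (- act w c j) \<longleftrightarrow> gam lt c (inv w i) = gam lt c (inv w (- j))"
    using *[of i "- j"] sp_neg[OF sp_inv[OF assms(1)], of j] assms(2) by (simp add: cvecs_def act_def)
qed

text \<open>The five conditions in the definition of skew local regions are the five kinds of equations
  that \<open>regular\<close> excludes.\<close>
lemma skew_iff:
  assumes c: "c \<in> cvecs k"
  shows "skew_local_region k lt r1 r2 c J \<longleftrightarrow> local_region k lt r1 r2 c J \<and>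
    (\<forall>w\<in>Fset k lt r1 r2 c J. regular (gam lt c \<circ> inv w))"
proof -
  have "(\<not> same_pow lt (act w c 1) (act w c (- 1)) \<and>
      (k \<ge> 2 \<longrightarrow> \<not> same_pow lt (act w c 2) (act w c (- 2)) \<and> \<not> same_pow lt (act w c 1) (- act w c 2)) \<and>
      (\<forall>i\<in>{1..int k - 1}. \<not> same_pow lt (act w c i) (act w c (i + 1))) \<and>
      (\<forall>i\<in>{1..int k - 2}. \<not> same_pow lt (act w c i) (act w c (i + 2))))
      \<longleftrightarrow> regular (gam lt c \<circ> inv w)" if w: "w \<in> signed_perms k" for w
  proof -
    let ?d = "gam lt c \<circ> inv w"
    have A: "(\<forall>i<k. ?d (lo i) \<noteq> ?d (hi i)) \<longleftrightarrow> ?d 1 \<noteq> ?d (- 1) \<and> (\<forall>i\<in>{1..int k - 1}. ?d i \<noteq> ?d (i + 1))"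
    proof (intro iffI conjI ballI allI impI)
      assume l: "\<forall>i<k. ?d (lo i) \<noteq> ?d (hi i)"
      have "?d (lo 0) \<noteq> ?d (hi 0)" using l k_pos by fastforce
      then show "?d 1 \<noteq> ?d (- 1)" unfolding lo_def hi_def by simp
      fix i assume i: "i \<in> {1..int k - 1}"
      then have "nat i < k" by auto
      with l have "?d (lo (nat i)) \<noteq> ?d (hi (nat i))" by blast
      then show "?d i \<noteq> ?d (i + 1)" using i by (simp add: lo_def hi_def)
    next
      fix i assume r: "?d 1 \<noteq> ?d (- 1) \<and> (\<forall>i\<in>{1..int k - 1}. ?d i \<noteq> ?d (i + 1))" and i: "i < k"
      show "?d (lo i) \<noteq> ?d (hi i)"
      proof (cases "i = 0")
        case True
        then show ?thesis using r by (auto simp: lo_def hi_def)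
      next
        case False
        then have "int i \<in> {1..int k - 1}" using i by auto
        then have "?d (int i) \<noteq> ?d (int i + 1)" using r by blast
        then show ?thesis using False by (simp add: lo_def hi_def)
      qed
    qed
    have B: "(\<forall>i. 1 \<le> i \<and> i + 2 \<le> k \<longrightarrow> ?d (int i) \<noteq> ?d (int i + 2)) \<longleftrightarrow>
        (\<forall>i\<in>{1..int k - 2}. ?d i \<noteq> ?d (i + 2))"
    proof (intro iffI ballI allI impI)
      fix i assume l: "\<forall>i. 1 \<le> i \<and> i + 2 \<le> k \<longrightarrow> ?d (int i) \<noteq> ?d (int i + 2)" and i: "i \<in> {1..int k - 2}"
      then have "1 \<le> nat i \<and> nat i + 2 \<le> k" by auto
      with l have "?d (int (nat i)) \<noteq> ?d (int (nat i) + 2)" by blast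
      then show "?d i \<noteq> ?d (i + 2)" using i by simp
    next
      fix i assume r: "\<forall>i\<in>{1..int k - 2}. ?d i \<noteq> ?d (i + 2)" and i: "1 \<le> i \<and> i + 2 \<le> k"
      then have "int i \<in> {1..int k - 2}" by auto
      then show "?d (int i) \<noteq> ?d (int i + 2)" using r by blast
    qed
    show ?thesis
      unfolding regular_def A B unfolding same_pow_act[OF w c] comp_apply by blast
  qed
  then show ?thesis
    unfolding skew_local_region_def Let_def using Fset_SP by (metis (no_types, lifting))
qed

end

locale skew_region = hecke_log k q q0 qk lt r1 r2 for k q q0 qk lt r1 r2 +
  fixes z :: complex and c :: "int \<Rightarrow> complex" and J :: "(int \<Rightarrow> real) set"
  assumes z: "z \<noteq> 0" and skew: "skew_local_region k lt r1 r2 c J"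
begin

abbreviation "F \<equiv> Fset k lt r1 r2 c J"
abbreviation "e \<equiv> vsym F"
abbreviation "H \<equiv> Hmod k q q0 qk lt r1 r2 z c J"

definition wt :: "(int \<Rightarrow> int) \<Rightarrow> int \<Rightarrow> complex" where
  "wt w = gam lt c \<circ> inv w"

definition wtW :: "nat \<Rightarrow> (int \<Rightarrow> int) \<Rightarrow> complex" where
  "wtW j w = (if j = 0 then z else wt w (int j))"

text \<open>The off-diagonal coefficient of \<open>T\<^sub>i\<close> at \<open>v\<^sub>w\<close>.\<close>
definition sq :: "nat \<Rightarrow> (int \<Rightarrow> int) \<Rightarrow> complex" where
  "sq i w = csqrt (rd i (wt w))"

lemma c: "c \<in> cvecs k"
  using skew by (simp add: skew_local_region_def local_region_def)

lemmas g = wtfun_gam[OF c, of lt]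

lemma F_SP: "w \<in> F \<Longrightarrow> w \<in> signed_perms k"
  by (rule Fset_SP)

lemma finite_F: "finite F"
  by (rule finite_subset[OF _ finite_sp[of k]]) (auto intro: F_SP)

lemma wt_wtfun: "w \<in> signed_perms k \<Longrightarrow> wtfun (wt w)"
  unfolding wt_def using wtfun_comp[OF g sp_inv] .

lemma wt_s: "w \<in> signed_perms k \<Longrightarrow> i < k \<Longrightarrow> wt (s i \<circ> w) = wt w \<circ> s i"
  unfolding wt_def by (simp add: inv_sp_comp[OF sp_sr] comp_assoc)

lemma s_SP: "w \<in> signed_perms k \<Longrightarrow> i < k \<Longrightarrow> s i \<circ> w \<in> signed_perms k"
  by (simp add: sp_comp sp_sr)

lemma wtW_nz: "w \<in> signed_perms k \<Longrightarrow> wtW j w \<noteq> 0"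
  using z wtfunD(2)[OF wt_wtfun] by (simp add: wtW_def)

lemma F_regular: "w \<in> F \<Longrightarrow> regular (wt w)"
  using skew unfolding skew_iff[OF c] wt_def by blast

lemma F_off_wall: "w \<in> F \<Longrightarrow> i < k \<Longrightarrow> wt w (lo i) \<noteq> wt w (hi i)"
  using F_regular unfolding regular_def by blast

text \<open>Between \<open>w\<close> and \<open>s\<^sub>i w\<close> only one hyperplane is crossed.  By regularity it does not belong to
  \<open>Z(c)\<close>, so the question is whether it belongs to \<open>P(c)\<close>.\<close>
lemma s_in_F:
  assumes w: "w \<in> F" and i: "i < k"
  shows "s i \<circ> w \<in> F \<longleftrightarrow> \<not> adjc (wt w) (lo i) (hi i)"
proof -
  note sp = F_SP[OF w] and off = F_off_wall[OF w i]
  note wtf = wt_wtfun[OF sp]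
  have "w \<circ> inv (s i \<circ> w) = s i"
    using inv_sp_comp[OF sp_sr[OF i] sp] sp by (simp add: fun_eq_iff)
  then have "s i \<circ> w \<in> F \<longleftrightarrow> s i \<in> admissible k q q0 qk (wt w)"
    using Fset_admissible[OF c w s_SP[OF sp i]] unfolding wt_def by simp
  also have "\<dots> \<longleftrightarrow> \<not> adjc (wt w) (lo i) (hi i)"
  proof
    assume adm: "s i \<in> admissible k q q0 qk (wt w)"
    show "\<not> adjc (wt w) (lo i) (hi i)"
    proof
      assume adj: "adjc (wt w) (lo i) (hi i)"
      have "\<forall>a\<in>idx k. \<forall>b\<in>idx k. a < b \<and> (wt w a = wt w b \<or> adjc (wt w) a b) \<longrightarrow> s i a < s i b"
        using adm unfolding admissible_def inv_sr mem_Collect_eq by (elim conjE)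
      from this[THEN bspec, THEN bspec, of "lo i" "hi i"] show False
        using lo_hi_idx[OF i] lo_less_hi[of i] adj by simp
    qed
  next
    assume na: "\<not> adjc (wt w) (lo i) (hi i)"
    have "s i a < s i b" if ab: "a \<in> idx k" "b \<in> idx k" "a < b" "wt w a = wt w b \<or> adjc (wt w) a b" for a b
    proof (rule ccontr)
      assume "\<not> ?thesis"
      then have "a = lo i \<and> b = hi i \<or> a = - hi i \<and> b = - lo i"
        using sr_less[of a b i] ab idx_nonzero by blast
      then show False
        using ab(4) na off wtfunD(1)[OF wtf] adj_neg[OF wtf, of q q0 qk a b] by auto
    qed
    then show "s i \<in> admissible k q q0 qk (wt w)" using sp_sr[OF i] by (simp add: admissible_def)
  qed
  finally show ?thesis .
qed

text \<open>This makes the convention \<open>v\<^sub>w = 0\<close> outside \<open>\<F>\<close> consistent with the quadratic and braid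
  relations: exactly the coefficients across the boundary of \<open>\<F>\<close> vanish.\<close>
lemma sq_eq_0_iff:
  assumes w: "w \<in> F" and i: "i < k"
  shows "sq i w = 0 \<longleftrightarrow> s i \<circ> w \<notin> F"
  using rad_eq_0_iff[OF wt_wtfun[OF F_SP[OF w]] F_off_wall[OF w i] nonzero] s_in_F[OF w i]
  by (simp add: sq_def)

lemma H_simps:
  "hscl H = fscale" "hcar H = module.span fscale (e ` F)"
  "hW H j = lin_ext F (\<lambda>w. fscale (wtW j w) (e w))"
  by (simp_all add: Hmod_def Let_def wtW_def wt_def comp_def if_distrib cong: if_cong)

lemma H_T:
  "hT H i = lin_ext F (\<lambda>w. fscale (dc i (wt w)) (e w) + fscale (sq i w) (e (s i \<circ> w)))"
proof -
  have "Tdiag q q0 qk lt c i w = dc i (wt w)" for w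
    by (simp add: Tdiag_def dcoef_def wt_def)
  then show ?thesis
    by (simp add: Hmod_def Let_def sq_def rad_def par_def)
qed

sublocale lin_space H
proof (rule lin_space.intro)
  show "vector_space (hscl H)" using vector_space_fscale by (simp add: H_simps)
  then interpret vector_space "hscl H" .
  show "module.subspace (hscl H) (hcar H)" unfolding H_simps(2) H_simps(1)[symmetric] by (rule subspace_span)
qed

notation scl (infixr "\<cdot>" 75)

lemma H_car: "hcar H = span (e ` F)"
  by (simp add: H_simps)

lemma e_car [simp]: "e w \<in> hcar H"
  by (cases "w \<in> F") (auto simp: H_car vsym_def span_base span_zero)

lemma e_notin: "w \<notin> F \<Longrightarrow> e w = 0"
  by (simp add: vsym_def)

lemma T_e: "w \<in> F \<Longrightarrow> hT H i (e w) = dc i (wt w) \<cdot> e w + sq i w \<cdot> e (s i \<circ> w)"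
  unfolding H_T lin_ext_vsym[OF finite_F] by (simp add: H_simps(1))

lemma W_e: "hW H j (e w) = wtW j w \<cdot> e w"
  unfolding H_simps(3) lin_ext_vsym[OF finite_F] by (simp add: H_simps(1) e_notin fscale_def fun_eq_iff)

lemma linear_endo_lin_ext:
  assumes "\<And>w. w \<in> F \<Longrightarrow> h w \<in> hcar H"
  shows "linear_endo H (lin_ext F h)"
  unfolding linear_endo_def
proof (intro conjI ballI allI)
  show "lin_ext F h x \<in> hcar H" for x
    unfolding lin_ext_def using sub assms by (intro subspace_sum[OF sub]) (simp add: H_simps(1)[symmetric])
  show "lin_ext F h (x + y) = lin_ext F h x + lin_ext F h y" for x y
    by (rule ext) (simp add: lin_ext_apply distrib_right sum.distrib)
  show "lin_ext F h (a \<cdot> x) = a \<cdot> lin_ext F h x" for a x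
    by (rule ext) (simp add: lin_ext_apply H_simps(1) fscale_apply sum_distrib_left mult.assoc)
qed

lemma HT_lin: "linear_endo H (hT H i)"
  unfolding H_T by (rule linear_endo_lin_ext) (simp add: H_simps(1)[symmetric])

lemma HW_lin: "linear_endo H (hW H j)"
  unfolding H_simps(3) by (rule linear_endo_lin_ext) (simp add: H_simps(1)[symmetric])

lemma endo_eqI:
  assumes "linear_endo H f" "linear_endo H h" "\<And>w. w \<in> F \<Longrightarrow> f (e w) = h (e w)" "x \<in> hcar H"
  shows "f x = h x"
  by (rule linear_endo_eq_on_span[OF assms(1,2), of "e ` F"]) (use assms in \<open>auto simp: H_car[symmetric]\<close>)

lemma TT_e:
  assumes w: "w \<in> F" and i: "i < k"
  shows "hT H i (hT H i (e w)) = (pr i - inverse (pr i)) \<cdot> hT H i (e w) + e w"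
proof -
  note lin = linear_endoD[OF HT_lin]
  let ?d = "dc i (wt w)" and ?r = "sq i w" and ?h = "pr i - inverse (pr i)"
  have r2: "?r * ?r = - ?d\<^sup>2 + ?h * ?d + 1"
    unfolding sq_def rad_eq[OF pr_nz, symmetric] by (simp flip: power2_eq_square)
  have e': "?r \<cdot> hT H i (e (s i \<circ> w)) = (?r * (?h - ?d)) \<cdot> e (s i \<circ> w) + (?r * ?r) \<cdot> e w"
  proof (cases "?r = 0")
    case False
    then have sw: "s i \<circ> w \<in> F" using sq_eq_0_iff[OF w i] by blast
    have ss: "s i \<circ> (s i \<circ> w) = w" by (simp add: fun_eq_iff)
    have "dc i (wt (s i \<circ> w)) = ?h - ?d"
      using dcoef_sum[OF wt_wtfun[OF F_SP[OF w]] F_off_wall[OF w i], of q q0 qk]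
      unfolding wt_s[OF F_SP[OF w] i] by (simp add: algebra_simps)
    moreover have "sq i (s i \<circ> w) = ?r"
      unfolding sq_def wt_s[OF F_SP[OF w] i]
      using rad_refl[OF wt_wtfun[OF F_SP[OF w]] F_off_wall[OF w i]] by simp
    ultimately show ?thesis using T_e[OF sw, of i] unfolding ss by (simp add: scale_right_distrib)
  qed simp
  have "hT H i (hT H i (e w)) = ?d \<cdot> hT H i (e w) + ?r \<cdot> hT H i (e (s i \<circ> w))"
    by (subst T_e[OF w]) (simp add: lin)
  also have "\<dots> = (?d * ?d + ?r * ?r) \<cdot> e w + (?h * ?r) \<cdot> e (s i \<circ> w)"
    unfolding e' T_e[OF w]
    by (simp add: scale_right_distrib scale_left_distrib scale_right_diff_distrib scale_left_diff_distrib
        algebra_simps)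
  also have "\<dots> = (?h * ?d + 1) \<cdot> e w + (?h * ?r) \<cdot> e (s i \<circ> w)"
  proof -
    have "?d * ?d + ?r * ?r = ?h * ?d + 1" unfolding r2 by (simp add: power2_eq_square)
    then show ?thesis by (simp only:)
  qed
  also have "\<dots> = ?h \<cdot> (?d \<cdot> e w + ?r \<cdot> e (s i \<circ> w)) + e w"
    by (simp only: scale_right_distrib scale_left_distrib scale_scale scale_one add_ac)
  finally show ?thesis unfolding T_e[OF w] .
qed

lemma TT_H:
  assumes i: "i < k" and x: "x \<in> hcar H"
  shows "hT H i (hT H i x) = (pr i - inverse (pr i)) \<cdot> hT H i x + x"
  by (rule endo_eqI[OF linear_endo_intros(1)[OF HT_lin HT_lin]
        linear_endo_intros(2)[OF linear_endo_intros(3)[OF HT_lin HT_lin] linear_endo_ident]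
        TT_e[OF _ i] x])

lemma quadratic_H: "i < k \<Longrightarrow> quadratic_rel H (hT H i) (pr i)"
  using pr_nz[of i]
  by (auto simp: quadratic_rel_def Let_def linear_endoD[OF HT_lin] TT_H scale_right_distrib
      scale_left_diff_distrib algebra_simps)

sublocale quad_mod k q q0 qk H
  by unfold_locales (auto simp: HT_lin quadratic_H)

text \<open>In the seminormal basis \<open>\<tau>\<^sub>i v\<^sub>w\<close> is the square root times \<open>v\<^bsub>s\<^sub>i w\<^esub>\<close>.  The coefficient \<open>a\<close>, which
  vanishes as soon as \<open>w\<close> has left \<open>\<F>\<close>, makes the formula applicable along a whole word.\<close>
lemma tau_e:
  assumes w: "w \<in> signed_perms k" and i: "i < k" and a: "w \<notin> F \<Longrightarrow> a = 0"
  shows "tau i (wt w) (a \<cdot> e w) = (a * sq i w) \<cdot> e (s i \<circ> w) \<and> (s i \<circ> w \<notin> F \<longrightarrow> a * sq i w = 0)"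
proof (cases "w \<in> F")
  case True
  then show ?thesis
    using T_e[OF True, of i] sq_eq_0_iff[OF True i] linear_endoD(3)[OF HT_lin[of i], of "e w" a]
    by (auto simp: tau_def scale_right_distrib mult.commute)
next
  case False
  then show ?thesis using a i by simp
qed

lemma tau_e2:
  assumes w: "w \<in> F" and i: "i < k" "j < k"
  shows "tau j (wt w \<circ> s i) (tau i (wt w) (e w)) = (sq i w * sq j (s i \<circ> w)) \<cdot> e (s j \<circ> (s i \<circ> w)) \<and>
    (s j \<circ> (s i \<circ> w) \<notin> F \<longrightarrow> sq i w * sq j (s i \<circ> w) = 0)"
  using tau_e[OF F_SP[OF w] i(1), of 1] w tau_e[OF s_SP[OF F_SP[OF w] i(1)] i(2), of "sq i w"]
  by (simp add: wt_s[OF F_SP[OF w] i(1)])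

lemma tau_e3:
  assumes w: "w \<in> F" and i: "i < k" "j < k" "l < k"
  shows "tau l (wt w \<circ> s i \<circ> s j) (tau j (wt w \<circ> s i) (tau i (wt w) (e w)))
      = (sq i w * sq j (s i \<circ> w) * sq l (s j \<circ> (s i \<circ> w))) \<cdot> e (s l \<circ> (s j \<circ> (s i \<circ> w))) \<and>
    (s l \<circ> (s j \<circ> (s i \<circ> w)) \<notin> F \<longrightarrow> sq i w * sq j (s i \<circ> w) * sq l (s j \<circ> (s i \<circ> w)) = 0)"
proof -
  note sp = F_SP[OF w] s_SP[OF F_SP[OF w] i(1)]
  have "wt (s j \<circ> (s i \<circ> w)) = wt w \<circ> s i \<circ> s j" by (simp only: wt_s[OF sp(2) i(2)] wt_s[OF sp(1) i(1)])
  then show ?thesis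
    using tau_e2[OF w i(1,2)] tau_e[OF s_SP[OF sp(2) i(2)] i(3), of "sq i w * sq j (s i \<circ> w)"] by simp
qed

lemma tau_e4:
  assumes w: "w \<in> F" and i: "i < k" "j < k"
  shows "tau j (wt w \<circ> s i \<circ> s j \<circ> s i) (tau i (wt w \<circ> s i \<circ> s j) (tau j (wt w \<circ> s i) (tau i (wt w) (e w))))
      = (sq i w * sq j (s i \<circ> w) * sq i (s j \<circ> (s i \<circ> w)) * sq j (s i \<circ> (s j \<circ> (s i \<circ> w))))
        \<cdot> e (s j \<circ> (s i \<circ> (s j \<circ> (s i \<circ> w))))"
proof -
  note sp = F_SP[OF w] s_SP[OF F_SP[OF w] i(1)] s_SP[OF s_SP[OF F_SP[OF w] i(1)] i(2)]
  have "wt (s i \<circ> (s j \<circ> (s i \<circ> w))) = wt w \<circ> s i \<circ> s j \<circ> s i"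
    by (simp only: wt_s[OF sp(3) i(1)] wt_s[OF sp(2) i(2)] wt_s[OF sp(1) i(1)])
  then show ?thesis
    using tau_e3[OF w i(1,2,1)]
      tau_e[OF s_SP[OF sp(3) i(1)] i(2), of "sq i w * sq j (s i \<circ> w) * sq i (s j \<circ> (s i \<circ> w))"] by simp
qed

text \<open>The two longest words of intertwining operators agree on \<open>v\<^sub>w\<close>: the products of the square roots
  along them are equal, because both words cross the same walls.\<close>
lemma braid_e_A:
  assumes w: "w \<in> F" and i: "1 \<le> i" "i + 1 < k"
  shows "hT H i (hT H (i+1) (hT H i (e w))) = hT H (i+1) (hT H i (hT H (i+1) (e w)))"
proof -
  have ij: "i < k" "i + 1 < k" using i by auto
  note sp = F_SP[OF w]
  note wt2 = wt_s[OF s_SP[OF sp ij(1)] ij(2)] wt_s[OF s_SP[OF sp ij(2)] ij(1)] wt_s[OF sp ij(1)] wt_s[OF sp ij(2)]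
  have pr: "pr i = pr (i + 1)" using i by (simp add: par_def)
  have rd: "rd i (wt w \<circ> s (i+1)) = rd (i+1) (wt w \<circ> s i)" "rd i (wt w \<circ> s i \<circ> s (i+1)) = rd (i+1) (wt w)"
    "rd (i+1) (wt w \<circ> s (i+1) \<circ> s i) = rd i (wt w)"
    using braid_dc_A[OF i(1), of "wt w"] by (auto intro: rd_cong simp: pr)
  have word: "s i \<circ> (s (i+1) \<circ> (s i \<circ> w)) = s (i+1) \<circ> (s i \<circ> (s (i+1) \<circ> w))"
    by (simp add: fun_eq_iff braid_refl_A(1)[OF i(1)])
  have sqs: "sq i w * sq (i+1) (s i \<circ> w) * sq i (s (i+1) \<circ> (s i \<circ> w))
      = sq (i+1) w * sq i (s (i+1) \<circ> w) * sq (i+1) (s i \<circ> (s (i+1) \<circ> w))"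
    unfolding sq_def wt2 rd by (simp add: mult_ac)
  have "hT H i (hT H (i+1) (hT H i (e w))) - hT H (i+1) (hT H i (hT H (i+1) (e w))) = 0"
    unfolding braid_tau_A[OF i wt_wtfun[OF sp] F_regular[OF w] e_car]
      tau_e3[OF w ij(1) ij(2) ij(1), THEN conjunct1] tau_e3[OF w ij(2) ij(1) ij(2), THEN conjunct1]
      word sqs by (rule diff_self)
  then show ?thesis by (simp only: right_minus_eq)
qed

lemma braid_e_B:
  assumes w: "w \<in> F" and k2: "2 \<le> k"
  shows "hT H 0 (hT H 1 (hT H 0 (hT H 1 (e w)))) = hT H 1 (hT H 0 (hT H 1 (hT H 0 (e w))))"
proof -
  have ij: "0 < k" "1 < k" using k2 by auto
  note sp = F_SP[OF w]
  note sp2 = s_SP[OF sp ij(1)] s_SP[OF sp ij(2)]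
  note sp3 = s_SP[OF sp2(1) ij(2)] s_SP[OF sp2(2) ij(1)]
  note wt2 = wt_s[OF sp3(1) ij(1)] wt_s[OF sp3(2) ij(2)]
    wt_s[OF sp2(1) ij(2)] wt_s[OF sp2(2) ij(1)] wt_s[OF sp ij(1)] wt_s[OF sp ij(2)]
  have rd: "rd 1 (wt w \<circ> s 1 \<circ> s 0) = rd 1 (wt w \<circ> s 0)" "rd 0 (wt w \<circ> s 0 \<circ> s 1) = rd 0 (wt w \<circ> s 1)"
    "rd 0 (wt w \<circ> s 1 \<circ> s 0 \<circ> s 1) = rd 0 (wt w)" "rd 1 (wt w \<circ> s 0 \<circ> s 1 \<circ> s 0) = rd 1 (wt w)"
    using braid_dc_B[OF wt_wtfun[OF sp]] by (auto intro: rd_cong)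
  have word: "s 0 \<circ> (s 1 \<circ> (s 0 \<circ> (s 1 \<circ> w))) = s 1 \<circ> (s 0 \<circ> (s 1 \<circ> (s 0 \<circ> w)))"
    by (simp add: fun_eq_iff braid_refl_B(1))
  have sqs: "sq 1 w * sq 0 (s 1 \<circ> w) * sq 1 (s 0 \<circ> (s 1 \<circ> w)) * sq 0 (s 1 \<circ> (s 0 \<circ> (s 1 \<circ> w)))
      = sq 0 w * sq 1 (s 0 \<circ> w) * sq 0 (s 1 \<circ> (s 0 \<circ> w)) * sq 1 (s 0 \<circ> (s 1 \<circ> (s 0 \<circ> w)))"
    unfolding sq_def wt2 rd by (simp add: mult_ac)
  have "hT H 0 (hT H 1 (hT H 0 (hT H 1 (e w)))) - hT H 1 (hT H 0 (hT H 1 (hT H 0 (e w)))) = 0"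
    unfolding braid_tau_B[OF k2 wt_wtfun[OF sp] F_regular[OF w] e_car]
      tau_e4[OF w ij] tau_e4[OF w ij(2) ij(1)] word sqs by (rule diff_self)
  then show ?thesis by (simp only: right_minus_eq)
qed

lemma commute_e:
  assumes w: "w \<in> F" and ij: "i < k" "j < k" "i + 2 \<le> j"
  shows "hT H i (hT H j (e w)) = hT H j (hT H i (e w))"
proof -
  note sp = F_SP[OF w] and cr = commute_refl[OF ij(3)]
  have ex: "hT H m (hT H l (e w)) = (dc l (wt w) * dc m (wt w)) \<cdot> e w + (dc l (wt w) * sq m w) \<cdot> e (s m \<circ> w)
      + (sq l w * dc m (wt w)) \<cdot> e (s l \<circ> w) + (sq l w * sq m w) \<cdot> e (s m \<circ> (s l \<circ> w))"
    if l: "l < k" and d: "dc m (wt w \<circ> s l) = dc m (wt w)" and m: "m < k" for l m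
  proof -
    have d': "dc m (wt (s l \<circ> w)) = dc m (wt w)" using d wt_s[OF sp l] by simp
    then have r': "sq m (s l \<circ> w) = sq m w" unfolding sq_def by (auto intro: arg_cong[where f = csqrt] rd_cong)
    have "sq l w \<cdot> hT H m (e (s l \<circ> w))
        = (sq l w * dc m (wt w)) \<cdot> e (s l \<circ> w) + (sq l w * sq m w) \<cdot> e (s m \<circ> (s l \<circ> w))"
    proof (cases "sq l w = 0")
      case False
      then have "s l \<circ> w \<in> F" using sq_eq_0_iff[OF w l] by blast
      from T_e[OF this, of m] show ?thesis by (simp add: d' r' scale_right_distrib)
    qed simp
    moreover have "hT H m (hT H l (e w)) = hT H m (dc l (wt w) \<cdot> e w + sq l w \<cdot> e (s l \<circ> w))"
      using T_e[OF w, of l] by (rule arg_cong)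
    moreover have "\<dots> = dc l (wt w) \<cdot> hT H m (e w) + sq l w \<cdot> hT H m (e (s l \<circ> w))"
      by (simp add: linear_endoD[OF HT_lin])
    ultimately show ?thesis using T_e[OF w, of m] by (simp add: scale_right_distrib)
  qed
  have "dc i (wt w \<circ> s j) = dc i (wt w)" "dc j (wt w \<circ> s i) = dc j (wt w)"
    using cr by (auto intro: dc_cong)
  moreover have "s i \<circ> (s j \<circ> w) = s j \<circ> (s i \<circ> w)" by (simp add: fun_eq_iff cr)
  ultimately show ?thesis using ex[of j i] ex[of i j] ij by (simp add: mult_ac)
qed

text \<open>The inverse of \<open>W\<^sub>j\<close>.\<close>
definition V :: "nat \<Rightarrow> ((int \<Rightarrow> int) \<Rightarrow> complex) \<Rightarrow> (int \<Rightarrow> int) \<Rightarrow> complex" where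
  "V j = lin_ext F (\<lambda>w. inverse (wtW j w) \<cdot> e w)"

lemma V_lin: "linear_endo H (V j)"
  unfolding V_def by (rule linear_endo_lin_ext) simp

lemma V_e: "V j (e w) = inverse (wtW j w) \<cdot> e w"
  unfolding V_def lin_ext_vsym[OF finite_F] by (simp add: e_notin)

lemma WV:
  assumes "x \<in> hcar H"
  shows "hW H j (V j x) = x" "V j (hW H j x) = x"
proof -
  show "hW H j (V j x) = x"
    by (rule endo_eqI[OF linear_endo_intros(1)[OF HW_lin V_lin] linear_endo_ident _ assms])
       (simp add: V_e W_e linear_endoD(3)[OF HW_lin] wtW_nz[OF F_SP])
  show "V j (hW H j x) = x"
    by (rule endo_eqI[OF linear_endo_intros(1)[OF V_lin HW_lin] linear_endo_ident _ assms])
       (simp add: V_e W_e linear_endoD(3)[OF V_lin] wtW_nz[OF F_SP])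
qed

lemma W_bij: "bij_betw (hW H j) (hcar H) (hcar H)"
  by (rule bij_betwI[where g = "V j"]) (auto simp: WV linear_endoD[OF HW_lin] linear_endoD[OF V_lin])

lemma hWinv_V: "x \<in> hcar H \<Longrightarrow> hWinv H j x = V j x"
  unfolding hWinv_def using W_bij[of j]
  by (intro inv_into_f_eq) (auto simp: bij_betw_def WV linear_endoD[OF V_lin])

lemma WT_e:
  assumes w: "w \<in> F" and i: "i < k"
  shows "hW H j (hT H i (e w)) = (dc i (wt w) * wtW j w) \<cdot> e w + (sq i w * wtW j (s i \<circ> w)) \<cdot> e (s i \<circ> w)"
    "hT H i (hW H j (e w)) = (wtW j w * dc i (wt w)) \<cdot> e w + (wtW j w * sq i w) \<cdot> e (s i \<circ> w)"
    "V j (hT H i (e w)) = (dc i (wt w) * inverse (wtW j w)) \<cdot> e w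
       + (sq i w * inverse (wtW j (s i \<circ> w))) \<cdot> e (s i \<circ> w)"
  using T_e[OF w, of i]
  by (simp_all add: W_e V_e linear_endoD[OF HW_lin] linear_endoD[OF HT_lin] linear_endoD[OF V_lin]
      scale_right_distrib)

lemma wtW_s: "w \<in> signed_perms k \<Longrightarrow> i < k \<Longrightarrow> j \<noteq> 0 \<Longrightarrow> wtW j (s i \<circ> w) = wt w (s i (int j))"
  by (simp add: wtW_def wt_s)

lemma WT_commute_e:
  assumes w: "w \<in> F" and i: "i < k" and j: "j = 0 \<or> s i (int j) = int j"
  shows "hW H j (hT H i (e w)) = hT H i (hW H j (e w))"
proof -
  have "wtW j (s i \<circ> w) = wtW j w"
    using j wtW_s[OF F_SP[OF w] i, of j] by (cases "j = 0") (auto simp: wtW_def)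
  then show ?thesis unfolding WT_e[OF w i] by (simp add: mult.commute)
qed

lemma cross_e:
  assumes w: "w \<in> F" and i: "1 \<le> i" "i < k"
  shows "hT H i (hW H i (e w)) = hW H (i+1) (hT H i (e w)) + (q - inverse q) \<cdot> (- hW H (i+1) (e w))"
    "hT H i (hW H (i+1) (e w)) = hW H i (hT H i (e w)) + (q - inverse q) \<cdot> hW H (i+1) (e w)"
proof -
  note sp = F_SP[OF w]
  have val: "wtW i w = wt w (int i)" "wtW (i+1) w = wt w (int i + 1)"
    "wtW i (s i \<circ> w) = wt w (int i + 1)" "wtW (i+1) (s i \<circ> w) = wt w (int i)"
    using i wtW_s[OF sp i(2), of i] wtW_s[OF sp i(2), of "i+1"] by (auto simp: wtW_def s_eval add.commute)
  have m: "dc i (wt w) * (wt w (int i + 1) - wt w (int i)) = (q - inverse q) * wt w (int i + 1)"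
    using dcoef_pos_mult(1)[OF wt_wtfun[OF sp] _ F_off_wall[OF w i(2)]] i by simp
  have x: "wt w (int i) * dc i (wt w) = dc i (wt w) * wt w (int i + 1) - (q - inverse q) * wt w (int i + 1)"
    using m by (simp add: algebra_simps)
  have y: "wt w (int i + 1) * dc i (wt w) = dc i (wt w) * wt w (int i) + (q - inverse q) * wt w (int i + 1)"
    using m by (simp add: algebra_simps)
  show "hT H i (hW H i (e w)) = hW H (i+1) (hT H i (e w)) + (q - inverse q) \<cdot> (- hW H (i+1) (e w))"
    unfolding WT_e[OF w i(2)] unfolding W_e val x
    by (simp add: scale_left_diff_distrib mult.commute)
  show "hT H i (hW H (i+1) (e w)) = hW H i (hT H i (e w)) + (q - inverse q) \<cdot> hW H (i+1) (e w)"
    unfolding WT_e[OF w i(2)] unfolding W_e val y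
    by (simp add: scale_left_distrib mult.commute)
qed

lemma cross_e_0:
  assumes w: "w \<in> F"
  shows "hT H 0 (hW H 1 (e w)) = V 1 (hT H 0 (e w)) + (q0 - inverse q0) \<cdot> hW H 1 (e w)
      + (qk - inverse qk) \<cdot> V 1 (hW H 1 (e w))"
proof -
  note sp = F_SP[OF w] and k0 = k_pos[THEN less_le_trans[OF zero_less_one]]
  let ?x = "wt w 1"
  have nz: "?x \<noteq> 0" using wtfunD(2)[OF wt_wtfun[OF sp]] .
  have val: "wtW 1 w = ?x" "wtW 1 (s 0 \<circ> w) = inverse ?x"
    using wtW_s[OF sp k0, of 1] wtfunD(1)[OF wt_wtfun[OF sp], of 1]
    by (auto simp: wtW_def s_eval)
  have "dc 0 (wt w) * (?x\<^sup>2 - 1) = ?x * ((q0 - inverse q0) * ?x + (qk - inverse qk))"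
    using dcoef_0_mult(1)[OF wt_wtfun[OF sp] F_off_wall[OF w k0]] .
  then have "?x * (?x * dc 0 (wt w))
      = ?x * (dc 0 (wt w) * inverse ?x + (q0 - inverse q0) * ?x + (qk - inverse qk))"
    using nz by (simp add: distrib_left) (simp add: algebra_simps power2_eq_square)
  then have x: "?x * dc 0 (wt w) = dc 0 (wt w) * inverse ?x + (q0 - inverse q0) * ?x + (qk - inverse qk)"
    using nz by simp
  show ?thesis
    unfolding WT_e[OF w k0] unfolding W_e linear_endoD(3)[OF V_lin e_car] V_e val x
    using nz by (simp add: scale_left_distrib scale_scale mult.commute[of "sq 0 w"])
qed

lemma hecke_H: "hecke_module k q q0 qk H"
  unfolding hecke_module_def
proof (intro conjI ballI allI impI)
  note T = HT_lin and W = HW_lin and o = linear_endo_intros(1)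
  fix x assume x: "x \<in> hcar H"
  show "hW H 0 (hT H i x) = hT H i (hW H 0 x)" if "i < k" for i
    by (rule endo_eqI[OF o[OF W T] o[OF T W] _ x]) (use WT_commute_e that in blast)
  show "hT H 0 (hT H 1 (hT H 0 (hT H 1 x))) = hT H 1 (hT H 0 (hT H 1 (hT H 0 x)))" if "2 \<le> k"
    by (rule endo_eqI[OF o[OF T o[OF T o[OF T T]]] o[OF T o[OF T o[OF T T]]] braid_e_B[OF _ that] x])
  show "hT H i (hT H (i + 1) (hT H i x)) = hT H (i + 1) (hT H i (hT H (i + 1) x))"
    if "1 \<le> i \<and> i + 1 < k" for i
    by (rule endo_eqI[OF o[OF T o[OF T T]] o[OF T o[OF T T]] _ x]) (use braid_e_A that in blast)
  show "hT H i (hT H j x) = hT H j (hT H i x)" if "i < k" "j < k" "i + 2 \<le> j" for i j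
    by (rule endo_eqI[OF o[OF T T] o[OF T T] commute_e[OF _ that] x])
  show "hW H i (hW H j x) = hW H j (hW H i x)" for i j
    by (rule endo_eqI[OF o[OF W W] o[OF W W] _ x]) (simp add: W_e linear_endoD[OF W] mult.commute)
  show "hT H 0 (hW H j x) = hW H j (hT H 0 x)" if "j \<le> k" "j \<noteq> 1" for j
  proof (rule endo_eqI[OF o[OF T W] o[OF W T] _ x])
    show "hT H 0 (hW H j (e w)) = hW H j (hT H 0 (e w))" if "w \<in> F" for w
      by (rule WT_commute_e[symmetric, OF that]) (use k_pos \<open>j \<noteq> 1\<close> in \<open>auto simp: s_eval\<close>)
  qed
  show "hT H i (hW H j x) = hW H j (hT H i x)"
    if "1 \<le> i \<and> i < k \<and> j \<le> k \<and> j \<noteq> i \<and> j \<noteq> i + 1" for i j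
  proof (rule endo_eqI[OF o[OF T W] o[OF W T] _ x])
    show "hT H i (hW H j (e w)) = hW H j (hT H i (e w))" if "w \<in> F" for w
      by (rule WT_commute_e[symmetric, OF that])
         (use \<open>1 \<le> i \<and> i < k \<and> j \<le> k \<and> j \<noteq> i \<and> j \<noteq> i + 1\<close> in \<open>auto simp: s_eval\<close>)
  qed
  show "hT H i (hW H i x) = hW H (i + 1) (hT H i x) + hscl H (q - inverse q) (- hW H (i + 1) x)"
    if "1 \<le> i \<and> i < k" for i
    by (rule endo_eqI[OF o[OF T W] linear_endo_intros(2)[OF o[OF W T]
          linear_endo_intros(3)[OF linear_endo_intros(4)[OF W W] W]] _ x]) (use cross_e(1) that in blast)
  show "hT H i (hW H (i + 1) x) = hW H i (hT H i x) + hscl H (q - inverse q) (hW H (i + 1) x)"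
    if "1 \<le> i \<and> i < k" for i
    by (rule endo_eqI[OF o[OF T W] linear_endo_intros(2)[OF o[OF W T] linear_endo_intros(3)[OF W W]] _ x])
       (use cross_e(2) that in blast)
  have "hT H 0 (hW H 1 x) = V 1 (hT H 0 x) + (q0 - inverse q0) \<cdot> hW H 1 x
      + (qk - inverse qk) \<cdot> V 1 (hW H 1 x)"
    by (rule endo_eqI[OF o[OF T W] linear_endo_intros(2)[OF linear_endo_intros(2)[OF o[OF V_lin T]
          linear_endo_intros(3)[OF W W]] linear_endo_intros(3)[OF o[OF V_lin W] W]] cross_e_0 x])
  then show "hT H 0 (hW H 1 x) = hWinv H 1 (hT H 0 x) + hscl H (q0 - inverse q0) (hW H 1 x)
      + hscl H (qk - inverse qk) (hWinv H 1 (hW H 1 x))"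
    using hWinv_V linear_endoD(1)[OF T x] linear_endoD(1)[OF W x] by simp
next
  show "quadratic_rel H (hT H 0) q0" using quadratic_H[of 0] k_pos by (simp add: par_def)
  show "quadratic_rel H (hT H i) q" if "1 \<le> i \<and> i < k" for i
    using quadratic_H[of i] that by (simp add: par_def)
qed (use vs sub HT_lin HW_lin W_bij in blast)+

sublocale hecke_mod k q q0 qk H
  by unfold_locales (rule hecke_H)

lemma H_apply:
  assumes "x \<in> hcar H"
  shows "x = (\<Sum>w\<in>F. x w \<cdot> e w)" "w \<notin> F \<Longrightarrow> x w = 0"
proof -
  have sup: "x w = 0" if "w \<notin> F" for w
  proof -
    have "span (e ` F) \<subseteq> {x. x w = 0}"
    proof (rule span_minimal)
      show "e ` F \<subseteq> {x. x w = 0}" using that by (auto simp: vsym_def)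
      show "subspace {x. x w = 0}" by (rule subspaceI) (auto simp: H_simps(1) fscale_def)
    qed
    then show ?thesis using assms H_car by blast
  qed
  then show "w \<notin> F \<Longrightarrow> x w = 0" by blast
  show "x = (\<Sum>w\<in>F. x w \<cdot> e w)"
  proof
    fix u
    have "(\<Sum>w\<in>F. x w \<cdot> e w) u = (\<Sum>w\<in>F. if w = u then x w else 0)"
      by (simp add: sum_fun_apply H_simps(1) fscale_apply) (auto intro: sum.cong simp: vsym_def)
    also have "\<dots> = x u" using sup finite_F by (auto simp: sum.delta)
    finally show "x u = (\<Sum>w\<in>F. x w \<cdot> e w) u" by simp
  qed
qed

lemma e_nz: "w \<in> F \<Longrightarrow> e w \<noteq> 0"
  by (auto simp: vsym_def fun_eq_iff)

lemma e_inj: "inj_on e F"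
proof (rule inj_onI)
  fix w w' assume "w \<in> F" "w' \<in> F" "e w = e w'"
  have "e w w = e w' w" by (rule fun_cong[OF \<open>e w = e w'\<close>])
  then show "w = w'" using \<open>w \<in> F\<close> \<open>w' \<in> F\<close> by (simp add: vsym_def split: if_splits)
qed

lemma calibrated_H: "calibrated k H"
proof -
  have "independent (e ` F)"
  proof
    assume "dependent (e ` F)"
    then have "\<exists>u. (\<exists>x\<in>e ` F. u x \<noteq> 0) \<and> (\<Sum>x\<in>e ` F. u x \<cdot> x) = 0"
      using dependent_finite[OF finite_imageI[OF finite_F]] by simp
    then obtain u where u: "\<exists>x\<in>e ` F. u x \<noteq> 0" "(\<Sum>x\<in>e ` F. u x \<cdot> x) = 0"
      by (elim exE conjE)
    then obtain w where w: "w \<in> F" "u (e w) \<noteq> 0" by auto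
    have "0 = (\<Sum>w\<in>F. u (e w) \<cdot> e w) w" using u(2) by (simp add: sum.reindex[OF e_inj])
    also have "\<dots> = (\<Sum>w'\<in>F. if w' = w then u (e w') else 0)"
      by (simp add: sum_fun_apply H_simps(1) fscale_apply) (auto intro: sum.cong simp: vsym_def)
    also have "\<dots> = u (e w)" using w finite_F by simp
    finally show False using w by simp
  qed
  moreover have "\<exists>a. hW H j b = a \<cdot> b" if "b \<in> e ` F" for b j using that W_e by blast
  ultimately show ?thesis
    unfolding calibrated_def using H_car by (intro exI[of _ "e ` F"]) auto
qed

lemma F_sorted: "w \<in> F \<Longrightarrow> fibre_sorted k (gam lt c) w"
  using Fset_iff[OF c] by blast

lemma wtW_differ:
  assumes "w \<in> F" "w' \<in> F" "w \<noteq> w'"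
  shows "\<exists>j\<in>{1..k}. wtW j w \<noteq> wtW j w'"
proof -
  obtain j where "j \<in> {1..k}" "gam lt c (inv w (int j)) \<noteq> gam lt c (inv w' (int j))"
    using weights_differ[OF g F_SP[OF assms(1)] F_SP[OF assms(2)] F_sorted[OF assms(1)] F_sorted[OF assms(2)]
        assms(3)] by blast
  then show ?thesis by (intro bexI[of _ j]) (auto simp: wtW_def wt_def)
qed

text \<open>The region is connected: undoing descents of \<open>w\<^sub>0 w\<^sup>-\<^sup>1\<close> leads from \<open>w\<close> to \<open>w\<^sub>0\<close> inside
  \<open>\<F>\<close>, and the off-diagonal coefficients along this path do not vanish.\<close>
lemma submodule_contains_all:
  assumes U: "submodule k H U" and w0: "w0 \<in> F" "e w0 \<in> U" and w: "w \<in> F"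
  shows "e w \<in> U"
proof -
  note sp0 = F_SP[OF w0(1)]
  have mem: "inv y \<circ> w0 \<in> F \<longleftrightarrow> y \<in> admissible k q q0 qk (wt w0)" if y: "y \<in> signed_perms k" for y
  proof -
    have "w0 \<circ> inv (inv y \<circ> w0) = y"
      using inv_sp_comp[OF sp_inv[OF y] sp0] sp0 y by (simp add: fun_eq_iff)
    then show ?thesis
      using Fset_admissible[OF c w0(1) sp_comp[OF sp_inv[OF y] sp0]] unfolding wt_def by simp
  qed
  have main: "y \<in> admissible k q q0 qk (wt w0) \<longrightarrow> e (inv y \<circ> w0) \<in> U" if "y \<in> signed_perms k" for y
    using that
  proof (induction rule: sp_induct)
    case id
    then show ?case using w0 by simp
  next
    case (descent y i)
    show ?case
    proof
      assume y: "y \<in> admissible k q q0 qk (wt w0)"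
      let ?x = "y \<circ> s i"
      note x = admissible_descent(1)[OF y wt_wtfun[OF sp0] descent.hyps(2,3)]
      have spx: "?x \<in> signed_perms k" using descent.hyps sp_comp sp_sr by blast
      let ?w' = "inv ?x \<circ> w0" and ?w = "inv y \<circ> w0"
      have w': "?w' \<in> F" "e ?w' \<in> U" using mem[OF spx] x descent.IH by blast+
      have "inv ?x = s i \<circ> inv y" using inv_sp_comp[OF descent.hyps(1) sp_sr[OF descent.hyps(2)]] by simp
      then have sw: "s i \<circ> ?w' = ?w" by (simp add: fun_eq_iff)
      have "?w \<in> F" using mem[OF descent.hyps(1)] y by blast
      then have r: "sq i ?w' \<noteq> 0" using sq_eq_0_iff[OF w'(1) descent.hyps(2)] sw by simp
      have subU: "subspace U" and TU: "hT H i ` U \<subseteq> U"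
        using U descent.hyps(2) unfolding submodule_def by auto
      have "hT H i (e ?w') - dc i (wt ?w') \<cdot> e ?w' \<in> U"
        using w'(2) TU subU by (intro subspace_diff subspace_scale) auto
      also have "hT H i (e ?w') - dc i (wt ?w') \<cdot> e ?w' = sq i ?w' \<cdot> e ?w"
        using T_e[OF w'(1), of i] unfolding sw by simp
      finally have "inverse (sq i ?w') \<cdot> sq i ?w' \<cdot> e ?w \<in> U" using subspace_scale[OF subU] by blast
      then show "e ?w \<in> U" using r by simp
    qed
  qed
  have sp: "w0 \<circ> inv w \<in> signed_perms k" using sp_comp[OF sp0 sp_inv[OF F_SP[OF w]]] .
  have "inv (w0 \<circ> inv w) \<circ> w0 = w"
    using inv_sp_comp[OF sp0 sp_inv[OF F_SP[OF w]]] sp0 F_SP[OF w] by (simp add: fun_eq_iff)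
  then show ?thesis using main[OF sp] mem[OF sp] w by simp
qed

lemma irreducible_H:
  assumes "F \<noteq> {}"
  shows "irreducible_module k q q0 qk H"
  unfolding irreducible_module_def
proof (intro conjI allI impI)
  show "hecke_module k q q0 qk H" by (rule hecke_H)
  show "hcar H \<noteq> {0}" using assms e_car e_nz by blast
  fix U assume U: "submodule k H U"
  have subU: "subspace U" "U \<subseteq> hcar H" and WU: "\<And>j. j \<le> k \<Longrightarrow> hW H j ` U \<subseteq> U"
    using U unfolding submodule_def by auto
  show "U = {0} \<or> U = hcar H"
  proof (cases "U \<subseteq> {0}")
    case True
    then show ?thesis using subspace_0[OF subU(1)] by blast
  next
    case False
    then obtain x where x: "x \<in> U" "x \<noteq> 0" by blast
    then have xH: "x \<in> hcar H" using subU by blast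
    have "\<exists>w\<in>F. x w \<noteq> 0"
    proof (rule ccontr)
      assume "\<not> ?thesis"
      then have "x = 0" using H_apply(2)[OF xH] by (auto simp: fun_eq_iff)
      then show False using x by simp
    qed
    then obtain w0 where w0: "w0 \<in> F" "x w0 \<noteq> 0" by blast
    have "x w0 \<cdot> e w0 \<in> U"
    proof (rule joint_eigenvector_components[OF finite_F subU, where J = "{1..k}" and W = "hW H"
          and x = e and l = wtW])
      show "(\<Sum>w\<in>F. x w \<cdot> e w) \<in> U" using x H_apply(1)[OF xH] by simp
    qed (use HW_lin WU W_e wtW_differ w0 in auto)
    then have "inverse (x w0) \<cdot> x w0 \<cdot> e w0 \<in> U" using subspace_scale[OF subU(1)] by blast
    then have "e w0 \<in> U" using w0 by simp
    then have "e ` F \<subseteq> U" using submodule_contains_all[OF U w0(1)] by blast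
    then have "hcar H \<subseteq> U" unfolding H_car by (rule span_minimal[OF _ subU(1)])
    then show ?thesis using subU by blast
  qed
qed

lemma e_wv: "w \<in> F \<Longrightarrow> wv z (wt w) (e w)"
  unfolding wv_def by (auto simp: W_e wtW_def)

text \<open>Every eigenvalue of \<open>W\<^sub>j\<close> is read off at a basis vector that occurs in the eigenvector.\<close>
lemma W_eigen_H:
  assumes x: "x \<in> hcar H" "hW H j x = a \<cdot> x" and w: "x w \<noteq> 0"
  shows "w \<in> F" "a = wtW j w"
proof -
  show wF: "w \<in> F" using H_apply(2)[OF x(1)] w by blast
  have "hW H j x w = (\<Sum>w'\<in>F. if w' = w then x w' * wtW j w' else 0)"
    unfolding H_simps(3) lin_ext_apply by (intro sum.cong) (auto simp: vsym_def fscale_apply)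
  also have "\<dots> = x w * wtW j w" using wF finite_F by simp
  finally show "a = wtW j w" using x(2) w by (simp add: H_simps(1) fscale_apply)
qed

lemma prod_int: "(\<Prod>j\<leftarrow>[1..<Suc k]. f (int j)) = (\<Prod>i\<in>{1..int k}. f i :: complex)"
proof -
  have "(\<Prod>j\<leftarrow>[1..<Suc k]. f (int j)) = (\<Prod>j\<in>{1..<Suc k}. f (int j))"
    using prod.distinct_set_conv_list[of "[1..<Suc k]" "\<lambda>j. f (int j)"] by (simp only: set_upt distinct_upt)
  also have "\<dots> = (\<Prod>i\<in>{1..int k}. f i)"
    by (rule prod.reindex_bij_witness[of _ nat int]) auto
  finally show ?thesis .
qed

lemma hWprod_e:
  "hWprod k H (e w) = (\<Prod>i\<in>{1..int k}. wt w i) \<cdot> e w"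
proof -
  have "foldr (hW H) js (e w) = (\<Prod>j\<leftarrow>js. wtW j w) \<cdot> e w" for js
    by (induction js) (simp_all add: linear_endoD[OF HW_lin] W_e mult.commute)
  moreover have "map (\<lambda>j. wtW j w) [1..<Suc k] = map (\<lambda>j. wt w (int j)) [1..<Suc k]"
    by (rule map_cong) (auto simp: wtW_def)
  ultimately show ?thesis unfolding hWprod_def by (simp only: prod_int)
qed

lemma hP_e:
  "hP k H (a \<cdot> e w) = (a * (z * (\<Prod>i\<in>{1..int k}. inverse (wt w i)))) \<cdot> e w"
proof -
  have "fold (hWinv H) js (a \<cdot> e w) = (a * (\<Prod>j\<leftarrow>js. inverse (wtW j w))) \<cdot> e w" for js a
    by (induction js arbitrary: a) (simp_all add: hWinv_V linear_endoD[OF V_lin] V_e mult.assoc)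
  moreover have "map (\<lambda>j. inverse (wtW j w)) [1..<Suc k] = map (\<lambda>j. inverse (wt w (int j))) [1..<Suc k]"
    by (rule map_cong) (auto simp: wtW_def)
  ultimately have "fold (hWinv H) [1..<Suc k] (a \<cdot> e w) = (a * (\<Prod>i\<in>{1..int k}. inverse (wt w i))) \<cdot> e w"
    using prod_int[of "\<lambda>i. inverse (wt w i)"] by (simp only:)
  then show ?thesis
    unfolding hP_def by (simp add: linear_endoD[OF HW_lin] W_e wtW_def mult_ac del: upt_Suc)
qed

end

section \<open>The classification\<close>

lemma exp_surj_complex:
  fixes y :: complex
  assumes "y \<noteq> 0"
  shows "\<exists>x. exp x = y"
proof -
  have "y = complex_of_real (cmod y) * cis (Arg y)"
    using rcis_cmod_Arg[of y] by (simp add: rcis_def)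
  also have "\<dots> = exp (complex_of_real (ln (cmod y)) + \<i> * complex_of_real (Arg y))"
    using assms by (simp add: exp_add cis_conv_exp exp_of_real)
  finally show ?thesis by metis
qed

context hecke_log
begin

abbreviation "labels \<equiv> skew_labels k lt r1 r2"

definition mod_of :: "complex \<times> (int \<Rightarrow> complex) \<times> (int \<Rightarrow> real) set \<Rightarrow> ((int \<Rightarrow> int) \<Rightarrow> complex) hmod" where
  "mod_of x = (case x of (z, c, J) \<Rightarrow> Hmod k q q0 qk lt r1 r2 z c J)"

lemma lt_nz: "lt \<noteq> 0"
  using exp_lt q2(1) by auto

lemma skew_region_iff:
  "skew_region k q q0 qk lt r1 r2 z c J \<longleftrightarrow> z \<noteq> 0 \<and> skew_local_region k lt r1 r2 c J"
  using hecke_log_axioms by (auto simp: skew_region_def skew_region_axioms_def)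

lemma mod_of_label:
  assumes "x \<in> labels C"
  shows "irreducible_module k q q0 qk (mod_of x)" "calibrated k (mod_of x)"
    "hecke_module k q q0 qk (mod_of x)"
proof -
  obtain z c J where x: "x = (z, c, J)" "z \<noteq> 0" "skew_local_region k lt r1 r2 c J" "Fset k lt r1 r2 c J \<noteq> {}"
    using assms by (auto simp: skew_labels_def)
  interpret skew_region k q q0 qk lt r1 r2 z c J using x by (simp add: skew_region_iff)
  show "irreducible_module k q q0 qk (mod_of x)" "calibrated k (mod_of x)"
    "hecke_module k q q0 qk (mod_of x)"
    using irreducible_H calibrated_H hecke_H x by (simp_all add: mod_of_def)
qed

lemma exists_weight_vector:
  fixes M :: "('v::ab_group_add) hmod"
  assumes M: "irreducible_module k q q0 qk M" "calibrated k M"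
  shows "\<exists>z c v. z \<noteq> 0 \<and> c \<in> cvecs k \<and> based k q q0 qk M z (gam lt c) v"
proof -
  interpret calib k q q0 qk M
    using M by unfold_locales (auto simp: irreducible_module_def)
  obtain B where B: "B \<subseteq> hcar M" "independent B" "span B = hcar M"
    and eig: "\<forall>b\<in>B. \<forall>j\<le>k. \<exists>a. hW M j b = a \<cdot> b"
    using calibrated unfolding calibrated_def by blast
  have "B \<noteq> {}" using B(3) M(1) by (auto simp: irreducible_module_def)
  then obtain v where v: "v \<in> B" by blast
  have vcar: "v \<in> hcar M" and vnz: "v \<noteq> 0" using v B dependent_zero by blast+
  have "\<forall>j. \<exists>a. j \<le> k \<longrightarrow> hW M j v = a \<cdot> v" using eig v by blast
  then obtain a where a: "\<And>j. j \<le> k \<Longrightarrow> hW M j v = a j \<cdot> v" by metis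
  have anz: "a j \<noteq> 0" if "j \<le> k" for j using eigenvalue_nz[OF that vcar vnz a[OF that]] .
  have "\<forall>j. \<exists>x. j \<le> k \<longrightarrow> exp x = - a j" using exp_surj_complex anz by (metis neg_equal_0_iff_equal)
  then obtain l where l: "\<And>j. j \<le> k \<Longrightarrow> exp (l j) = - a j" by metis
  define c :: "int \<Rightarrow> complex" where
    "c i = (if 1 \<le> i \<and> i \<le> int k then l (nat i) / lt
            else if 1 \<le> - i \<and> - i \<le> int k then - (l (nat (- i)) / lt) else 0)" for i
  have c: "c \<in> cvecs k" by (auto simp: cvecs_def c_def)
  have "gam lt c (int j) = a j" if "1 \<le> j" "j \<le> k" for j
    using that l lt_nz by (simp add: gam_def tpow_def c_def)
  then have "wv (a 0) (gam lt c) v" using vcar a by (auto simp: wv_def)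
  then have "based k q q0 qk M (a 0) (gam lt c) v"
    using vnz wtfun_gam[OF c] M(1) by unfold_locales auto
  then show ?thesis using c anz[of 0] by blast
qed

text \<open>Let \<open>d\<close> be a weight of \<open>M\<close>.  It has the form \<open>\<gamma> \<circ> w\<^sub>0\<^sup>-\<^sup>1\<close> with \<open>\<gamma>\<close> given by the representative \<open>c\<close> of
  its orbit, and \<open>w\<^sub>0\<close> determines \<open>J\<close>.  The weights of \<open>M\<close> are those of the region \<open>(c, J)\<close>, which is
  therefore skew; so the module of \<open>(z, c, J)\<close> is available and shares the weight \<open>(z, d)\<close> with
  \<open>M\<close>.\<close>
lemma label_exists:
  fixes M :: "('v::ab_group_add) hmod"
  assumes M: "irreducible_module k q q0 qk M" "calibrated k M" and C: "orbit_representatives k lt C"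
  shows "\<exists>x\<in>labels C. hmod_iso k M (mod_of x)"
proof -
  obtain z c0 v where z: "z \<noteq> 0" and c0: "c0 \<in> cvecs k" and based: "based k q q0 qk M z (gam lt c0) v"
    using exists_weight_vector[OF M] by blast
  obtain c where c: "c \<in> C" "same_orbit k lt c0 c" using C c0 unfolding orbit_representatives_def by blast
  then have cv: "c \<in> cvecs k" using C unfolding orbit_representatives_def by blast
  obtain u where u: "u \<in> signed_perms k" "\<And>i. same_pow lt (act u c0 i) (c i)"
    using c(2) unfolding same_orbit_def by blast
  have g0: "gam lt c0 = gam lt c \<circ> u"
  proof
    fix i
    have "same_pow lt (act u c0 (u i)) (c (u i))" by (rule u(2))
    then show "gam lt c0 i = (gam lt c \<circ> u) i" using u(1) by (simp add: act_def same_pow_def gam_def)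
  qed
  \<comment> \<open>Among the elements that carry \<open>c\<close> to the given weight, exactly one has
    \<open>R(w) \<inter> Z(c) = \<emptyset>\<close>; it determines \<open>J\<close>.\<close>
  obtain w0 where w0: "w0 \<in> signed_perms k" "fibre_sorted k (gam lt c) w0" "gam lt c \<circ> inv w0 = gam lt c0"
    using fibre_sorted_exists[OF sp_inv[OF u(1)], of "gam lt c"] wtfunD(1)[OF wtfun_gam[OF cv]] u(1)
    unfolding g0 by auto
  define J where "J = pair_roots k (\<lambda>a b. w0 a > w0 b \<and> adjc (gam lt c) a b)"
  have w0F: "w0 \<in> Fset k lt r1 r2 c J" using w0 by (simp add: Fset_iff[OF cv] J_def)
  have "J \<subseteq> Pset k lt r1 r2 c" unfolding J_def Pset_roots[OF cv] pair_roots_def by blast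
  then have local: "local_region k lt r1 r2 c J" using cv by (simp add: local_region_def)
  interpret M: based k q q0 qk M z "gam lt c0" v by (rule based)
  have "regular (gam lt c \<circ> inv w)" if w: "w \<in> Fset k lt r1 r2 c J" for w
  proof -
    have "w0 \<circ> inv w \<in> M.Adm"
      using Fset_admissible[OF cv w0F Fset_SP[OF w]] w w0(3) by simp
    from M.Adm_regular[OF this] have "regular (gam lt c \<circ> inv w0 \<circ> (w0 \<circ> inv w))" unfolding w0(3) .
    moreover have "gam lt c \<circ> inv w0 \<circ> (w0 \<circ> inv w) = gam lt c \<circ> inv w"
      using w0(1) by (simp add: fun_eq_iff)
    ultimately show ?thesis by simp
  qed
  then have skew: "skew_local_region k lt r1 r2 c J" using local skew_iff[OF cv] by blast
  interpret R: skew_region k q q0 qk lt r1 r2 z c J using z skew by (simp add: skew_region_iff)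
  have F: "R.F \<noteq> {}" using w0F by blast
  have "R.wv z (gam lt c0) (R.e w0)" using R.e_wv[OF w0F] unfolding R.wt_def w0(3) .
  then have "based k q q0 qk R.H z (gam lt c0) (R.e w0)"
    using R.calibrated_H R.irreducible_H[OF F] R.e_nz[OF w0F] M.d by unfold_locales auto
  from irreducible_iso_if_common_weight[OF based this]
  have "hmod_iso k M (mod_of (z, c, J))" by (simp add: mod_of_def)
  moreover have "(z, c, J) \<in> labels C" using z c(1) skew F by (simp add: skew_labels_def)
  ultimately show ?thesis by blast
qed

text \<open>An isomorphism maps \<open>v\<^sub>w\<close> to a weight vector of the same weight.  This weight determines \<open>z\<close>, the
  orbit and hence \<open>c\<close>, then \<open>w\<close> as the unique element with \<open>R(w) \<inter> Z(c) = \<emptyset>\<close> of this weight, and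
  \<open>J = R(w) \<inter> P(c)\<close>.\<close>
lemma label_unique:
  assumes x: "x \<in> labels C" and x': "x' \<in> labels C" and iso: "hmod_iso k (mod_of x) (mod_of x')"
    and C: "orbit_representatives k lt C"
  shows "x = x'"
proof -
  obtain z c J where zcJ: "x = (z, c, J)" "z \<noteq> 0" "c \<in> C" "skew_local_region k lt r1 r2 c J"
    "Fset k lt r1 r2 c J \<noteq> {}" using x by (auto simp: skew_labels_def)
  obtain z' c' J' where zcJ': "x' = (z', c', J')" "z' \<noteq> 0" "c' \<in> C" "skew_local_region k lt r1 r2 c' J'"
    using x' by (auto simp: skew_labels_def)
  interpret A: skew_region k q q0 qk lt r1 r2 z c J using zcJ by (simp add: skew_region_iff)
  interpret B: skew_region k q q0 qk lt r1 r2 z' c' J' using zcJ' by (simp add: skew_region_iff)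
  obtain w where w: "w \<in> A.F" using zcJ by blast
  obtain f where f: "bij_betw f (hcar A.H) (hcar B.H)"
    and fs: "\<forall>a. \<forall>y\<in>hcar A.H. f (hscl A.H a y) = hscl B.H a (f y)"
    and fW: "\<forall>j\<le>k. \<forall>y\<in>hcar A.H. f (hW A.H j y) = hW B.H j (f y)"
    using iso zcJ(1) zcJ'(1) unfolding hmod_iso_def mod_of_def by auto
  let ?y = "f (A.e w)"
  have ycar: "?y \<in> hcar B.H" using f A.e_car by (rule bij_betwE[THEN bspec])
  have "f 0 = 0" using fs[rule_format, of 0 0] by simp
  then have "?y \<noteq> 0" using A.e_nz[OF w] f A.e_car[of w] A.car_simps(1) unfolding bij_betw_def inj_on_def by metis
  then obtain u where u: "?y u \<noteq> 0" by (auto simp: fun_eq_iff)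
  have yW: "hW B.H j ?y = hscl B.H (A.wtW j w) ?y" if "j \<le> k" for j
  proof -
    have "hW B.H j ?y = f (hW A.H j (A.e w))" using fW that by simp
    also have "\<dots> = f (hscl A.H (A.wtW j w) (A.e w))" by (simp only: A.W_e)
    also have "\<dots> = hscl B.H (A.wtW j w) ?y" using fs A.e_car by blast
    finally show ?thesis .
  qed
  note eigen = B.W_eigen_H[where x = ?y and w = u, OF ycar _ u]
  have uF: "u \<in> B.F" by (rule eigen(1)[OF yW[of 0]]) simp
  have eq: "A.wtW j w = B.wtW j u" if "j \<le> k" for j by (rule eigen(2)[OF yW[OF that]])
  have zz: "z = z'" using eq[of 0] by (simp add: A.wtW_def B.wtW_def)
  note sw = A.F_SP[OF w] and su = B.F_SP[OF uF]
  have pos: "gam lt c (inv w (int j)) = gam lt c' (inv u (int j))" if "1 \<le> j" "j \<le> k" for j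
    using eq[OF that(2)] that(1) by (simp add: A.wtW_def B.wtW_def A.wt_def B.wt_def)
  have wts: "gam lt c (inv w i) = gam lt c' (inv u i)" for i
  proof -
    consider "1 \<le> i" "i \<le> int k" | "1 \<le> - i" "- i \<le> int k" | "i \<notin> idx k" by (force simp: idx_def)
    then show ?thesis
    proof cases
      case 1
      then show ?thesis using pos[of "nat i"] by auto
    next
      case 2
      then have "gam lt c (inv w (- i)) = gam lt c' (inv u (- i))" using pos[of "nat (- i)"] by auto
      then show ?thesis
        using wtfunD(1)[OF A.g] wtfunD(1)[OF B.g] sp_neg[OF sp_inv[OF sw], of i] sp_neg[OF sp_inv[OF su], of i]
        by simp
    next
      case 3
      have zero: "c i = 0" if "c \<in> cvecs k" for c :: "int \<Rightarrow> complex"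
      proof (cases "i = 0")
        case True
        have "c (- 0) = - c 0" using that unfolding cvecs_def by blast
        then show ?thesis using True by simp
      next
        case False
        then show ?thesis using 3 that by (auto simp: cvecs_def idx_def)
      qed
      then show ?thesis
        using zero[OF A.c] zero[OF B.c] sp_out[OF sp_inv[OF sw] 3] sp_out[OF sp_inv[OF su] 3]
        by (simp add: gam_def)
    qed
  qed
  have "same_orbit k lt c c'"
    unfolding same_orbit_def
  proof (intro bexI allI)
    show "inv u \<circ> w \<in> signed_perms k" using sp_comp[OF sp_inv[OF su] sw] .
    fix i
    have "inv (inv u \<circ> w) = inv w \<circ> u" using inv_sp_comp[OF sp_inv[OF su] sw] su by simp
    then have "gam lt c (inv (inv u \<circ> w) i) = gam lt c' i" using wts[of "u i"] su by simp
    then show "same_pow lt (act (inv u \<circ> w) c i) (c' i)" by (simp add: same_pow_def act_def gam_def)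
  qed
  moreover have "same_orbit k lt c c"
    unfolding same_orbit_def by (rule bexI[of _ id]) (simp_all add: same_pow_def act_def)
  moreover have "\<exists>!c'. c' \<in> C \<and> same_orbit k lt c c'"
    using C A.c unfolding orbit_representatives_def by blast
  ultimately have cc: "c = c'" using zcJ(3) zcJ'(3) by blast
  have "w = u"
    using fibre_sorted_unique[OF sw su A.F_sorted[OF w]] B.F_sorted[OF uF] wts unfolding cc by blast
  then have "J = J'"
    using w uF Fset_iff[OF A.c, of w J] Fset_iff[OF B.c, of u J'] unfolding cc by simp
  then show ?thesis using zz cc zcJ(1) zcJ'(1) by simp
qed

theorem classification:
  fixes M :: "('v::ab_group_add) hmod"
  assumes M: "irreducible_module k q q0 qk M" "calibrated k M" and C: "orbit_representatives k lt C"
  shows "\<exists>!x. x \<in> labels C \<and> hmod_iso k M (mod_of x)"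
proof (rule ex_ex1I)
  show "\<exists>x. x \<in> labels C \<and> hmod_iso k M (mod_of x)" using label_exists[OF M C] by blast
  interpret hecke_mod k q q0 qk M using M by unfold_locales (auto simp: irreducible_module_def)
  fix x y assume "x \<in> labels C \<and> hmod_iso k M (mod_of x)" "y \<in> labels C \<and> hmod_iso k M (mod_of y)"
  then show "x = y"
    using label_unique[OF _ _ hmod_iso_trans[OF hmod_iso_sym] C] by blast
qed

lemma iso_class_eq_iff:
  fixes M N :: "('v::ab_group_add) hmod"
  assumes "hecke_module k q q0 qk M" "hecke_module k q q0 qk N"
  shows "iso_class k q q0 qk M = iso_class k q q0 qk N \<longleftrightarrow> hmod_iso k M N"
proof -
  interpret M: hecke_mod k q q0 qk M using assms(1) by unfold_locales
  show ?thesis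
  proof
    assume "iso_class k q q0 qk M = iso_class k q q0 qk N"
    moreover have "N \<in> iso_class k q q0 qk N" using assms(2) hmod_iso_refl by (simp add: iso_class_def)
    ultimately have "N \<in> iso_class k q q0 qk M" by simp
    then show "hmod_iso k M N" by (simp add: iso_class_def)
  next
    assume i: "hmod_iso k M N"
    have "hmod_iso k M P \<longleftrightarrow> hmod_iso k N P" for P :: "'v hmod"
      using hmod_iso_trans[OF i] hmod_iso_trans[OF M.hmod_iso_sym[OF i]] by blast
    then show "iso_class k q q0 qk M = iso_class k q q0 qk N" by (simp add: iso_class_def)
  qed
qed

lemma classes_bij:
  assumes C: "orbit_representatives k lt C"
  shows "bij_betw (\<lambda>x. iso_class k q q0 qk (mod_of x)) (labels C)
    (iso_class k q q0 qk ` {M :: ((int \<Rightarrow> int) \<Rightarrow> complex) hmod.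
       irreducible_module k q q0 qk M \<and> calibrated k M})" (is "bij_betw ?f _ (_ ` ?I)")
  unfolding bij_betw_def
proof (intro conjI equalityI subsetI)
  show "inj_on ?f (labels C)"
  proof (rule inj_onI)
    fix x y assume "x \<in> labels C" "y \<in> labels C" "?f x = ?f y"
    then show "x = y" using label_unique[OF _ _ _ C] iso_class_eq_iff mod_of_label(3) by blast
  qed
  show "X \<in> iso_class k q q0 qk ` ?I" if "X \<in> ?f ` labels C" for X
    using that mod_of_label by blast
  show "X \<in> ?f ` labels C" if X: "X \<in> iso_class k q q0 qk ` ?I" for X
  proof -
    obtain M where M: "M \<in> ?I" "X = iso_class k q q0 qk M" using X by blast
    obtain x where x: "x \<in> labels C" "hmod_iso k M (mod_of x)" using label_exists[OF _ _ C] M(1) by blast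
    have "hecke_module k q q0 qk M" using M(1) by (simp add: irreducible_module_def)
    then have "X = ?f x" using iso_class_eq_iff mod_of_label(3)[OF x(1)] x(2) M(2) by blast
    then show ?thesis using x(1) by blast
  qed
qed

lemma construction:
  assumes "z \<noteq> 0" "skew_local_region k lt r1 r2 c J"
  shows "let F = Fset k lt r1 r2 c J; v = vsym F; M = Hmod k q q0 qk lt r1 r2 z c J in
           hecke_module k q q0 qk M \<and>
           (F \<noteq> {} \<longrightarrow> irreducible_module k q q0 qk M) \<and>
           (\<forall>w\<in>F.
              hP k M (hWprod k M (v w)) = fscale z (v w) \<and>
              hP k M (v w) =
                fscale (z * (\<Prod>i\<in>{1..int k}. inverse (gam lt c (inv w i)))) (v w))"
proof -
  interpret skew_region k q q0 qk lt r1 r2 z c J using assms by (simp add: skew_region_iff)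
  have 1: "hP k H (e w) = fscale (z * (\<Prod>i\<in>{1..int k}. inverse (gam lt c (inv w i)))) (e w)" for w
    using hP_e[of 1 w] by (simp add: wt_def H_simps(1)[symmetric])
  have 2: "hP k H (hWprod k H (e w)) = fscale z (e w)" if w: "w \<in> F" for w
  proof -
    have "(\<Prod>i\<in>{1..int k}. wt w i) * (z * (\<Prod>i\<in>{1..int k}. inverse (wt w i)))
        = z * (\<Prod>i\<in>{1..int k}. wt w i * inverse (wt w i))"
      by (simp add: prod.distrib mult_ac)
    also have "\<dots> = z" using wtfunD(2)[OF wt_wtfun[OF F_SP[OF w]]] by simp
    finally have "(\<Prod>i\<in>{1..int k}. wt w i) * (z * (\<Prod>i\<in>{1..int k}. inverse (wt w i))) = z" .
    then show ?thesis unfolding hWprod_e hP_e by (simp only: H_simps(1))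
  qed
  show ?thesis unfolding Let_def using hecke_H irreducible_H 1 2 by blast
qed

end

theorem theorem3p3:
  fixes k :: nat and q q0 qk tau r1 r2 :: complex
  assumes "k \<ge> 1"
    and "q \<noteq> 0" "q0 \<noteq> 0" "qk \<noteq> 0"
    and "\<forall>n::nat. n \<ge> 1 \<longrightarrow> q ^ n \<noteq> 1"
    and "q0 * qk \<notin> {1, - 1, q, inverse q, - q, - inverse q,
                      q ^ 2, inverse (q ^ 2), - (q ^ 2), - inverse (q ^ 2)}"
    and "- (inverse q0 * qk) \<notin> {1, - 1, q, inverse q, - q, - inverse q,
                      q ^ 2, inverse (q ^ 2), - (q ^ 2), - inverse (q ^ 2)}"
    and "q0 * qk \<noteq> - (inverse q0 * qk)"
    and "q0 * qk \<noteq> inverse (- (inverse q0 * qk))"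
    and "exp (tau / 2) = q"
    and "- tpow tau r1 = - (qk * inverse q0)"
    and "- tpow tau r2 = qk * q0"
  shows
    \<comment> \<open>(a)\<close>
    "(\<forall>z c J. z \<noteq> 0 \<and> skew_local_region k tau r1 r2 c J \<longrightarrow>
        (let F = Fset k tau r1 r2 c J; v = vsym F; M = Hmod k q q0 qk tau r1 r2 z c J in
           hecke_module k q q0 qk M \<and>
           (F \<noteq> {} \<longrightarrow> irreducible_module k q q0 qk M) \<and>
           (\<forall>w\<in>F.
              hP k M (hWprod k M (v w)) = fscale z (v w) \<and>
              hP k M (v w) =
                fscale (z * (\<Prod>i\<in>{1..int k}. inverse (gam tau c (inv w i)))) (v w))))
     \<and>
    \<comment> \<open>(b), one representative \<open>c\<close> for each orbit\<close>
     (\<forall>C. orbit_representatives k tau C \<longrightarrow>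
        bij_betw (\<lambda>(z, c, J). iso_class k q q0 qk (Hmod k q q0 qk tau r1 r2 z c J))
          (skew_labels k tau r1 r2 C)
          (iso_class k q q0 qk ` {M :: ((int \<Rightarrow> int) \<Rightarrow> complex) hmod.
             irreducible_module k q q0 qk M \<and> calibrated k M})
        \<and>
        (\<forall>M :: ('v::ab_group_add) hmod. irreducible_module k q q0 qk M \<and> calibrated k M \<longrightarrow>
           (\<exists>!x. x \<in> skew_labels k tau r1 r2 C \<and>
              hmod_iso k M (case x of (z, c, J) \<Rightarrow> Hmod k q q0 qk tau r1 r2 z c J))))"
proof -
  interpret hecke_log k q q0 qk tau r1 r2
    using assms by (intro hecke_log.intro hecke_params.intro hecke_log_axioms.intro)
  have "(\<lambda>(z, c, J). iso_class k q q0 qk (Hmod k q q0 qk tau r1 r2 z c J))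
      = (\<lambda>x. iso_class k q q0 qk (mod_of x))"
    by (auto simp: fun_eq_iff mod_of_def)
  note bij = classes_bij[folded this]
  note unique = classification[unfolded mod_of_def]
  show ?thesis
    by (intro conjI allI impI; (elim conjE)?; (rule construction bij unique; assumption))
qed

end
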